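(* Let $H$ be the normal distribution with mean $\mu_H$ and variance $\sigma_H^2$. Let $\Pi=\Pi_n$ be the Dirichlet process mixture prior on densities on $\mathbb R$ induced by $$q(x)=\int\phi_{\sigma_n}(x-z)\,dG(z),\qquad G\sim\mathrm{DP}(\alpha H),$$ with $\alpha>1$ and $\sigma_n=n^{-1/5}$. Also, suppose that $p_0$ is twice continuously differentiable with a sub-Gaussian tail, and satisfies $$\int\Big\{\Big(\frac{p_0''}{p_0}\Big)^2+\Big(\frac{p_0'}{p_0}\Big)^4\Big\}\,dP_0<\infty.$$ Then, for any $p$ with $1\le p<4$, there exists a constant $K$ such that $$\Pi_n\big(M_p(P)\le K\mid X_1,\ldots,X_n\big)\to1\quad\text{in probability.}$$
   Context: Setting: $X_1,X_2,\ldots$ are i.i.d. real random variables from a true distribution $P_0$ having a Lebesgue density $p_0$ on $\mathbb R$. Given a prior $\Pi_n$ on densities, the posterior probability of a measurable set $A$ of densities is $$\Pi_n(A\mid X_1,\ldots,X_n)=\frac{\int_A\prod_{i=1}^n q(X_i)/p_0(X_i)\,d\Pi_n(q)}{\int\prod_{i=1}^n q(X_i)/p_0(X_i)\,d\Pi_n(q)}.$$ A density is identified with its probability measure, and $P$ inside $\Pi_n(\cdot\mid X_1,\ldots,X_n)$ denotes the random probability measure whose density is drawn from the posterior. Convergence in probability is with respect to the true distribution $P_0$ of the data, as $n\to\infty$. The constant $K$ does not depend on $n$. Notation: $M_p(P)=\int|x|^p\,dP(x)$; $\phi$ is the standard normal density and $\phi_\sigma(x)=\sigma^{-1}\phi(x/\sigma)$;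 $\mathrm{DP}(\alpha H)$ is the Dirichlet process with base measure $\alpha H$ (total mass $\alpha$). Sub-Gaussian tail: there are constants $C,c>0$ with $P_0(\{|x|>t\})\le Ce^{-ct^2}$ for all $t>0$. *)

theory Defs
  imports "HOL-Probability.Probability"
begin

section \<open>The Dirichlet process\<close>

text \<open>The Gamma distribution with shape \<open>a\<close> and scale 1. For shape 0 it is the point mass at 0,
  so that partitions into sets of which some have base measure 0 need no separate treatment.\<close>

definition gamma_distribution :: "real \<Rightarrow> real measure" where
  "gamma_distribution a =
     (if a = 0 then return borel 0
      else density lborel
        (\<lambda>x. ennreal (if 0 < x then x powr (a - 1) * exp (- x) / Gamma a else 0)))"

text \<open>Law of \<open>(Z\<^sub>i / (\<Sum>j\<in>I. Z\<^sub>j))\<close> over \<open>i \<in> I\<close>, with independent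
  \<open>Z\<^sub>i \<sim> Gamma(a i, 1)\<close> (Ferguson's definition); the parameters are
  nonnegative and not all 0.\<close>

definition dirichlet_distribution :: "'i set \<Rightarrow> ('i \<Rightarrow> real) \<Rightarrow> ('i \<Rightarrow> real) measure" where
  "dirichlet_distribution I a =
     distr (PiM I (\<lambda>i. gamma_distribution (a i))) (PiM I (\<lambda>_. borel))
       (\<lambda>z. \<lambda>i\<in>I. z i / (\<Sum>j\<in>I. z j))"

text \<open>\<open>D\<close> is the law of a random probability measure, and \<open>A\<close> is the finite base measure
  (its total mass included).\<close>

definition is_dirichlet_process :: "'a measure \<Rightarrow> 'a measure measure \<Rightarrow> bool" where
  "is_dirichlet_process A D \<longleftrightarrow>
     D \<in> space (prob_algebra (prob_algebra A)) \<and>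
     (\<forall>(k::nat) B.
        (\<forall>i<k. B i \<in> sets A) \<and> disjoint_family_on B {..<k} \<and> (\<Union>i<k. B i) = space A \<longrightarrow>
        distr D (PiM {..<k} (\<lambda>_. borel)) (\<lambda>G. \<lambda>i\<in>{..<k}. measure G (B i)) =
        dirichlet_distribution {..<k} (\<lambda>i. measure A (B i)))"

section \<open>Densities on the real line\<close>

definition densities :: "(real \<Rightarrow> real) set" where
  "densities = {q. q \<in> borel_measurable borel \<and> (\<forall>x. 0 \<le> q x) \<and> (\<integral>\<^sup>+x. ennreal (q x) \<partial>lborel) = 1}"

definition prob_of :: "(real \<Rightarrow> real) \<Rightarrow> real measure" where
  "prob_of q = density lborel (\<lambda>x. ennreal (q x))"

text \<open>The smallest \<open>\<sigma>\<close>-algebra on densities that makes the identification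
  \<open>q \<mapsto> prob_of q\<close> and all point evaluations \<open>q \<mapsto> q x\<close> (hence the likelihood) measurable.\<close>

definition density_space :: "(real \<Rightarrow> real) measure" where
  "density_space =
     vimage_algebra densities (\<lambda>q. (prob_of q, q)) (prob_algebra borel \<Otimes>\<^sub>M PiM UNIV (\<lambda>_. borel))"

definition abs_moment :: "real \<Rightarrow> real measure \<Rightarrow> ennreal" where
  "abs_moment p P = (\<integral>\<^sup>+x. ennreal (\<bar>x\<bar> powr p) \<partial>P)"

definition sub_gaussian_tail :: "real measure \<Rightarrow> bool" where
  "sub_gaussian_tail P \<longleftrightarrow>
     (\<exists>C>0. \<exists>c>0. \<forall>t>0. measure P {x. t < \<bar>x\<bar>} \<le> C * exp (- c * t\<^sup>2))"

section \<open>Normal mixture priors and posteriors\<close>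

definition normal_mixture :: "real \<Rightarrow> real measure \<Rightarrow> real \<Rightarrow> real" where
  "normal_mixture \<sigma> G x = (\<integral>z. normal_density 0 \<sigma> (x - z) \<partial>G)"

definition normal_mixture_prior :: "real measure measure \<Rightarrow> real \<Rightarrow> (real \<Rightarrow> real) measure" where
  "normal_mixture_prior D \<sigma> = distr D density_space (normal_mixture \<sigma>)"

definition likelihood_ratio :: "(real \<Rightarrow> real) \<Rightarrow> nat \<Rightarrow> (nat \<Rightarrow> real) \<Rightarrow> (real \<Rightarrow> real) \<Rightarrow> real" where
  "likelihood_ratio p0 n x q = (\<Prod>i=1..n. q (x i) / p0 (x i))"

definition posterior ::
    "(real \<Rightarrow> real) measure \<Rightarrow> (real \<Rightarrow> real) \<Rightarrow> nat \<Rightarrow> (nat \<Rightarrow> real) \<Rightarrow> (real \<Rightarrow> real) set \<Rightarrow> real" where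
  "posterior Q p0 n x A =
     enn2real ((\<integral>\<^sup>+q\<in>A. ennreal (likelihood_ratio p0 n x q) \<partial>Q) /
               (\<integral>\<^sup>+q. ennreal (likelihood_ratio p0 n x q) \<partial>Q))"

text \<open>Random variables only: without the measurability clause, \<open>measure\<close> would be 0 on
  non-measurable events.\<close>

definition converges_in_probability :: "'a measure \<Rightarrow> (nat \<Rightarrow> 'a \<Rightarrow> real) \<Rightarrow> real \<Rightarrow> bool" where
  "converges_in_probability M Y c \<longleftrightarrow>
     (\<forall>n. Y n \<in> borel_measurable M) \<and>
     (\<forall>\<epsilon>>0. (\<lambda>n. measure M {\<omega>\<in>space M. \<epsilon> < \<bar>Y n \<omega> - c\<bar>}) \<longlonglongrightarrow> 0)"

section \<open>The notions above are measurable\<close>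

lemma space_density_space [simp]: "space density_space = densities"
  by (simp add: density_space_def)

lemma prob_of_in_prob_algebra: "q \<in> densities \<Longrightarrow> prob_of q \<in> space (prob_algebra borel)"
  by (auto simp: densities_def prob_of_def space_prob_algebra emeasure_density intro!: prob_spaceI)

lemma measurable_density_space_pair:
  "(\<lambda>q. (prob_of q, q)) \<in> density_space \<rightarrow>\<^sub>M prob_algebra borel \<Otimes>\<^sub>M PiM UNIV (\<lambda>_. borel)"
  unfolding density_space_def
  by (rule measurable_vimage_algebra1)
     (auto simp: space_pair_measure space_PiM prob_of_in_prob_algebra)

lemma measurable_prob_of [measurable]: "prob_of \<in> density_space \<rightarrow>\<^sub>M prob_algebra borel"
  using measurable_compose[OF measurable_density_space_pair measurable_fst] by simp

lemma measurable_density_eval: "(\<lambda>q. q x) \<in> borel_measurable density_space"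
proof -
  have "(\<lambda>q. q) \<in> density_space \<rightarrow>\<^sub>M PiM UNIV (\<lambda>_::real. borel :: real measure)"
    using measurable_compose[OF measurable_density_space_pair measurable_snd] by simp
  from measurable_compose[OF this measurable_component_singleton[of x]] show ?thesis by simp
qed

lemma sets_moment_le [measurable]:
  "{q\<in>densities. abs_moment p (prob_of q) \<le> c} \<in> sets density_space"
proof -
  have "(\<lambda>P. abs_moment p P) \<in> borel_measurable (prob_algebra borel)"
    unfolding abs_moment_def prob_algebra_def
    by (intro measurable_restrict_space1 nn_integral_measurable_subprob_algebra) measurable
  from measurable_compose[OF measurable_prob_of this]
  have "{q\<in>space density_space. abs_moment p (prob_of q) \<le> c} \<in> sets density_space"
    by measurable
  then show ?thesis by simp
qed

lemma normal_mixture_joint [measurable]: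
  "(\<lambda>(G, x). normal_mixture \<sigma> G x) \<in> borel_measurable (prob_algebra borel \<Otimes>\<^sub>M borel)"
proof -
  have [measurable]: "fst \<in> (prob_algebra borel \<Otimes>\<^sub>M (borel :: real measure)) \<rightarrow>\<^sub>M subprob_algebra (borel :: real measure)"
    by (rule measurable_prob_algebraD) measurable
  have "(\<lambda>w. \<integral>\<^sup>+z. ennreal (normal_density 0 \<sigma> (snd w - z)) \<partial>fst w)
      \<in> borel_measurable (prob_algebra borel \<Otimes>\<^sub>M (borel :: real measure))"
    by (rule nn_integral_measurable_subprob_algebra2[where N = borel]) measurable
  then have *: "(\<lambda>w. enn2real (\<integral>\<^sup>+z. ennreal (normal_density 0 \<sigma> (snd w - z)) \<partial>fst w))
      \<in> borel_measurable (prob_algebra borel \<Otimes>\<^sub>M (borel :: real measure))"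
    by measurable
  have "(\<lambda>(G, x). normal_mixture \<sigma> G x) w
      = enn2real (\<integral>\<^sup>+z. ennreal (normal_density 0 \<sigma> (snd w - z)) \<partial>fst w)"
    if "w \<in> space (prob_algebra borel \<Otimes>\<^sub>M (borel :: real measure))" for w
  proof -
    have "(\<lambda>z. normal_density 0 \<sigma> (snd w - z)) \<in> borel_measurable borel"
      by measurable
    moreover have "sets (fst w) = sets borel"
      using measurable_space[OF measurable_fst that] by (simp add: space_prob_algebra)
    ultimately have "(\<lambda>z. normal_density 0 \<sigma> (snd w - z)) \<in> borel_measurable (fst w)"
      by (subst measurable_cong_sets[OF _ refl])
    then show ?thesis
      unfolding normal_mixture_def split_beta' by (rule integral_eq_nn_integral) simp
  qed
  then show ?thesis
    by (subst measurable_cong) (assumption, rule *)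
qed

lemma normal_mixture_density:
  assumes G: "G \<in> space (prob_algebra borel)" and "0 < \<sigma>"
  shows "normal_mixture \<sigma> G \<in> densities"
proof -
  from G interpret G: prob_space G by (simp add: space_prob_algebra)
  from G have [measurable_cong]: "sets G = sets borel" by (simp add: space_prob_algebra)
  interpret pair_sigma_finite lborel G ..
  have meas: "normal_mixture \<sigma> G \<in> borel_measurable borel"
    using measurable_compose[OF measurable_Pair1'[OF G] normal_mixture_joint] by simp
  have bnd: "normal_density 0 \<sigma> y \<le> 1 / sqrt (2 * pi * \<sigma>\<^sup>2)" for y
    by (simp add: normal_density_def divide_right_mono)
  have int: "integrable G (\<lambda>z. normal_density 0 \<sigma> (x - z))" for x
    using bnd by (intro G.integrable_const_bound[where B = "1 / sqrt (2 * pi * \<sigma>\<^sup>2)"]) simp_all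
  have "(\<integral>\<^sup>+x. ennreal (normal_mixture \<sigma> G x) \<partial>lborel)
      = (\<integral>\<^sup>+x. \<integral>\<^sup>+z. ennreal (normal_density 0 \<sigma> (x - z)) \<partial>G \<partial>lborel)"
    unfolding normal_mixture_def by (simp add: nn_integral_eq_integral[OF int])
  also have "\<dots> = (\<integral>\<^sup>+z. \<integral>\<^sup>+x. ennreal (normal_density 0 \<sigma> (x - z)) \<partial>lborel \<partial>G)"
    by (rule Fubini'[symmetric]) measurable
  also have "\<dots> = (\<integral>\<^sup>+z. 1 \<partial>G)"
  proof (rule nn_integral_cong)
    fix z
    have "normal_density 0 \<sigma> (x - z) = normal_density z \<sigma> x" for x
      by (simp add: normal_density_def)
    then show "(\<integral>\<^sup>+x. ennreal (normal_density 0 \<sigma> (x - z)) \<partial>lborel) = 1"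
      using prob_space.emeasure_space_1[OF prob_space_normal_density[OF \<open>0 < \<sigma>\<close>, of z]]
      by (simp add: emeasure_density)
  qed
  finally show ?thesis
    using meas by (simp add: densities_def normal_mixture_def G.emeasure_space_1)
qed

lemma measurable_normal_mixture:
  assumes "0 < \<sigma>"
  shows "normal_mixture \<sigma> \<in> prob_algebra borel \<rightarrow>\<^sub>M density_space"
  unfolding density_space_def
proof (rule measurable_vimage_algebra2)
  show "normal_mixture \<sigma> \<in> space (prob_algebra borel) \<rightarrow> densities"
    using normal_mixture_density assms by auto
  have ev: "normal_mixture \<sigma> \<in> prob_algebra borel \<rightarrow>\<^sub>M PiM UNIV (\<lambda>_. borel)"
    by (rule measurable_PiM_single') (auto simp: space_PiM)
  have P: "(\<lambda>G. prob_of (normal_mixture \<sigma> G)) \<in> prob_algebra borel \<rightarrow>\<^sub>M prob_algebra borel"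
  proof (rule measurable_prob_algebraI)
    show "prob_space (prob_of (normal_mixture \<sigma> G))" if "G \<in> space (prob_algebra borel)" for G
      using prob_of_in_prob_algebra[OF normal_mixture_density[OF that assms]]
      by (simp add: space_prob_algebra)
    show "(\<lambda>G. prob_of (normal_mixture \<sigma> G)) \<in> prob_algebra borel \<rightarrow>\<^sub>M subprob_algebra borel"
    proof (rule measurable_subprob_algebra)
      fix G :: "real measure" assume G: "G \<in> space (prob_algebra borel)"
      show "subprob_space (prob_of (normal_mixture \<sigma> G))"
        using prob_of_in_prob_algebra[OF normal_mixture_density[OF G assms]]
        by (simp add: space_prob_algebra prob_space_imp_subprob_space)
      show "sets (prob_of (normal_mixture \<sigma> G)) = sets borel" by (simp add: prob_of_def)
    next
      fix B :: "real set" assume [measurable]: "B \<in> sets borel"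
      have "emeasure (prob_of (normal_mixture \<sigma> G)) B
          = (\<integral>\<^sup>+x. ennreal (normal_mixture \<sigma> G x) * indicator B x \<partial>lborel)"
        if "G \<in> space (prob_algebra borel)" for G
        using normal_mixture_density[OF that assms]
        by (simp add: prob_of_def densities_def emeasure_density)
      moreover have "(\<lambda>G. \<integral>\<^sup>+x. ennreal (normal_mixture \<sigma> G x) * indicator B x \<partial>lborel)
          \<in> borel_measurable (prob_algebra borel)"
        by measurable
      ultimately show "(\<lambda>G. emeasure (prob_of (normal_mixture \<sigma> G)) B)
          \<in> borel_measurable (prob_algebra borel)"
        by (simp cong: measurable_cong)
    qed
  qed
  show "(\<lambda>G. (prob_of (normal_mixture \<sigma> G), normal_mixture \<sigma> G))
      \<in> prob_algebra borel \<rightarrow>\<^sub>M prob_algebra borel \<Otimes>\<^sub>M PiM UNIV (\<lambda>_. borel)"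
    using P ev by measurable
qed

end

theory Submission
  imports Defs "HOL-Computational_Algebra.Polynomial" "HOL-Real_Asymp.Real_Asymp"
begin

text \<open>
The evidence (the integrated likelihood ratio) is, with probability tending to 1, at least
\<open>exp (- 8 n^{1/4})\<close>, so that every set of mixing measures whose part of the evidence has mean at most
\<open>exp (- 10 n^{1/4})\<close> is negligible for the posterior.

Lower bound. Write \<open>\<sigma> = n^{-1/5}\<close>. The mixing density \<open>\<phi>\<^sub>\<sigma> * p\<^sub>0\<close> gives the mixture
\<open>\<phi>\<^sub>\<tau> * p\<^sub>0\<close> with \<open>\<tau> = \<surd>2 \<sigma>\<close>, whose chi-square distance to \<open>p\<^sub>0\<close> is of order
\<open>\<sigma>\<^sup>4\<close>: this follows from Taylor's formula and the Cauchy-Schwarz inequality, and needs only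
\<open>\<integral> (p\<^sub>0'')\<^sup>2 / p\<^sub>0 < \<infinity>\<close>. Smooth mixing densities may be sampled on a lattice, because a Riemann sum of the
normal density converges faster than any power of the mesh; mesh \<open>n^{-21/100}\<close> suffices. The Dirichlet
process puts the required mass, up to relative errors, on very short intervals next to all lattice
points of \<open>[- n^{1/100}, n^{1/100}]\<close> with probability at least \<open>exp (- n^{1/4})\<close>.

Tails. The \<open>p\<close>-th moment of a mixture is controlled by the masses \<open>G {z. k < \<bar>z\<bar>}\<close>. For \<open>k\<close> beyond a
multiple of \<open>n^{1/8}\<close> these are small under the prior, whose mean is bounded by means of \<open>\<alpha> > 1\<close>. For
smaller \<open>k\<close>, a mass above \<open>7 P\<^sub>0 {x. k < \<bar>x\<bar>} + 40 n^{-3/4}\<close> is refuted by the number of observations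
with \<open>k < \<bar>x\<bar>\<close>; the terms \<open>40 n^{-3/4}\<close> contribute at most a power \<open>n^{(p + 1) / 8 - 3/4}\<close> to the
moment, which vanishes for \<open>p < 4\<close>.
\<close>

section \<open>The chi-square distance between a density and its normal smoothing\<close>

text \<open>All exponents are tuned to the one scale n^{1/4}. The chi-square bound makes the mean of
  the product of \<open>p0 / target\<close> at most (1 + C n^{-4/5})^n <= exp (C n^{1/5}), so
  Markov's inequality alone controls that product. The prior ball has of the order of n^{22/100}
  cells (window n^{1/100} over mesh n^{-21/100}), each costing n^{2/100} on the log scale because
  the normal base density is that small at the edge of the window; the product n^{24/100} is below
  n^{1/4}. The ratio of mesh to bandwidth is n^{-1/100}; its 80th power n^{-4/5} is below the
  relative precision n^{-3/4}, which n observations turn into a multiple of n^{1/4}. The 8 in the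
  lower bound is 6 for this precision, 1 for the prior mass and 1 for the chi-square fluctuation.
  The obstacle is that prior tails of order exp (- const k^2) beat such an evidence bound only for k
  of order n^{1/8}, whereas a moment involves every k. Below that point the data have to decide, and
  an exponential test resolves tail masses only down to n^{1/4} / n = n^{-3/4}.\<close>

abbreviation \<phi> :: "real \<Rightarrow> real \<Rightarrow> real" where "\<phi> \<equiv> normal_density 0"

text \<open>A zero of a nonnegative function is a minimum, hence also a zero of \<open>f'\<close>;
  where \<open>f''\<close> does not vanish, zeros of \<open>f'\<close> are isolated. The lemma deals
  with the convention x / 0 = 0: at these points the quotient of \<open>f''\<close> squared by
  \<open>f\<close> is 0 and loses the value of \<open>f''\<close>.\<close>

lemma countable_zeros_nonzero_second_derivative:
  fixes f f' f'' :: "real \<Rightarrow> real"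
  assumes f: "\<And>x. (f has_real_derivative f' x) (at x)"
    and f': "\<And>x. (f' has_real_derivative f'' x) (at x)"
    and cont: "continuous_on UNIV f''" and nonneg: "\<And>x. 0 \<le> f x"
  shows "countable {x. f x = 0 \<and> f'' x \<noteq> 0}"
proof -
  define D where "D = {x. f'' x \<noteq> 0}"
  have "open D"
    unfolding D_def using open_Collect_neq[OF cont continuous_on_const] by simp
  have zero: "f' x = 0" if "f x = 0" for x
    by (rule DERIV_local_min[OF f zero_less_one]) (use that nonneg in auto)
  have "{x. f x = 0} sparse_in D"
    unfolding sparse_in_eventually_iff[OF \<open>open D\<close>]
  proof
    fix y assume "y \<in> D"
    show "\<forall>\<^sub>F z in at y. z \<notin> {x. f x = 0}"
    proof (cases "f y = 0")
      case True
      have "((\<lambda>z. (f' z - f' y) / (z - y)) \<longlongrightarrow> f'' y) (at y)"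
        using f'[of y] by (simp add: has_field_derivative_iff)
      then have "\<forall>\<^sub>F z in at y. (f' z - f' y) / (z - y) \<noteq> 0"
        by (rule tendsto_imp_eventually_ne) (use \<open>y \<in> D\<close> in \<open>simp add: D_def\<close>)
      then show ?thesis
        by eventually_elim (use zero True in auto)
    next
      case False
      have "(f \<longlongrightarrow> f y) (at y)"
        using DERIV_isCont[OF f] by (simp add: isCont_def)
      then have "\<forall>\<^sub>F z in at y. f z \<noteq> 0"
        by (rule tendsto_imp_eventually_ne) (use False in simp)
      then show ?thesis by simp
    qed
  qed
  from sparse_imp_countable[OF \<open>open D\<close> this] show ?thesis
    by (rule countable_subset[rotated]) (auto simp: D_def)
qed

text \<open>The substitution \<open>t = u\<^sup>2\<close> in the integral remainder produces the weight \<open>u\<close> that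
  \<open>normal_mixture_chi_square\<close> needs.\<close>

lemma taylor_remainder_bound:
  fixes f f' f'' :: "real \<Rightarrow> real"
  assumes f: "\<And>x. (f has_real_derivative f' x) (at x)"
    and f': "\<And>x. (f' has_real_derivative f'' x) (at x)"
    and cont: "continuous_on UNIV f''"
  shows "ennreal \<bar>f (x - y) - f x + y * f' x\<bar> \<le>
    (\<integral>\<^sup>+u. ennreal (2 * u * y\<^sup>2 * \<bar>f'' (x - u\<^sup>2 * y)\<bar>) * indicator {0..1} u \<partial>lborel)"
proof -
  \<comment> \<open>\<open>\<Psi> u\<close> is the value at \<open>x - y\<close> of the first-order
    Taylor polynomial with the moving centre \<open>x - u\<^sup>2 * y\<close>: exact for u = 1,
    expanded at \<open>x\<close> for u = 0. Its derivative contains \<open>f''\<close> only.\<close>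
  define \<Psi> where "\<Psi> u = f (x - u\<^sup>2 * y) - (1 - u\<^sup>2) * y * f' (x - u\<^sup>2 * y)" for u
  define \<psi> where "\<psi> u = 2 * u * (1 - u\<^sup>2) * y\<^sup>2 * f'' (x - u\<^sup>2 * y)" for u
  have d: "(\<Psi> has_real_derivative \<psi> u) (at u)" for u
    unfolding \<Psi>_def \<psi>_def
    by (rule derivative_eq_intros DERIV_chain2[OF f] DERIV_chain2[OF f'] refl)+
       (simp add: algebra_simps power2_eq_square)
  have c: "continuous_on {0..1} \<psi>"
    unfolding \<psi>_def by (intro continuous_intros continuous_on_compose2[OF cont]) auto
  have i: "integrable lborel (\<lambda>u. indicator {0..1} u *\<^sub>R \<psi> u)"
    using borel_integrable_atLeastAtMost'[OF c] by (simp add: set_integrable_def)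
  have "(\<integral>u. indicator {0..1} u *\<^sub>R \<psi> u \<partial>lborel) = \<Psi> 1 - \<Psi> 0"
    by (rule integral_FTC_atLeastAtMost[OF _ _ c])
       (auto intro: d[THEN DERIV_subset] simp flip: has_real_derivative_iff_has_vector_derivative)
  also have "\<dots> = f (x - y) - f x + y * f' x"
    by (simp add: \<Psi>_def)
  finally have "ennreal \<bar>f (x - y) - f x + y * f' x\<bar> \<le> (\<integral>\<^sup>+u. norm (indicator {0..1} u *\<^sub>R \<psi> u) \<partial>lborel)"
    using integral_norm_bound_ennreal[OF i] by simp
  also have "\<dots> \<le> (\<integral>\<^sup>+u. ennreal (2 * u * y\<^sup>2 * \<bar>f'' (x - u\<^sup>2 * y)\<bar>) * indicator {0..1} u \<partial>lborel)"
  proof (rule nn_integral_mono)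
    fix u :: real
    show "ennreal (norm (indicator {0..1} u *\<^sub>R \<psi> u))
        \<le> ennreal (2 * u * y\<^sup>2 * \<bar>f'' (x - u\<^sup>2 * y)\<bar>) * indicator {0..1} u"
    proof (cases "u \<in> {0..1}")
      case True
      then have "\<bar>\<psi> u\<bar> = 2 * u * y\<^sup>2 * \<bar>f'' (x - u\<^sup>2 * y)\<bar> * (1 - u\<^sup>2)"
        by (simp add: \<psi>_def abs_mult power_le_one)
      also have "\<dots> \<le> 2 * u * y\<^sup>2 * \<bar>f'' (x - u\<^sup>2 * y)\<bar> * 1"
        using True by (intro mult_left_mono) auto
      finally show ?thesis using True by (simp add: ennreal_leI)
    qed simp
  qed
  finally show ?thesis .
qed

lemma normal_density_scale_le:
  assumes "0 < u" "u \<le> 1"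
  shows "\<phi> s (y / u) \<le> \<phi> s y"
proof -
  have "u\<^sup>2 \<le> 1" using assms by (simp add: power_le_one)
  then have "y\<^sup>2 * u\<^sup>2 \<le> y\<^sup>2 * 1" by (intro mult_left_mono) auto
  then have "y\<^sup>2 \<le> (y / u)\<^sup>2"
    using assms by (simp add: power_divide field_simps)
  then have "- ((y / u)\<^sup>2) / (2 * s\<^sup>2) \<le> - (y\<^sup>2) / (2 * s\<^sup>2)"
    by (simp add: divide_right_mono)
  then show ?thesis
    unfolding normal_density_def by (auto intro!: divide_right_mono)
qed

lemma normal_mixture_prob_of:
  assumes "q \<in> densities"
  shows "normal_mixture s (prob_of q) x = (\<integral>y. \<phi> s y * q (x - y) \<partial>lborel)"
proof -
  have [measurable]: "q \<in> borel_measurable borel" and "\<And>x. 0 \<le> q x" using assms by (auto simp: densities_def)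
  then have "normal_mixture s (prob_of q) x = (\<integral>z. q z * \<phi> s (x - z) \<partial>lborel)"
    unfolding normal_mixture_def prob_of_def by (subst integral_density) auto
  also have "\<dots> = (\<integral>y. q (x - y) * \<phi> s (x - (x - y)) \<partial>lborel)"
    using lborel_integral_real_affine[of "-1" "\<lambda>z. q z * \<phi> s (x - z)" x] by simp
  finally show ?thesis by (simp add: mult.commute)
qed

lemma normal_mixture_prob_of_integrable:
  assumes "q \<in> densities"
  shows "integrable lborel (\<lambda>y. \<phi> s y * q (x - y))"
proof -
  have [measurable]: "q \<in> borel_measurable borel" and nn: "\<And>x. 0 \<le> q x"
    and 1: "(\<integral>\<^sup>+x. q x \<partial>lborel) = 1" using assms by (auto simp: densities_def)
  have "integrable lborel q" by (rule integrableI_nonneg) (auto simp: nn 1)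
  then have "integrable lborel (\<lambda>y. q (x + (-1) * y))"
    by (rule lborel_integrable_real_affine) simp
  then have i: "integrable lborel (\<lambda>y. q (x - y) / sqrt (2 * pi * s\<^sup>2))" by simp
  have "\<phi> s y * q (x - y) \<le> q (x - y) / sqrt (2 * pi * s\<^sup>2)" for y
    using mult_right_mono[of "exp (- y\<^sup>2 / (2 * s\<^sup>2))" 1 "q (x - y)"] nn[of "x - y"]
    by (simp add: normal_density_def divide_right_mono)
  then show ?thesis
    by (intro Bochner_Integration.integrable_bound[OF i]) (auto simp: nn)
qed

lemma normal_mixture_prob_of_pos:
  assumes "q \<in> densities" "0 < s"
  shows "0 < normal_mixture s (prob_of q) x"
proof -
  have [measurable]: "q \<in> borel_measurable borel" and nn: "\<And>x. 0 \<le> q x"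
    and 1: "(\<integral>\<^sup>+x. q x \<partial>lborel) = 1" using assms by (auto simp: densities_def)
  have "normal_mixture s (prob_of q) x \<noteq> 0"
  proof
    assume "normal_mixture s (prob_of q) x = 0"
    then have "AE y in lborel. \<phi> s y * q (x - y) = 0"
      unfolding normal_mixture_prob_of[OF assms(1)]
      by (subst (asm) integral_nonneg_eq_0_iff_AE[OF normal_mixture_prob_of_integrable[OF assms(1)]])
         (auto simp: nn)
    then have "AE y in lborel. q (x - y) = 0"
      by eventually_elim (use normal_density_pos[OF assms(2)] in \<open>auto simp: less_le\<close>)
    then have "AE y in lborel. q (x - (x + (- 1) * y)) = 0"
      by (intro AE_borel_affine) auto
    then have "(\<integral>\<^sup>+x. q x \<partial>lborel) = 0"
      by (subst nn_integral_0_iff_AE) auto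
    with 1 show False by simp
  qed
  moreover have "0 \<le> normal_mixture s (prob_of q) x"
    unfolding normal_mixture_prob_of[OF assms(1)] by (intro integral_nonneg_AE) (auto simp: nn)
  ultimately show ?thesis by simp
qed

text \<open>For \<open>y \<noteq> 0\<close> the path from \<open>x\<close> to \<open>x - y\<close>
  is injective in \<open>u\<close>, so a countable exceptional set of points pulls back to a
  countable set of parameters.\<close>

lemma AE_zero_second_derivative:
  fixes f f'' :: "real \<Rightarrow> real"
  assumes "countable {x. f x = 0 \<and> f'' x \<noteq> 0}" "y \<noteq> 0"
  shows "AE u in lborel. u \<in> {0..1} \<longrightarrow> f (x - u\<^sup>2 * y) = 0 \<longrightarrow> f'' (x - u\<^sup>2 * y) = 0"
proof -
  let ?N = "(\<lambda>z. sqrt ((x - z) / y)) ` {x. f x = 0 \<and> f'' x \<noteq> 0}"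
  have "countable ?N" using assms by simp
  then have "?N \<in> null_sets lborel" by (rule countable_imp_null_set_lborel)
  then show ?thesis
  proof (rule AE_I')
    show "{u \<in> space lborel. \<not> (u \<in> {0..1} \<longrightarrow> f (x - u\<^sup>2 * y) = 0 \<longrightarrow> f'' (x - u\<^sup>2 * y) = 0)} \<subseteq> ?N"
    proof
      fix u assume u: "u \<in> {u \<in> space lborel. \<not> (u \<in> {0..1} \<longrightarrow> f (x - u\<^sup>2 * y) = 0 \<longrightarrow> f'' (x - u\<^sup>2 * y) = 0)}"
      then have "u = sqrt ((x - (x - u\<^sup>2 * y)) / y)"
        using assms(2) by (simp add: real_sqrt_abs)
      with u show "u \<in> ?N" by blast
    qed
  qed
qed

lemma nn_integral_normal_pow4:
  assumes "0 < s"
  shows "(\<integral>\<^sup>+y. ennreal (\<phi> s y * y ^ 4) \<partial>lborel) = ennreal (3 * s ^ 4)"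
proof -
  have "has_bochner_integral lborel (\<lambda>y. \<phi> s y * y ^ 4) (3 * s ^ 4)"
    using normal_moment_even[OF assms, of 0 2]
    by (simp add: fact_numeral field_simps power2_eq_square power4_eq_xxxx)
  then show ?thesis
    using nn_integral_eq_integral[of lborel "\<lambda>y. \<phi> s y * y ^ 4"]
    by (simp add: has_bochner_integral_iff)
qed

text \<open>After the substitution \<open>v = u * y\<close> the factor \<open>u\<close> cancels the
  Jacobian, and the kernel \<open>\<phi> s (v / u)\<close> is at most \<open>\<phi> s v\<close>
  because shrinking by \<open>u\<close> only moves its argument away from 0. It is applied with
  \<open>u\<^sup>2\<close> in the role of \<open>u\<close>, which is why the Taylor remainder has to
  supply the weight \<open>u\<close> before squaring.\<close>

lemma nn_integral_normal_shrink_le: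
  assumes "q \<in> densities" "0 < s" "0 < u" "u \<le> 1"
  shows "(\<integral>\<^sup>+y. ennreal (\<phi> s y * u * q (x - u * y)) \<partial>lborel)
    \<le> ennreal (normal_mixture s (prob_of q) x)"
proof -
  have [measurable]: "q \<in> borel_measurable borel" and nn: "\<And>x. 0 \<le> q x"
    using assms by (auto simp: densities_def)
  have "(\<integral>\<^sup>+y. ennreal (\<phi> s y * u * q (x - u * y)) \<partial>lborel)
      = ennreal \<bar>1 / u\<bar> * (\<integral>\<^sup>+v. ennreal (\<phi> s (0 + 1 / u * v) * u * q (x - u * (0 + 1 / u * v))) \<partial>lborel)"
    using assms by (intro nn_integral_real_affine) auto
  also have "\<dots> = (\<integral>\<^sup>+v. ennreal (1 / u * (\<phi> s (v / u) * u * q (x - v))) \<partial>lborel)"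
    using assms nn by (subst nn_integral_cmult[symmetric]) (auto simp: ennreal_mult[symmetric])
  also have "\<dots> \<le> (\<integral>\<^sup>+v. ennreal (\<phi> s v * q (x - v)) \<partial>lborel)"
    using assms nn normal_density_scale_le[of u s]
    by (intro nn_integral_mono ennreal_leI) (auto intro!: mult_right_mono)
  also have "\<dots> = ennreal (normal_mixture s (prob_of q) x)"
    unfolding normal_mixture_prob_of[OF assms(1)]
    by (rule nn_integral_eq_integral[OF normal_mixture_prob_of_integrable[OF assms(1)]]) (auto simp: nn)
  finally show ?thesis .
qed

text \<open>For \<open>w = q''\<^sup>2 / q\<close> this is the squared norm, over pairs (y, u), of
  the first Cauchy-Schwarz factor in \<open>normal_mixture_deviation_bound\<close>.\<close>

definition smoothing_energy :: "real \<Rightarrow> (real \<Rightarrow> real) \<Rightarrow> real \<Rightarrow> ennreal" where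
  "smoothing_energy s w x = (\<integral>\<^sup>+y. \<integral>\<^sup>+u. ennreal (4 * (\<phi> s y * y ^ 4) * w (x - u\<^sup>2 * y))
      * indicator {0..1::real} u \<partial>lborel \<partial>lborel)"

text \<open>The remainder of Taylor's formula is split as \<open>q'' / sqrt q\<close> times
  \<open>sqrt q\<close>, both evaluated along the path. By
  \<open>nn_integral_normal_shrink_le\<close> the square of the second factor integrates to at most
  the mixture itself, which is exactly the denominator of the chi-square distance and cancels
  there.\<close>

lemma normal_mixture_deviation_bound:
  fixes q q' q'' :: "real \<Rightarrow> real"
  assumes q: "q \<in> densities" and s: "0 < s"
    and q': "\<And>x. (q has_real_derivative q' x) (at x)"
    and q'': "\<And>x. (q' has_real_derivative q'' x) (at x)"
    and cont: "continuous_on UNIV q''"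
  shows "ennreal ((normal_mixture s (prob_of q) x - q x)\<^sup>2) \<le> ennreal (normal_mixture s (prob_of q) x) *
    smoothing_energy s (\<lambda>x. (q'' x)\<^sup>2 / q x) x"
proof -
  have [measurable]: "q \<in> borel_measurable borel" and nn: "\<And>x. 0 \<le> q x"
    using q by (auto simp: densities_def)
  have [measurable]: "q'' \<in> borel_measurable borel"
    using cont by (rule borel_measurable_continuous_onI)
  let ?Q = "normal_mixture s (prob_of q) x"
  note i1 = normal_mixture_prob_of_integrable[OF q, of s x]
  have i2: "integrable lborel (\<lambda>y. \<phi> s y * q x)"
    using integrable_normal_density[OF s] by simp
  have i3: "integrable lborel (\<lambda>y. \<phi> s y * y * q' x)"
    using integrable_normal_moment_nz_1[OF s] by simp
  \<comment> \<open>The linear term may be inserted freely: the centred normal density has mean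
    0.\<close>
  have eq: "?Q - q x = (\<integral>y. \<phi> s y * (q (x - y) - q x + y * q' x) \<partial>lborel)"
  proof -
    have "(\<integral>y. \<phi> s y * (q (x - y) - q x + y * q' x) \<partial>lborel)
       = (\<integral>y. \<phi> s y * q (x - y) - \<phi> s y * q x + \<phi> s y * y * q' x \<partial>lborel)"
      by (simp add: algebra_simps)
    also have "\<dots> = ?Q - q x"
      using i1 i2 i3 integral_normal_moment_nz_1[OF s, of 0] integral_normal_density[OF s, of 0]
      by (simp add: normal_mixture_prob_of[OF q])
    finally show ?thesis ..
  qed
  have i: "integrable lborel (\<lambda>y. \<phi> s y * (q (x - y) - q x + y * q' x))"
    using Bochner_Integration.integrable_add[OF Bochner_Integration.integrable_diff[OF i1 i2] i3]
    by (simp add: algebra_simps)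
  \<comment> \<open>The two Cauchy-Schwarz factors. The weight \<open>u\<close> goes to
    \<open>g\<close> together with \<open>sqrt q\<close>, and the constant 2 and
    \<open>y\<^sup>2\<close> go to \<open>f\<close>.\<close>
  define f where "f = (\<lambda>(y, u). ennreal (sqrt (\<phi> s y) * y\<^sup>2 * 2 *
      sqrt ((q'' (x - u\<^sup>2 * y))\<^sup>2 / q (x - u\<^sup>2 * y))) * indicator {0..1::real} u)"
  define g where "g = (\<lambda>(y, u). ennreal (sqrt (\<phi> s y) * u * sqrt (q (x - u\<^sup>2 * y)))
      * indicator {0..1::real} u)"
  have [measurable]: "f \<in> borel_measurable (lborel \<Otimes>\<^sub>M lborel)" "g \<in> borel_measurable (lborel \<Otimes>\<^sub>M lborel)"
    unfolding f_def g_def by measurable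
  have count: "countable {x. q x = 0 \<and> q'' x \<noteq> 0}"
    by (rule countable_zeros_nonzero_second_derivative[OF q' q'' cont nn])
  have "(\<integral>\<^sup>+z. (g z)\<^sup>2 \<partial>(lborel \<Otimes>\<^sub>M lborel)) = (\<integral>\<^sup>+u. \<integral>\<^sup>+y. (g (y, u))\<^sup>2 \<partial>lborel \<partial>lborel)"
    by (rule lborel_pair.nn_integral_snd[symmetric]) measurable
  also have "\<dots> \<le> (\<integral>\<^sup>+u. ennreal ?Q * indicator {0..1::real} u \<partial>lborel)"
  proof (rule nn_integral_mono)
    fix u :: real
    show "(\<integral>\<^sup>+y. (g (y, u))\<^sup>2 \<partial>lborel) \<le> ennreal ?Q * indicator {0..1} u"
    proof (cases "0 < u \<and> u \<le> 1")
      case True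
      then have "(\<integral>\<^sup>+y. (g (y, u))\<^sup>2 \<partial>lborel) = (\<integral>\<^sup>+y. ennreal (\<phi> s y * u\<^sup>2 * q (x - u\<^sup>2 * y)) \<partial>lborel)"
        using nn by (intro nn_integral_cong) (simp add: g_def ennreal_power power_mult_distrib)
      also have "\<dots> \<le> ennreal ?Q"
        by (rule nn_integral_normal_shrink_le[OF q s]) (use True in \<open>auto simp: power_le_one\<close>)
      finally show ?thesis using True by simp
    next
      case False
      then have "(\<integral>\<^sup>+y. (g (y, u))\<^sup>2 \<partial>lborel) = (\<integral>\<^sup>+y. 0 \<partial>(lborel::real measure))"
        by (intro nn_integral_cong) (auto simp: g_def split: split_indicator)
      then show ?thesis by simp
    qed
  qed
  also have "\<dots> = ennreal ?Q"
    by (simp add: nn_integral_cmult)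
  finally have g2: "(\<integral>\<^sup>+z. (g z)\<^sup>2 \<partial>(lborel \<Otimes>\<^sub>M lborel)) \<le> ennreal ?Q" .
  have "ennreal \<bar>?Q - q x\<bar> \<le> (\<integral>\<^sup>+y. norm (\<phi> s y * (q (x - y) - q x + y * q' x)) \<partial>lborel)"
    using integral_norm_bound_ennreal[OF i] unfolding eq by simp
  also have "\<dots> = (\<integral>\<^sup>+y. ennreal (\<phi> s y) * ennreal \<bar>q (x - y) - q x + y * q' x\<bar> \<partial>lborel)"
    by (simp add: abs_mult ennreal_mult)
  also have "\<dots> \<le> (\<integral>\<^sup>+y. ennreal (\<phi> s y) *
      (\<integral>\<^sup>+u. ennreal (2 * u * y\<^sup>2 * \<bar>q'' (x - u\<^sup>2 * y)\<bar>) * indicator {0..1::real} u \<partial>lborel) \<partial>lborel)"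
    by (intro nn_integral_mono mult_left_mono taylor_remainder_bound[OF q' q'' cont]) auto
  also have "\<dots> = (\<integral>\<^sup>+y. \<integral>\<^sup>+u. f (y, u) * g (y, u) \<partial>lborel \<partial>lborel)"
  \<comment> \<open>For \<open>y = 0\<close> the path is constant and may stay at a zero of
    \<open>q\<close>, so the factorisation is claimed only for \<open>y \<noteq> 0\<close>.\<close>
  proof (rule nn_integral_cong_AE, rule AE_I'[of "{0}"])
    show "{y \<in> space lborel. ennreal (\<phi> s y) *
        (\<integral>\<^sup>+u. ennreal (2 * u * y\<^sup>2 * \<bar>q'' (x - u\<^sup>2 * y)\<bar>) * indicator {0..1::real} u \<partial>lborel)
        \<noteq> (\<integral>\<^sup>+u. f (y, u) * g (y, u) \<partial>lborel)} \<subseteq> {0}"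
    proof (rule subsetI, rule ccontr)
      fix y :: real
      assume y: "y \<in> {y \<in> space lborel. ennreal (\<phi> s y) *
        (\<integral>\<^sup>+u. ennreal (2 * u * y\<^sup>2 * \<bar>q'' (x - u\<^sup>2 * y)\<bar>) * indicator {0..1::real} u \<partial>lborel)
        \<noteq> (\<integral>\<^sup>+u. f (y, u) * g (y, u) \<partial>lborel)}" and "y \<notin> {0}"
      then have "y \<noteq> 0" by simp
      from AE_zero_second_derivative[OF count this, of x]
      have "AE u in lborel. ennreal (\<phi> s y) * (ennreal (2 * u * y\<^sup>2 * \<bar>q'' (x - u\<^sup>2 * y)\<bar>) * indicator {0..1} u)
          = f (y, u) * g (y, u)"
      proof eventually_elim
        case (elim u)
        show ?case
        proof (cases "u \<in> {0..1}")
          case True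
          have a: "sqrt ((q'' (x - u\<^sup>2 * y))\<^sup>2 / q (x - u\<^sup>2 * y)) * sqrt (q (x - u\<^sup>2 * y)) = \<bar>q'' (x - u\<^sup>2 * y)\<bar>"
            using elim True nn[of "x - u\<^sup>2 * y"]
            by (cases "q (x - u\<^sup>2 * y) = 0") (auto simp: real_sqrt_mult[symmetric])
          have b: "sqrt (\<phi> s y) * sqrt (\<phi> s y) = \<phi> s y"
            by simp
          have "f (y, u) * g (y, u) = ennreal ((sqrt (\<phi> s y) * sqrt (\<phi> s y)) * y\<^sup>2 * 2 * u *
              (sqrt ((q'' (x - u\<^sup>2 * y))\<^sup>2 / q (x - u\<^sup>2 * y)) * sqrt (q (x - u\<^sup>2 * y))))"
            using True nn by (simp add: f_def g_def ennreal_mult'[symmetric] ac_simps)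
          then show ?thesis
            unfolding a b using True by (simp add: ennreal_mult'[symmetric] ac_simps)
        qed (simp add: f_def g_def)
      qed
      then have "(\<integral>\<^sup>+u. ennreal (\<phi> s y) * (ennreal (2 * u * y\<^sup>2 * \<bar>q'' (x - u\<^sup>2 * y)\<bar>) * indicator {0..1} u) \<partial>lborel)
          = (\<integral>\<^sup>+u. f (y, u) * g (y, u) \<partial>lborel)"
        by (rule nn_integral_cong_AE)
      with y show False
        by (simp add: nn_integral_cmult)
    qed
  qed (rule countable_imp_null_set_lborel, simp)
  also have "\<dots> = (\<integral>\<^sup>+z. f z * g z \<partial>(lborel \<Otimes>\<^sub>M lborel))"
    by (rule lborel.nn_integral_fst) measurable
  finally have "(ennreal \<bar>?Q - q x\<bar>)\<^sup>2 \<le> (\<integral>\<^sup>+z. f z * g z \<partial>(lborel \<Otimes>\<^sub>M lborel))\<^sup>2"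
    by (rule power_mono) simp
  also have "\<dots> \<le> (\<integral>\<^sup>+z. (f z)\<^sup>2 \<partial>(lborel \<Otimes>\<^sub>M lborel)) * (\<integral>\<^sup>+z. (g z)\<^sup>2 \<partial>(lborel \<Otimes>\<^sub>M lborel))"
    by (rule Cauchy_Schwarz_nn_integral) measurable
  also have "(\<integral>\<^sup>+z. (f z)\<^sup>2 \<partial>(lborel \<Otimes>\<^sub>M lborel)) = (\<integral>\<^sup>+y. \<integral>\<^sup>+u. (f (y, u))\<^sup>2 \<partial>lborel \<partial>lborel)"
    by (rule lborel.nn_integral_fst[symmetric]) measurable
  also have "\<dots> = smoothing_energy s (\<lambda>x. (q'' x)\<^sup>2 / q x) x"
    unfolding smoothing_energy_def using nn by (intro nn_integral_cong)
      (auto simp: f_def ennreal_power power_mult_distrib algebra_simps split: split_indicator)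
  finally have "ennreal ((?Q - q x)\<^sup>2) \<le> smoothing_energy s (\<lambda>x. (q'' x)\<^sup>2 / q x) x * (\<integral>\<^sup>+z. (g z)\<^sup>2 \<partial>(lborel \<Otimes>\<^sub>M lborel))"
    by (simp add: ennreal_power)
  also have "\<dots> \<le> smoothing_energy s (\<lambda>x. (q'' x)\<^sup>2 / q x) x * ennreal ?Q"
    by (rule mult_left_mono[OF g2]) simp
  finally show ?thesis
    by (subst mult.commute)
qed

text \<open>Dividing the deviation bound by the mixture and integrating over \<open>x\<close> first
  removes the shift \<open>u\<^sup>2 * y\<close> by translation invariance. What remains is 4 times
  the fourth moment \<open>3 * s ^ 4\<close> of the kernel, hence 12.\<close>

lemma normal_mixture_chi_square:
  fixes q q' q'' :: "real \<Rightarrow> real"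
  assumes q: "q \<in> densities" and s: "0 < s"
    and q': "\<And>x. (q has_real_derivative q' x) (at x)"
    and q'': "\<And>x. (q' has_real_derivative q'' x) (at x)"
    and cont: "continuous_on UNIV q''"
  shows "(\<integral>\<^sup>+x. ennreal ((q x)\<^sup>2 / normal_mixture s (prob_of q) x) \<partial>lborel)
    \<le> 1 + ennreal (12 * s ^ 4) * (\<integral>\<^sup>+x. ennreal ((q'' x / q x)\<^sup>2) \<partial>prob_of q)"
proof -
  have [measurable]: "q \<in> borel_measurable borel" and nn: "\<And>x. 0 \<le> q x"
    and 1: "(\<integral>\<^sup>+x. q x \<partial>lborel) = 1"
    using q by (auto simp: densities_def)
  have [measurable]: "q'' \<in> borel_measurable borel"
    using cont by (rule borel_measurable_continuous_onI)
  let ?Q = "normal_mixture s (prob_of q)"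
  have "?Q \<in> densities"
    by (rule normal_mixture_density[OF prob_of_in_prob_algebra[OF q] s])
  then have [measurable]: "?Q \<in> borel_measurable borel" and Q1: "(\<integral>\<^sup>+x. ?Q x \<partial>lborel) = 1"
    by (auto simp: densities_def)
  have Qpos: "0 < ?Q x" for x by (rule normal_mixture_prob_of_pos[OF q s])
  define w where "w x = (q'' x)\<^sup>2 / q x" for x
  have [measurable]: "w \<in> borel_measurable borel" unfolding w_def by measurable
  have wnn: "0 \<le> w x" for x using nn by (simp add: w_def)
  have w: "(\<integral>\<^sup>+x. ennreal ((q'' x / q x)\<^sup>2) \<partial>prob_of q) = (\<integral>\<^sup>+x. ennreal (w x) \<partial>lborel)"
    unfolding prob_of_def using nn
    by (subst nn_integral_density)
       (auto intro!: nn_integral_cong simp: ennreal_mult'[symmetric] w_def power2_eq_square)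
  define A where "A = smoothing_energy s w"
  have [measurable]: "A \<in> borel_measurable borel"
    unfolding A_def smoothing_energy_def[abs_def] by measurable
  have dev: "ennreal ((?Q x - q x)\<^sup>2 / ?Q x) \<le> A x" for x
  proof -
    have "ennreal ((?Q x - q x)\<^sup>2 / ?Q x) = ennreal (1 / ?Q x) * ennreal ((?Q x - q x)\<^sup>2)"
      using Qpos[of x] by (simp add: ennreal_mult'[symmetric])
    also have "\<dots> \<le> ennreal (1 / ?Q x) * (ennreal (?Q x) * A x)"
      using normal_mixture_deviation_bound[OF q s q' q'' cont, of x]
      by (intro mult_left_mono) (auto simp: A_def w_def[abs_def])
    also have "\<dots> = A x"
      using Qpos[of x] by (simp add: mult.assoc[symmetric] ennreal_mult'[symmetric])
    finally show ?thesis .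
  qed
  have "(\<integral>\<^sup>+x. A x \<partial>lborel) = (\<integral>\<^sup>+y. \<integral>\<^sup>+x. \<integral>\<^sup>+u. ennreal (4 * (\<phi> s y * y ^ 4) * w (x - u\<^sup>2 * y))
        * indicator {0..1::real} u \<partial>lborel \<partial>lborel \<partial>lborel)"
    unfolding A_def smoothing_energy_def by (rule lborel_pair.Fubini') measurable
  also have "\<dots> = (\<integral>\<^sup>+y. \<integral>\<^sup>+u. \<integral>\<^sup>+x. ennreal (4 * (\<phi> s y * y ^ 4) * w (x - u\<^sup>2 * y))
        * indicator {0..1::real} u \<partial>lborel \<partial>lborel \<partial>lborel)"
    by (rule nn_integral_cong, rule lborel_pair.Fubini') measurable
  also have "\<dots> = (\<integral>\<^sup>+y. \<integral>\<^sup>+u. ennreal (4 * (\<phi> s y * y ^ 4)) * (\<integral>\<^sup>+x. w x \<partial>lborel)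
        * indicator {0..1::real} u \<partial>lborel \<partial>lborel)"
  proof (intro nn_integral_cong)
    fix y u :: real
    have "(\<integral>\<^sup>+x. w x \<partial>lborel) = (\<integral>\<^sup>+x. w (x - u\<^sup>2 * y) \<partial>lborel)"
      using nn_integral_real_affine[of "\<lambda>x. ennreal (w x)" 1 "- (u\<^sup>2 * y)"] by simp
    then show "(\<integral>\<^sup>+x. ennreal (4 * (\<phi> s y * y ^ 4) * w (x - u\<^sup>2 * y)) * indicator {0..1::real} u \<partial>lborel)
      = ennreal (4 * (\<phi> s y * y ^ 4)) * (\<integral>\<^sup>+x. w x \<partial>lborel) * indicator {0..1} u"
      using wnn by (simp add: ennreal_mult nn_integral_cmult nn_integral_multc)
  qed
  also have "\<dots> = (\<integral>\<^sup>+y. 4 * ennreal (\<phi> s y * y ^ 4) * (\<integral>\<^sup>+x. w x \<partial>lborel) \<partial>lborel)"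
    by (simp add: nn_integral_cmult ennreal_mult)
  also have "\<dots> = 4 * ennreal (3 * s ^ 4) * (\<integral>\<^sup>+x. w x \<partial>lborel)"
    using nn_integral_normal_pow4[OF s] by (simp add: nn_integral_multc nn_integral_cmult)
  also have "\<dots> = ennreal (12 * s ^ 4) * (\<integral>\<^sup>+x. w x \<partial>lborel)"
    using s by (simp add: ennreal_mult'[symmetric] flip: ennreal_numeral)
  finally have Aint: "(\<integral>\<^sup>+x. A x \<partial>lborel) = ennreal (12 * s ^ 4) * (\<integral>\<^sup>+x. w x \<partial>lborel)" .
  have "(\<integral>\<^sup>+x. ennreal ((q x)\<^sup>2 / ?Q x) \<partial>lborel) + 1
      = (\<integral>\<^sup>+x. ennreal ((q x)\<^sup>2 / ?Q x) + ennreal (?Q x) \<partial>lborel)"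
    by (simp add: nn_integral_add Q1)
  also have "\<dots> = (\<integral>\<^sup>+x. 2 * ennreal (q x) + ennreal ((?Q x - q x)\<^sup>2 / ?Q x) \<partial>lborel)"
  \<comment> \<open>Expanding the square, with the mixture added on both sides, so that no
    subtraction of extended nonnegative integrals occurs.\<close>
  proof (rule nn_integral_cong)
    fix x
    have "(q x)\<^sup>2 / ?Q x + ?Q x = 2 * q x + (?Q x - q x)\<^sup>2 / ?Q x"
      using Qpos[of x] by (simp add: field_simps power2_eq_square)
    then show "ennreal ((q x)\<^sup>2 / ?Q x) + ennreal (?Q x) = 2 * ennreal (q x) + ennreal ((?Q x - q x)\<^sup>2 / ?Q x)"
      using Qpos[of x] nn[of x] by (simp add: ennreal_plus[symmetric] ennreal_mult'[symmetric] flip: ennreal_numeral del: ennreal_plus)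
  qed
  also have "\<dots> = 2 + (\<integral>\<^sup>+x. ennreal ((?Q x - q x)\<^sup>2 / ?Q x) \<partial>lborel)"
    by (simp add: nn_integral_add nn_integral_cmult 1)
  also have "\<dots> \<le> 2 + (\<integral>\<^sup>+x. A x \<partial>lborel)"
    by (intro add_left_mono nn_integral_mono dev)
  also have "\<dots> = (1 + ennreal (12 * s ^ 4) * (\<integral>\<^sup>+x. w x \<partial>lborel)) + 1"
    unfolding Aint by (simp add: add.commute add.left_commute flip: one_add_one)
  finally have "1 + (\<integral>\<^sup>+x. ennreal ((q x)\<^sup>2 / ?Q x) \<partial>lborel)
      \<le> 1 + (1 + ennreal (12 * s ^ 4) * (\<integral>\<^sup>+x. w x \<partial>lborel))"
    by (subst (1 2) add.commute)
  then show ?thesis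
    unfolding w ennreal_add_left_cancel_le by simp
qed

section \<open>Lattice sums of the normal density\<close>

lemma nn_integral_exp_minus_abs: "(\<integral>\<^sup>+x. ennreal (exp (- \<bar>x\<bar>)) \<partial>lborel) \<le> 2"
proof -
  have 1: "(\<integral>\<^sup>+x. ennreal (exponential_density 1 x) \<partial>lborel) = 1"
    using prob_space.emeasure_space_1[OF prob_space_exponential_density[of 1]]
    by (simp add: emeasure_density)
  have 2: "(\<integral>\<^sup>+x. ennreal (exponential_density 1 (- x)) \<partial>lborel) = 1"
    using nn_integral_real_affine[of "\<lambda>x. ennreal (exponential_density 1 x)" "-1" 0] 1 by simp
  have "(\<integral>\<^sup>+x. ennreal (exp (- \<bar>x\<bar>)) \<partial>lborel)
      \<le> (\<integral>\<^sup>+x. ennreal (exponential_density 1 x) + ennreal (exponential_density 1 (- x)) \<partial>lborel)"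
    by (intro nn_integral_mono) (auto simp: exponential_density_def)
  also have "\<dots> = 2"
    by (subst nn_integral_add) (auto simp: 1 2)
  finally show ?thesis .
qed

lemma ex1_lattice_cell:
  fixes h s m :: real
  assumes "0 < h"
  shows "\<exists>!j::int. h * of_int j - m \<le> s \<and> s < h * of_int j - m + h"
proof -
  have "h * of_int j - m \<le> s \<and> s < h * of_int j - m + h \<longleftrightarrow> j = \<lfloor>(s + m) / h\<rfloor>" for j :: int
  proof -
    have "h * of_int j - m \<le> s \<and> s < h * of_int j - m + h
        \<longleftrightarrow> of_int j \<le> (s + m) / h \<and> (s + m) / h < of_int j + 1"
      using assms by (simp add: field_simps)
    also have "\<dots> \<longleftrightarrow> j = \<lfloor>(s + m) / h\<rfloor>"
      by (auto simp: floor_unique[symmetric] floor_eq_iff)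
    finally show ?thesis .
  qed
  then show ?thesis by simp
qed

lemma nn_integral_count_space_lattice_cell:
  fixes h s m :: real
  assumes "0 < h"
  shows "(\<integral>\<^sup>+j. indicator {h * of_int j - m ..< h * of_int j - m + h} s \<partial>count_space (UNIV::int set)) = 1"
proof -
  obtain i :: int where i: "h * of_int j - m \<le> s \<and> s < h * of_int j - m + h \<longleftrightarrow> j = i" for j
    using ex1_lattice_cell[OF assms, of m s] by metis
  have "(\<integral>\<^sup>+j. indicator {h * of_int j - m ..< h * of_int j - m + h} s \<partial>count_space (UNIV::int set))
      = (\<integral>\<^sup>+j. indicator {i} j \<partial>count_space (UNIV::int set))"
    using i by (intro nn_integral_cong) (auto simp: indicator_def)
  then show ?thesis by simp
qed

interpretation int_count: sigma_finite_measure "count_space (UNIV::int set)"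
  by (rule sigma_finite_measure_count_space)

interpretation int_count_lborel: pair_sigma_finite "count_space (UNIV::int set)" "lborel :: real measure" ..

text \<open>Each term is compared with the integral over the cell of length \<open>h\<close> to its
  right: as \<open>h \<le> 1\<close>, the exponential changes there by a factor of at most
  \<open>exp 1\<close>. The cells tile the line, and the integral of
  \<open>exp (- \<bar>x\<bar>)\<close> is at most 2.\<close>

lemma nn_integral_lattice_exp:
  fixes h m :: real
  assumes h: "0 < h" "h \<le> 1"
  shows "ennreal h * (\<integral>\<^sup>+j. ennreal (exp (- \<bar>h * of_int j - m\<bar>)) \<partial>count_space (UNIV::int set)) \<le> ennreal (2 * exp 1)"
proof -
  have [measurable]: "(\<lambda>(j, s). indicator {h * of_int j - m ..< h * of_int j - m + h} s :: ennreal)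
      \<in> borel_measurable (count_space UNIV \<Otimes>\<^sub>M lborel)"
    unfolding indicator_def by measurable
  have "ennreal h * (\<integral>\<^sup>+j. ennreal (exp (- \<bar>h * of_int j - m\<bar>)) \<partial>count_space (UNIV::int set))
     = (\<integral>\<^sup>+j. ennreal h * ennreal (exp (- \<bar>h * of_int j - m\<bar>)) \<partial>count_space (UNIV::int set))"
    by (subst nn_integral_cmult) auto
  also have "\<dots> \<le> (\<integral>\<^sup>+j. \<integral>\<^sup>+s. ennreal (exp 1 * exp (- \<bar>s\<bar>)) *
        indicator {h * of_int j - m ..< h * of_int j - m + h} s \<partial>lborel \<partial>count_space UNIV)"
  proof (rule nn_integral_mono)
    fix j :: int
    let ?I = "{h * of_int j - m ..< h * of_int j - m + h}"
    have "ennreal h * ennreal (exp (- \<bar>h * of_int j - m\<bar>))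
        = (\<integral>\<^sup>+s. ennreal (exp (- \<bar>h * of_int j - m\<bar>)) * indicator ?I s \<partial>lborel)"
      using h by (simp add: nn_integral_cmult mult.commute)
    also have "\<dots> \<le> (\<integral>\<^sup>+s. ennreal (exp 1 * exp (- \<bar>s\<bar>)) * indicator ?I s \<partial>lborel)"
      using h by (intro nn_integral_mono) (auto split: split_indicator simp: exp_add[symmetric] intro!: ennreal_leI)
    finally show "ennreal h * ennreal (exp (- \<bar>h * of_int j - m\<bar>)) \<le> \<dots>" .
  qed
  also have "\<dots> = (\<integral>\<^sup>+s. \<integral>\<^sup>+j. ennreal (exp 1 * exp (- \<bar>s\<bar>)) *
        indicator {h * of_int j - m ..< h * of_int j - m + h} s \<partial>count_space UNIV \<partial>lborel)"
    by (rule int_count_lborel.Fubini'[symmetric]) measurable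
  also have "\<dots> = (\<integral>\<^sup>+s. ennreal (exp 1 * exp (- \<bar>s\<bar>)) \<partial>lborel)"
    by (subst nn_integral_cmult) (auto simp: nn_integral_count_space_lattice_cell[OF h(1)])
  also have "\<dots> = ennreal (exp 1) * (\<integral>\<^sup>+s. ennreal (exp (- \<bar>s\<bar>)) \<partial>lborel)"
    by (simp add: ennreal_mult nn_integral_cmult)
  also have "\<dots> \<le> ennreal (exp 1) * 2"
    by (intro mult_left_mono nn_integral_exp_minus_abs) auto
  also have "\<dots> = ennreal (2 * exp 1)"
    by (subst ennreal_mult) (simp_all add: mult.commute)
  finally show ?thesis .
qed

section \<open>Error of Riemann sums of smooth, exponentially decaying functions\<close>

definition exp_decay :: "(real \<Rightarrow> real) \<Rightarrow> real \<Rightarrow> bool" where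
  "exp_decay f C \<longleftrightarrow> continuous_on UNIV f \<and> 0 \<le> C \<and> (\<forall>x. \<bar>f x\<bar> \<le> C * exp (- \<bar>x\<bar>))"

text \<open>The Riemann sum of \<open>f\<close> with mesh \<open>h\<close> and offset
  \<open>m\<close>, written as an integral over the counting measure so that Fubini's theorem can
  exchange it with Lebesgue integrals over the offset.\<close>

definition lattice_sum :: "(real \<Rightarrow> real) \<Rightarrow> real \<Rightarrow> real \<Rightarrow> real" where
  "lattice_sum f h m = (\<integral>j. h * f (h * of_int j - m) \<partial>count_space UNIV)"

lemma exp_decay_measurable: "exp_decay f C \<Longrightarrow> f \<in> borel_measurable borel"
  by (auto simp: exp_decay_def intro: borel_measurable_continuous_onI)

lemma exp_decay_integrable:
  assumes "exp_decay f C" shows "integrable lborel f"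
proof -
  have "integrable lborel (\<lambda>x::real. C * exp (- \<bar>x\<bar>))"
    using nn_integral_exp_minus_abs
    by (intro integrable_mult_right integrableI_nonneg) (auto simp: less_top[symmetric] top_unique)
  then show ?thesis
    by (rule Bochner_Integration.integrable_bound)
       (use assms exp_decay_measurable[OF assms] in \<open>auto simp: exp_decay_def intro: order_trans[OF _ abs_ge_self]\<close>)
qed

lemma nn_integral_lattice_decay:
  assumes f: "exp_decay f C" and h: "0 < h" "h \<le> 1"
  shows "(\<integral>\<^sup>+j. ennreal (h * \<bar>f (h * of_int j - m)\<bar>) \<partial>count_space UNIV) \<le> ennreal (C * (2 * exp 1))"
proof -
  have "(\<integral>\<^sup>+j. ennreal (h * \<bar>f (h * of_int j - m)\<bar>) \<partial>count_space UNIV)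
      \<le> (\<integral>\<^sup>+j. ennreal (C * h) * ennreal (exp (- \<bar>h * of_int j - m\<bar>)) \<partial>count_space UNIV)"
    using f h by (intro nn_integral_mono)
      (auto simp: exp_decay_def ennreal_mult'[symmetric] algebra_simps intro!: ennreal_leI mult_left_mono)
  also have "\<dots> = ennreal C * (ennreal h * (\<integral>\<^sup>+j. ennreal (exp (- \<bar>h * of_int j - m\<bar>)) \<partial>count_space UNIV))"
    using f h by (subst nn_integral_cmult) (auto simp: ennreal_mult exp_decay_def mult.assoc)
  also have "\<dots> \<le> ennreal C * ennreal (2 * exp 1)"
    by (intro mult_left_mono nn_integral_lattice_exp h) auto
  also have "\<dots> = ennreal (C * (2 * exp 1))"
    using f by (simp add: ennreal_mult exp_decay_def)
  finally show ?thesis .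
qed

lemma lattice_integrable:
  assumes "exp_decay f C" "0 < h" "h \<le> 1"
  shows "integrable (count_space UNIV) (\<lambda>j. h * f (h * of_int j - m))"
  using nn_integral_lattice_decay[OF assms, of m] assms(2)
  by (intro integrableI_bounded) (auto simp: abs_mult intro: le_less_trans)

lemma lattice_sum_bound:
  assumes "exp_decay f C" "0 < h" "h \<le> 1"
  shows "\<bar>lattice_sum f h m\<bar> \<le> C * (2 * exp 1)"
proof -
  have "ennreal \<bar>lattice_sum f h m\<bar> \<le> ennreal (C * (2 * exp 1))"
    unfolding lattice_sum_def
    using integral_norm_bound_ennreal[OF lattice_integrable[OF assms, of m]]
      nn_integral_lattice_decay[OF assms, of m] assms(2)
    by (auto simp: abs_mult intro: order_trans)
  then show ?thesis
    using assms(1) by (simp add: exp_decay_def ennreal_le_iff)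
qed

lemma lattice_pair_integrable:
  assumes f: "exp_decay f C" and h: "0 < h" "h \<le> 1"
  shows "integrable (count_space UNIV \<Otimes>\<^sub>M lborel)
    (\<lambda>(j, v). (h * f (h * of_int j - v)) * indicator {a<..b} v)"
proof (rule integrableI_bounded)
  have [measurable]: "f \<in> borel_measurable borel" using f by (rule exp_decay_measurable)
  show m[measurable]: "(\<lambda>(j, v). (h * f (h * of_int j - v)) * indicator {a<..b} v)
      \<in> borel_measurable (count_space UNIV \<Otimes>\<^sub>M lborel)" by measurable
  have "(\<integral>\<^sup>+z. ennreal (norm (case z of (j, v) \<Rightarrow> (h * f (h * of_int j - v)) * indicator {a<..b} v))
      \<partial>(count_space UNIV \<Otimes>\<^sub>M lborel))
    = (\<integral>\<^sup>+v. \<integral>\<^sup>+j. ennreal (norm (h * f (h * of_int j - v) * indicator {a<..b} v)) \<partial>count_space UNIV \<partial>lborel)"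
    by (subst int_count_lborel.nn_integral_snd[symmetric]) auto
  also have "\<dots> \<le> (\<integral>\<^sup>+v. ennreal (C * (2 * exp 1)) * indicator {a<..b} v \<partial>lborel)"
    using nn_integral_lattice_decay[OF f h] h(1)
    by (intro nn_integral_mono) (auto simp: abs_mult split: split_indicator)
  also have "\<dots> < \<infinity>"
    by (cases "a \<le> b") (auto simp: nn_integral_cmult ennreal_mult_less_top)
  finally show "(\<integral>\<^sup>+z. ennreal (norm (case z of (j, v) \<Rightarrow> (h * f (h * of_int j - v)) * indicator {a<..b} v))
      \<partial>(count_space UNIV \<Otimes>\<^sub>M lborel)) < \<infinity>" .
qed

lemma integral_lattice_sum_interval:
  assumes f: "exp_decay f C" and h: "0 < h" "h \<le> 1"
  shows "(\<integral>v. lattice_sum f h v * indicator {a<..b} v \<partial>lborel)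
    = (\<integral>j. \<integral>v. h * f (h * of_int j - v) * indicator {a<..b} v \<partial>lborel \<partial>count_space UNIV)"
    and "integrable lborel (\<lambda>v. lattice_sum f h v * indicator {a<..b} v)"
proof -
  have eq: "lattice_sum f h v * indicator {a<..b} v
      = (\<integral>j. h * f (h * of_int j - v) * indicator {a<..b} v \<partial>count_space UNIV)" for v
    unfolding lattice_sum_def by simp
  show "(\<integral>v. lattice_sum f h v * indicator {a<..b} v \<partial>lborel)
    = (\<integral>j. \<integral>v. h * f (h * of_int j - v) * indicator {a<..b} v \<partial>lborel \<partial>count_space UNIV)"
    unfolding eq by (rule int_count_lborel.Fubini_integral[OF lattice_pair_integrable[OF f h]])
  show "integrable lborel (\<lambda>v. lattice_sum f h v * indicator {a<..b} v)"
    unfolding eq using int_count_lborel.integrable_snd[OF lattice_pair_integrable[OF f h]] by simp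
qed

text \<open>Unfolding: after the exchange of sum and integral, the substitution
  \<open>w = h * j - v\<close> sends the period of offsets, term by term, onto consecutive cells
  that tile the line.\<close>

lemma integral_lattice_sum_period:
  assumes f: "exp_decay f C" and h: "0 < h" "h \<le> 1"
  shows "(\<integral>v. lattice_sum f h v * indicator {m<..m + h} v \<partial>lborel) = h * (\<integral>x. f x \<partial>lborel)"
proof -
  have [measurable]: "f \<in> borel_measurable borel" using f by (rule exp_decay_measurable)
  \<comment> \<open>The reflection turns the left-open period into right-open cells, which is the
    form for which tiling was shown.\<close>
  define g where "g = (\<lambda>(j::int, w). h * f w * indicator {h * of_int j - (m + h) ..< h * of_int j - (m + h) + h} w)"
  have [measurable]: "(\<lambda>(j, s). indicator {h * of_int j - m' ..< h * of_int j - m' + h} s :: real)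
      \<in> borel_measurable (count_space UNIV \<Otimes>\<^sub>M lborel)" for m'
    unfolding indicator_def by measurable
  have [measurable]: "g \<in> borel_measurable (count_space UNIV \<Otimes>\<^sub>M lborel)"
    unfolding g_def by measurable
  have norm_g: "ennreal (norm (g (j, w))) = ennreal (h * \<bar>f w\<bar>) *
      indicator {h * of_int j - (m + h) ..< h * of_int j - (m + h) + h} w" for j w
    using h by (auto simp: g_def abs_mult split: split_indicator)
  have ig: "integrable (count_space UNIV \<Otimes>\<^sub>M lborel) g"
  proof (rule integrableI_bounded)
    have "(\<integral>\<^sup>+z. ennreal (norm (g z)) \<partial>(count_space UNIV \<Otimes>\<^sub>M lborel))
        = (\<integral>\<^sup>+w. \<integral>\<^sup>+j. ennreal (norm (g (j, w))) \<partial>count_space UNIV \<partial>lborel)"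
      by (subst int_count_lborel.nn_integral_snd[symmetric]) auto
    also have "\<dots> = (\<integral>\<^sup>+w. ennreal (h * \<bar>f w\<bar>) \<partial>lborel)"
      unfolding norm_g
      by (intro nn_integral_cong, subst nn_integral_cmult) (simp, subst nn_integral_count_space_lattice_cell[OF h(1)], simp)
    also have "\<dots> < \<infinity>"
      using exp_decay_integrable[OF f] h
      by (simp add: integrable_iff_bounded ennreal_mult nn_integral_cmult ennreal_mult_less_top)
    finally show "(\<integral>\<^sup>+z. ennreal (norm (g z)) \<partial>(count_space UNIV \<Otimes>\<^sub>M lborel)) < \<infinity>" .
  qed measurable
  have "(\<integral>v. lattice_sum f h v * indicator {m<..m + h} v \<partial>lborel)
      = (\<integral>j. \<integral>v. h * f (h * of_int j - v) * indicator {m<..m + h} v \<partial>lborel \<partial>count_space UNIV)"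
    by (rule integral_lattice_sum_interval[OF f h])
  also have "\<dots> = (\<integral>j. \<integral>w. g (j, w) \<partial>lborel \<partial>count_space UNIV)"
  proof (rule Bochner_Integration.integral_cong[OF refl])
    fix j :: int
    have "(\<integral>v. h * f (h * of_int j - v) * indicator {m<..m + h} v \<partial>lborel)
       = (\<integral>v. h * f (h * of_int j - (h * of_int j + (-1) * v))
           * indicator {m<..m + h} (h * of_int j + (-1) * v) \<partial>lborel)"
      using lborel_integral_real_affine[of "-1" "\<lambda>v. h * f (h * of_int j - v) * indicator {m<..m + h} v" "h * of_int j"]
      by simp
    also have "\<dots> = (\<integral>w. g (j, w) \<partial>lborel)"
      by (rule Bochner_Integration.integral_cong[OF refl]) (auto simp: g_def split: split_indicator)
    finally show "(\<integral>v. h * f (h * of_int j - v) * indicator {m<..m + h} v \<partial>lborel) = (\<integral>w. g (j, w) \<partial>lborel)" .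
  qed
  also have "\<dots> = (\<integral>w. \<integral>j. g (j, w) \<partial>count_space UNIV \<partial>lborel)"
    using int_count_lborel.Fubini_integral[of "\<lambda>j w. g (j, w)"] ig by simp
  also have "\<dots> = (\<integral>w. h * f w \<partial>lborel)"
  proof (rule Bochner_Integration.integral_cong[OF refl])
    fix w
    obtain i :: int where i: "h * of_int j - (m + h) \<le> w \<and> w < h * of_int j - (m + h) + h \<longleftrightarrow> j = i" for j
      using ex1_lattice_cell[OF h(1), of "m + h" w] by metis
    have "(\<integral>j. g (j, w) \<partial>count_space UNIV) = (\<integral>j. h * f w * indicator {i} j \<partial>count_space UNIV)"
      using i by (intro Bochner_Integration.integral_cong) (auto simp: g_def split: split_indicator)
    then show "(\<integral>j. g (j, w) \<partial>count_space UNIV) = h * f w" by simp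
  qed
  finally show ?thesis by simp
qed

text \<open>The fundamental theorem of calculus is applied to each term and the results are summed,
  so that no derivative has to be taken under the infinite sum.\<close>

lemma lattice_sum_increment:
  assumes f: "exp_decay f C" and f': "exp_decay f' C'" and h: "0 < h" "h \<le> 1"
    and der: "\<And>x. (f has_real_derivative f' x) (at x)" and "a \<le> b"
  shows "lattice_sum f h b - lattice_sum f h a = - (\<integral>v. lattice_sum f' h v * indicator {a<..b} v \<partial>lborel)"
proof -
  have cell: "(\<integral>v. h * f' (h * of_int j - v) * indicator {a<..b} v \<partial>lborel)
      = h * f (h * of_int j - a) - h * f (h * of_int j - b)" for j :: int
  proof -
    let ?F = "\<lambda>v. - h * f (h * of_int j - v)"
    let ?f = "\<lambda>v. h * f' (h * of_int j - v)"
    have d: "(?F has_real_derivative ?f v) (at v)" for v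
      by (auto intro!: derivative_eq_intros DERIV_chain2[OF der])
    have c: "continuous_on {a..b} ?f"
      using f' by (auto simp: exp_decay_def intro!: continuous_intros continuous_on_compose2[of UNIV f'])
    have [measurable]: "f' \<in> borel_measurable borel" by (rule exp_decay_measurable[OF f'])
    have "AE v in lborel. v \<noteq> a"
      using AE_lborel_singleton[of a] by simp
    then have "AE v in lborel. ?f v * indicator {a<..b} v = indicator {a..b} v *\<^sub>R ?f v"
      by eventually_elim (auto split: split_indicator)
    then have "(\<integral>v. ?f v * indicator {a<..b} v \<partial>lborel) = (\<integral>v. indicator {a..b} v *\<^sub>R ?f v \<partial>lborel)"
      by (rule integral_cong_AE[rotated 2]) measurable
    also have "\<dots> = ?F b - ?F a"
      by (rule integral_FTC_atLeastAtMost[OF \<open>a \<le> b\<close> _ c])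
         (rule has_vector_derivative_at_within[OF d[unfolded has_real_derivative_iff_has_vector_derivative]])
    finally show ?thesis by simp
  qed
  show ?thesis
    unfolding integral_lattice_sum_interval(1)[OF f' h] cell
    by (subst Bochner_Integration.integral_diff[OF lattice_integrable[OF f h] lattice_integrable[OF f h]])
       (simp add: lattice_sum_def)
qed

lemma integral_derivative_exp_decay:
  assumes f: "exp_decay f C" and f': "exp_decay f' C'"
    and der: "\<And>x. (f has_real_derivative f' x) (at x)"
  shows "(\<integral>x. f' x \<partial>lborel) = 0"
proof -
  have "((\<lambda>x::real. C * exp (- \<bar>x\<bar>)) \<longlongrightarrow> 0) at_top" "((\<lambda>x::real. C * exp (- \<bar>x\<bar>)) \<longlongrightarrow> 0) at_bot"
    by real_asymp+
  then have lim: "(f \<longlongrightarrow> 0) at_top" "(f \<longlongrightarrow> 0) at_bot"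
    using f by (auto simp: exp_decay_def intro: Lim_null_comparison[rotated])
  have "(LBINT x=-\<infinity>..\<infinity>. f' x) = 0 - 0"
  proof (rule interval_integral_FTC_integrable)
    show "isCont f' x" for x
      using f' by (simp add: exp_decay_def continuous_on_eq_continuous_at)
    show "set_integrable lborel (einterval (-\<infinity>) \<infinity>) f'"
      using exp_decay_integrable[OF f'] by (simp add: set_integrable_def einterval_def)
    show "(f has_vector_derivative f' x) (at x)" for x
      using der by (simp add: has_real_derivative_iff_has_vector_derivative)
  qed (use lim in \<open>auto simp: ereal_tendsto_simps\<close>)
  then show ?thesis
    by (simp add: interval_lebesgue_integral_def set_lebesgue_integral_def einterval_def)
qed

lemma integral_interval_bound:
  fixes g :: "real \<Rightarrow> real"
  assumes i: "integrable lborel (\<lambda>v. g v * indicator {a<..b} v)"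
    and B: "\<And>v. a < v \<Longrightarrow> v \<le> b \<Longrightarrow> \<bar>g v\<bar> \<le> B" and "a \<le> b"
  shows "\<bar>\<integral>v. g v * indicator {a<..b} v \<partial>lborel\<bar> \<le> B * (b - a)"
proof -
  have "\<bar>\<integral>v. g v * indicator {a<..b} v \<partial>lborel\<bar> \<le> (\<integral>v. \<bar>g v * indicator {a<..b} v\<bar> \<partial>lborel)"
    by (rule integral_abs_bound)
  also have "\<dots> \<le> (\<integral>v. B * indicator {a<..b} v \<partial>lborel)"
  proof (rule integral_mono)
    show "integrable lborel (\<lambda>v. \<bar>g v * indicator {a<..b} v\<bar>)" using i by (rule integrable_abs)
    show "integrable lborel (\<lambda>v. B * indicator {a<..b} v)" using \<open>a \<le> b\<close> by simp
  qed (use B in \<open>auto split: split_indicator\<close>)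
  also have "\<dots> = B * (b - a)" using \<open>a \<le> b\<close> by simp
  finally show ?thesis .
qed

text \<open>The lattice sum is periodic in its offset, with mean \<open>\<integral> f\<close> over a period, and its derivative in the
  offset is minus the lattice sum of \<open>f'\<close>.\<close>

lemma lattice_sum_error_derivative:
  assumes f: "exp_decay f C" and f': "exp_decay f' C'" and h: "0 < h" "h \<le> 1"
    and der: "\<And>x. (f has_real_derivative f' x) (at x)"
    and B: "\<And>v. \<bar>lattice_sum f' h v - (\<integral>x. f' x \<partial>lborel)\<bar> \<le> B"
  shows "\<bar>lattice_sum f h m - (\<integral>x. f x \<partial>lborel)\<bar> \<le> h * B"
proof -
  have B': "\<bar>lattice_sum f' h v\<bar> \<le> B" for v
    using B[of v] by (simp add: integral_derivative_exp_decay[OF f f' der])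
  then have "0 \<le> B" using abs_ge_zero order_trans by blast
  have inc: "\<bar>lattice_sum f h b - lattice_sum f h m\<bar> \<le> h * B" if "m \<le> b" "b \<le> m + h" for b
  proof -
    have "\<bar>\<integral>v. lattice_sum f' h v * indicator {m<..b} v \<partial>lborel\<bar> \<le> B * (b - m)"
      by (rule integral_interval_bound[OF integral_lattice_sum_interval(2)[OF f' h] B' that(1)])
    also have "\<dots> \<le> B * h" using that \<open>0 \<le> B\<close> by (intro mult_left_mono) auto
    finally show ?thesis
      unfolding lattice_sum_increment[OF f f' h der that(1)] by (simp add: mult.commute)
  qed
  have i: "integrable lborel (\<lambda>v. lattice_sum f h v * indicator {m<..m + h} v)"
    by (rule integral_lattice_sum_interval(2)[OF f h])
  have i2: "integrable lborel (\<lambda>v. lattice_sum f h m * indicator {m<..m + h} v)"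
    using h by simp
  have i3: "integrable lborel (\<lambda>v. (lattice_sum f h v - lattice_sum f h m) * indicator {m<..m + h} v)"
    using Bochner_Integration.integrable_diff[OF i i2] by (simp only: left_diff_distrib)
  have "(\<integral>v. (lattice_sum f h v - lattice_sum f h m) * indicator {m<..m + h} v \<partial>lborel)
      = h * (\<integral>x. f x \<partial>lborel) - lattice_sum f h m * h"
    unfolding left_diff_distrib Bochner_Integration.integral_diff[OF i i2] integral_lattice_sum_period[OF f h]
    using h by simp
  then have "h * ((\<integral>x. f x \<partial>lborel) - lattice_sum f h m)
      = (\<integral>v. (lattice_sum f h v - lattice_sum f h m) * indicator {m<..m + h} v \<partial>lborel)"
    by (simp only: right_diff_distrib mult.commute)
  also have "\<bar>\<dots>\<bar> \<le> h * B * (m + h - m)"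
    by (rule integral_interval_bound[OF i3]) (use inc h in auto)
  also have "\<dots> = h * (h * B)" by simp
  finally have "h * \<bar>lattice_sum f h m - (\<integral>x. f x \<partial>lborel)\<bar> \<le> h * (h * B)"
    using h by (simp add: abs_mult abs_minus_commute)
  then show ?thesis using h by simp
qed

text \<open>Every passage to the derivative gains one factor \<open>h\<close>, and the crude bound
  for the last derivative is uniform in the offset. The claim is for all members \<open>k\<close> of
  the sequence of derivatives because the induction on \<open>r\<close> moves from \<open>k\<close>
  to \<open>Suc k\<close>.\<close>

lemma lattice_sum_error_power:
  fixes F :: "nat \<Rightarrow> real \<Rightarrow> real"
  assumes decay: "\<And>k. exp_decay (F k) (C k)"
    and der: "\<And>k x. (F k has_real_derivative F (Suc k) x) (at x)"
  shows "\<exists>B. \<forall>h m. 0 < h \<longrightarrow> h \<le> 1 \<longrightarrow> \<bar>lattice_sum (F k) h m - (\<integral>x. F k x \<partial>lborel)\<bar> \<le> B * h ^ r"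
proof (induction r arbitrary: k)
  case 0
  have "\<bar>lattice_sum (F k) h m - (\<integral>x. F k x \<partial>lborel)\<bar>
      \<le> (C k * (2 * exp 1) + \<bar>\<integral>x. F k x \<partial>lborel\<bar>) * h ^ 0" if "0 < h" "h \<le> 1" for h m
    using lattice_sum_bound[OF decay[of k] that, of m] by simp
  then show ?case by blast
next
  case (Suc r)
  from Suc.IH[of "Suc k"] obtain B where
    B: "\<And>h m. 0 < h \<Longrightarrow> h \<le> 1 \<Longrightarrow> \<bar>lattice_sum (F (Suc k)) h m - (\<integral>x. F (Suc k) x \<partial>lborel)\<bar> \<le> B * h ^ r"
    by blast
  have "\<bar>lattice_sum (F k) h m - (\<integral>x. F k x \<partial>lborel)\<bar> \<le> B * h ^ Suc r" if "0 < h" "h \<le> 1" for h m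
    using lattice_sum_error_derivative[OF decay decay that der B[OF that], where m = m]
    by (simp add: algebra_simps)
  then show ?case by blast
qed

section \<open>The derivatives of the normal density\<close>

lemma pow_le_fact_exp:
  assumes "0 \<le> (x::real)" shows "x ^ n \<le> fact n * exp x"
proof -
  have "(\<Sum>i\<in>{n}. x ^ i /\<^sub>R fact i) \<le> (\<Sum>i. x ^ i /\<^sub>R fact i)"
    using assms exp_converges[of x] by (intro sum_le_suminf) (auto simp: sums_iff)
  then show ?thesis
    using exp_converges[of x] by (simp add: sums_iff field_simps)
qed

lemma poly_normal_exp_decay: "\<exists>C. exp_decay (\<lambda>x. poly p x * std_normal_density x) C"
proof -
  define K where "K = (\<Sum>i\<le>degree p. \<bar>coeff p i\<bar> * fact i)"
  have "K \<ge> 0" by (auto simp: K_def intro!: sum_nonneg)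
  have "\<bar>poly p x * std_normal_density x\<bar> \<le> (K * exp 2) * exp (- \<bar>x\<bar>)" for x
  proof -
    have "\<bar>poly p x\<bar> \<le> (\<Sum>i\<le>degree p. \<bar>coeff p i\<bar> * \<bar>x\<bar> ^ i)"
      unfolding poly_altdef by (rule order_trans[OF sum_abs]) (simp add: abs_mult power_abs)
    also have "\<dots> \<le> (\<Sum>i\<le>degree p. \<bar>coeff p i\<bar> * (fact i * exp \<bar>x\<bar>))"
      by (intro sum_mono mult_left_mono pow_le_fact_exp) auto
    also have "\<dots> = K * exp \<bar>x\<bar>"
      by (simp add: K_def sum_distrib_right mult.assoc)
    finally have p: "\<bar>poly p x\<bar> \<le> K * exp \<bar>x\<bar>" .
    \<comment> \<open>This square yields the Gaussian bound
      \<open>exp (2 - 2 * \<bar>x\<bar>)\<close>: one factor \<open>exp (- \<bar>x\<bar>)\<close>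
      absorbs the polynomial, the other one is the claimed decay.\<close>
    have "0 \<le> (\<bar>x\<bar> - 2)\<^sup>2" by simp
    then have "- x\<^sup>2 / 2 \<le> 2 - 2 * \<bar>x\<bar>" by (simp add: power2_eq_square algebra_simps)
    then have "exp (- x\<^sup>2 / 2) \<le> exp (2 - 2 * \<bar>x\<bar>)" by simp
    moreover have "1 \<le> sqrt (2 * pi)" using pi_ge_two by (simp add: real_le_rsqrt)
    ultimately have "std_normal_density x \<le> exp (2 - 2 * \<bar>x\<bar>)"
      unfolding std_normal_density_def
      using mult_mono[of "1 / sqrt (2 * pi)" 1 "exp (- x\<^sup>2 / 2)" "exp (2 - 2 * \<bar>x\<bar>)"] by simp
    with p have "\<bar>poly p x\<bar> * std_normal_density x \<le> (K * exp \<bar>x\<bar>) * exp (2 - 2 * \<bar>x\<bar>)"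
      using \<open>K \<ge> 0\<close> by (intro mult_mono) auto
    also have "\<dots> = (K * exp 2) * exp (- \<bar>x\<bar>)"
      by (simp add: exp_add[symmetric] mult.assoc)
    finally show ?thesis by (simp add: abs_mult)
  qed
  moreover have "continuous_on UNIV (\<lambda>x. poly p x * std_normal_density x)"
    unfolding std_normal_density_def by (intro continuous_intros) auto
  ultimately show ?thesis
    using \<open>K \<ge> 0\<close> by (intro exI[of _ "K * exp 2"]) (auto simp: exp_decay_def)
qed

text \<open>Up to the sign (-1)^k these are the probabilists' Hermite polynomials; with the sign
  included, \<open>hermite_poly k\<close> times the standard normal density is its
  \<open>k\<close>-th derivative.\<close>

primrec hermite_poly :: "nat \<Rightarrow> real poly" where
  "hermite_poly 0 = 1"
| "hermite_poly (Suc k) = pderiv (hermite_poly k) - [:0, 1:] * hermite_poly k"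

lemma hermite_poly_derivative:
  "((\<lambda>x. poly (hermite_poly k) x * std_normal_density x) has_real_derivative
     poly (hermite_poly (Suc k)) x * std_normal_density x) (at x)"
proof -
  have "(std_normal_density has_real_derivative - x * std_normal_density x) (at x)"
  proof -
    have "((\<lambda>x. exp (- x\<^sup>2 / 2)) has_real_derivative - x * exp (- x\<^sup>2 / 2)) (at x)"
      by (auto intro!: derivative_eq_intros)
    from DERIV_cmult[OF this, of "1 / sqrt (2 * pi)"] show ?thesis
      by (simp add: std_normal_density_def[abs_def] mult.left_commute)
  qed
  from DERIV_mult[OF poly_DERIV this, of "hermite_poly k"] show ?thesis
    by (simp add: algebra_simps)
qed

lemma normal_density_rescale:
  assumes "0 < s"
  shows "\<phi> s x = 1 / s * std_normal_density (x / s)"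
proof -
  have "- x\<^sup>2 / (2 * s\<^sup>2) = - (x / s)\<^sup>2 / 2" by (simp add: power_divide)
  moreover have "sqrt (2 * pi * s\<^sup>2) = s * sqrt (2 * pi)" using assms by (simp add: real_sqrt_mult)
  ultimately show ?thesis by (simp add: normal_density_def std_normal_density_def)
qed

text \<open>Rescaling by \<open>s\<close> reduces the claim to the standard normal density with mesh
  \<open>h / s\<close>, whose derivatives all decay exponentially. \<open>B\<close> depends on the
  order \<open>r\<close> only; order 80 is used later.\<close>

lemma lattice_normal_density:
  "\<exists>B. \<forall>h s m. 0 < h \<longrightarrow> h \<le> s \<longrightarrow>
     \<bar>(\<integral>j. h * \<phi> s (h * of_int j - m) \<partial>count_space UNIV) - 1\<bar> \<le> B * (h / s) ^ r"
proof -
  define F where "F k x = poly (hermite_poly k) x * std_normal_density x" for k x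
  have "\<forall>k. \<exists>C. exp_decay (F k) C"
    unfolding F_def using poly_normal_exp_decay by blast
  from choice[OF this] obtain C where C: "\<And>k. exp_decay (F k) (C k)" by blast
  have der: "(F k has_real_derivative F (Suc k) x) (at x)" for k x
    unfolding F_def by (rule hermite_poly_derivative)
  obtain B where B: "\<And>h m. 0 < h \<Longrightarrow> h \<le> 1 \<Longrightarrow> \<bar>lattice_sum (F 0) h m - (\<integral>x. F 0 x \<partial>lborel)\<bar> \<le> B * h ^ r"
    using lattice_sum_error_power[where F = F and C = C and k = 0 and r = r, OF C der] by auto
  have "\<bar>(\<integral>j. h * \<phi> s (h * of_int j - m) \<partial>count_space UNIV) - 1\<bar> \<le> B * (h / s) ^ r"
    if "0 < h" "h \<le> s" for h s m
  proof -
    have "h * \<phi> s (h * of_int j - m) = h / s * F 0 (h / s * of_int j - m / s)" for j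
    proof -
      have "h / s * of_int j - m / s = (h * of_int j - m) / s"
        by (simp add: diff_divide_distrib)
      then show ?thesis
        using that normal_density_rescale[of s "h * of_int j - m"] by (simp add: F_def)
    qed
    then have "(\<integral>j. h * \<phi> s (h * of_int j - m) \<partial>count_space UNIV) = lattice_sum (F 0) (h / s) (m / s)"
      by (simp add: lattice_sum_def)
    moreover have "(\<integral>x. F 0 x \<partial>lborel) = 1"
      using integral_normal_density[of 1 0] by (simp add: F_def)
    ultimately show ?thesis
      using B[of "h / s" "m / s"] that by simp
  qed
  then show ?thesis by blast
qed

lemma lattice_normal_density_integrable:
  assumes "0 < h" "h \<le> s"
  shows "integrable (count_space UNIV) (\<lambda>j. h * \<phi> s (h * of_int j - m))"
proof -
  obtain C where C: "exp_decay (\<lambda>x. poly 1 x * std_normal_density x) C"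
    using poly_normal_exp_decay by blast
  have "h * \<phi> s (h * of_int j - m) = h / s * std_normal_density (h / s * of_int j - m / s)" for j
  proof -
    have "h / s * of_int j - m / s = (h * of_int j - m) / s"
      by (simp add: diff_divide_distrib)
    then show ?thesis
      using assms normal_density_rescale[of s "h * of_int j - m"] by simp
  qed
  then show ?thesis
    using lattice_integrable[OF C, of "h / s" "m / s"] assms by simp
qed

section \<open>The Dirichlet process\<close>

lemma sets_gamma_distribution [simp, measurable_cong]: "sets (gamma_distribution a) = sets borel"
  by (simp add: gamma_distribution_def)

lemma space_gamma_distribution [simp]: "space (gamma_distribution a) = UNIV"
  by (simp add: gamma_distribution_def)

lemma gamma_distribution_density:
  assumes "0 < a"
  shows "gamma_distribution a = density lborel
    (\<lambda>x. ennreal (1 / Gamma a * (if 0 < x then x powr (a - 1) * exp (- x) else 0)))"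
  using assms unfolding gamma_distribution_def by (auto intro!: density_cong)

lemma Gamma_real_plus1: "0 < (a::real) \<Longrightarrow> Gamma (a + 1) = a * Gamma a"
  using nonpos_Ints_nonpos[of a] by (intro Gamma_plus1) linarith

lemma nn_integral_gamma_kernel:
  assumes "0 < a"
  shows "(\<integral>\<^sup>+x. ennreal (if 0 < x then x powr (a - 1) * exp (- x) else 0) \<partial>lborel) = ennreal (Gamma a)"
proof -
  have "AE x in lborel. x \<noteq> (0::real)" using AE_lborel_singleton[of "0::real"] by simp
  then have "(\<integral>\<^sup>+x. ennreal (if 0 < x then x powr (a - 1) * exp (- x) else 0) \<partial>lborel)
     = (\<integral>\<^sup>+t. ennreal (indicator {0..} t * t powr (a - 1) / exp t) \<partial>lborel)"
    by (intro nn_integral_cong_AE) (eventually_elim, auto simp: exp_minus divide_inverse)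
  then show ?thesis using Gamma_conv_nn_integral_real[OF assms] by simp
qed

lemma nn_integral_gamma_distribution_powr:
  assumes "0 < a" "0 < a + r"
  shows "(\<integral>\<^sup>+x. ennreal (x powr r) \<partial>gamma_distribution a) = ennreal (Gamma (a + r) / Gamma a)"
proof -
  have G: "0 < Gamma a" using assms by (simp add: Gamma_real_pos)
  have "(\<integral>\<^sup>+x. ennreal (x powr r) \<partial>gamma_distribution a)
     = (\<integral>\<^sup>+x. ennreal (1 / Gamma a) * ennreal (if 0 < x then x powr (a + r - 1) * exp (- x) else 0) \<partial>lborel)"
    unfolding gamma_distribution_density[OF assms(1)] using G
    by (subst nn_integral_density)
       (auto intro!: nn_integral_cong simp: ennreal_mult'[symmetric] powr_add[symmetric] algebra_simps)
  also have "\<dots> = ennreal (1 / Gamma a) * ennreal (Gamma (a + r))"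
    using nn_integral_gamma_kernel[OF assms(2)] by (subst nn_integral_cmult) auto
  finally show ?thesis using G assms by (simp add: ennreal_mult'[symmetric])
qed

lemma prob_space_gamma_distribution:
  assumes "0 \<le> a" shows "prob_space (gamma_distribution a)"
proof (cases "a = 0")
  case True
  then show ?thesis by (simp add: gamma_distribution_def prob_space_return)
next
  case False
  with assms have a: "0 < a" by simp
  then have G: "0 < Gamma a" by (simp add: Gamma_real_pos)
  have "emeasure (gamma_distribution a) (space (gamma_distribution a))
     = (\<integral>\<^sup>+x. ennreal (1 / Gamma a) * ennreal (if 0 < x then x powr (a - 1) * exp (- x) else 0) \<partial>lborel)"
    unfolding gamma_distribution_density[OF a] using G
    by (subst emeasure_density) (auto intro!: nn_integral_cong simp: ennreal_mult'[symmetric])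
  also have "\<dots> = ennreal (1 / Gamma a) * ennreal (Gamma a)"
    using nn_integral_gamma_kernel[OF a] by (subst nn_integral_cmult) auto
  also have "\<dots> = 1" using G by (simp add: ennreal_mult'[symmetric])
  finally show ?thesis by (rule prob_spaceI)
qed

lemma AE_gamma_distribution_pos:
  assumes "0 < a" shows "AE x in gamma_distribution a. 0 < x"
  using assms Gamma_real_pos[OF assms] unfolding gamma_distribution_density[OF assms]
  by (subst AE_density) (auto split: if_splits)

lemma AE_gamma_distribution_nonneg:
  assumes "0 \<le> a" shows "AE x in gamma_distribution a. 0 \<le> x"
proof (cases "a = 0")
  case True
  then have eq: "gamma_distribution a = return borel 0" by (simp add: gamma_distribution_def)
  show ?thesis unfolding eq by (subst AE_return) auto
next
  case False
  with assms have "AE x in gamma_distribution a. 0 < x" by (intro AE_gamma_distribution_pos) simp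
  then show ?thesis by eventually_elim simp
qed

lemma nn_integral_gamma_distribution_id:
  assumes "0 \<le> a" shows "(\<integral>\<^sup>+x. ennreal x \<partial>gamma_distribution a) = ennreal a"
proof (cases "a = 0")
  case True
  then show ?thesis by (simp add: gamma_distribution_def nn_integral_return)
next
  case False
  with assms have a: "0 < a" by simp
  have "(\<integral>\<^sup>+x. ennreal x \<partial>gamma_distribution a) = (\<integral>\<^sup>+x. ennreal (x powr 1) \<partial>gamma_distribution a)"
    using AE_gamma_distribution_pos[OF a] by (intro nn_integral_cong_AE) (auto elim!: eventually_mono)
  also have "\<dots> = ennreal (Gamma (a + 1) / Gamma a)"
    by (rule nn_integral_gamma_distribution_powr) (use a in auto)
  also have "Gamma (a + 1) / Gamma a = a"
    using a Gamma_real_pos[OF a] by (simp add: Gamma_real_plus1[OF a] del: Gamma_real_pos)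
  finally show ?thesis .
qed

lemma nn_integral_gamma_distribution_inverse:
  assumes "1 < b" shows "(\<integral>\<^sup>+x. ennreal (1 / x) \<partial>gamma_distribution b) = ennreal (1 / (b - 1))"
proof -
  have "(\<integral>\<^sup>+x. ennreal (1 / x) \<partial>gamma_distribution b) = (\<integral>\<^sup>+x. ennreal (x powr (-1)) \<partial>gamma_distribution b)"
    using AE_gamma_distribution_pos[of b] assms
    by (intro nn_integral_cong_AE) (auto elim!: eventually_mono simp: powr_minus_divide)
  also have "\<dots> = ennreal (Gamma (b + -1) / Gamma b)"
    by (rule nn_integral_gamma_distribution_powr) (use assms in auto)
  also have "Gamma (b + -1) / Gamma b = 1 / (b - 1)"
    using assms Gamma_real_plus1[of "b - 1"] Gamma_real_pos[of "b - 1"]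
    by (simp add: less_imp_neq[symmetric] del: Gamma_real_pos)
  finally show ?thesis .
qed

text \<open>The point is uniformity in small shapes \<open>a\<close>. Since
  \<open>1 / Gamma a = a / Gamma (a + 1)\<close> and \<open>Gamma\<close> is bounded on {1..1 + A},
  the density loses only one factor \<open>a\<close>; and \<open>w powr a\<close> is at least
  \<open>w powr A\<close> because \<open>w \<le> 1\<close>.\<close>

lemma gamma_distribution_interval_bound:
  fixes A :: real
  assumes "0 < A"
  shows "\<exists>c>0. \<forall>a w \<tau>. 0 < a \<longrightarrow> a \<le> A \<longrightarrow> 0 < w \<longrightarrow> w \<le> 1 \<longrightarrow> 0 < \<tau> \<longrightarrow> \<tau> \<le> 1 \<longrightarrow>
    ennreal (c * \<tau> * a * w powr A) \<le> emeasure (gamma_distribution a) {w..w * (1 + \<tau>)}"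
proof -
  have "continuous_on {1..1 + A} (Gamma :: real \<Rightarrow> real)"
    by (intro continuous_on_Gamma continuous_on_id) (auto elim!: nonpos_Ints_cases)
  then have "bounded (Gamma ` {1..1 + A})"
    by (intro compact_imp_bounded compact_continuous_image) auto
  then obtain K where "0 < K" and K': "\<forall>y \<in> Gamma ` {1..1 + A}. norm y \<le> K"
    unfolding bounded_pos by blast
  have K: "Gamma x \<le> K" if "1 \<le> x" "x \<le> 1 + A" for x
    using bspec[OF K', of "Gamma x"] that by auto
  \<comment> \<open>On the interval \<open>x \<le> 2 * w \<le> 2\<close>: this gives the 2 in the
    denominator and the factor \<open>exp (- 2)\<close>.\<close>
  define c where "c = exp (- 2) / (2 * K)"
  have "0 < c" using \<open>0 < K\<close> by (simp add: c_def)
  have "ennreal (c * \<tau> * a * w powr A) \<le> emeasure (gamma_distribution a) {w..w * (1 + \<tau>)}"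
    if a: "0 < a" "a \<le> A" and w: "0 < w" "w \<le> 1" and \<tau>: "0 < \<tau>" "\<tau> \<le> 1" for a w \<tau>
  proof -
    have G: "0 < Gamma a" using a by (simp add: Gamma_real_pos)
    have "a * Gamma a \<le> K"
      using K[of "a + 1"] Gamma_real_plus1[of a] a by simp
    then have Gi: "a / K \<le> 1 / Gamma a" using G \<open>0 < K\<close> by (simp add: field_simps)
    have lower: "c * a * w powr A / w \<le> x powr (a - 1) * exp (- x) / Gamma a"
      if x: "w \<le> x" "x \<le> w * (1 + \<tau>)" for x
    proof -
      have "x \<le> w * 2" using x \<tau> w by (intro order_trans[OF x(2)] mult_left_mono) auto
      have "w powr A \<le> w powr a" using a w by (intro powr_mono') auto
      also have "\<dots> \<le> x powr a" using a w x by (intro powr_mono2) auto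
      finally have "w powr A / (2 * w) \<le> x powr a / x"
        using \<open>x \<le> w * 2\<close> x w by (intro frac_le) auto
      also have "x powr a / x = x powr (a - 1)" using x w by (simp add: powr_diff)
      finally have 1: "w powr A / (2 * w) \<le> x powr (a - 1)" .
      have 2: "exp (- 2) \<le> exp (- x)" using \<open>x \<le> w * 2\<close> w by simp
      have "c * a * w powr A / w = w powr A / (2 * w) * exp (- 2) * (a / K)"
        by (simp add: c_def mult.commute mult.left_commute)
      also have "\<dots> \<le> x powr (a - 1) * exp (- x) * (1 / Gamma a)"
        using 1 2 Gi a w \<open>0 < K\<close> by (intro mult_mono) auto
      finally show ?thesis by simp
    qed
    have "ennreal (c * \<tau> * a * w powr A) = (\<integral>\<^sup>+x. ennreal (c * a * w powr A / w) * indicator {w..w * (1 + \<tau>)} x \<partial>lborel)"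
      using w \<tau> a \<open>0 < c\<close>
      by (subst nn_integral_cmult_indicator) (auto simp: ennreal_mult'[symmetric] algebra_simps)
    also have "\<dots> \<le> (\<integral>\<^sup>+x. ennreal (if 0 < x then x powr (a - 1) * exp (- x) / Gamma a else 0) * indicator {w..w * (1 + \<tau>)} x \<partial>lborel)"
      using lower w by (intro nn_integral_mono) (auto split: split_indicator intro!: ennreal_leI)
    also have "\<dots> = emeasure (gamma_distribution a) {w..w * (1 + \<tau>)}"
      unfolding gamma_distribution_density[OF a(1)]
      by (subst emeasure_density) (auto intro!: nn_integral_cong simp: divide_inverse mult.commute)
    finally show ?thesis .
  qed
  with \<open>0 < c\<close> show ?thesis by blast
qed

section \<open>Means and small balls of the Dirichlet process\<close>

context
  fixes A :: "'a measure" and D :: "'a measure measure"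
  assumes DP: "is_dirichlet_process A D"
begin

lemma sets_dirichlet_process: "sets D = sets (prob_algebra A)"
  and prob_space_dirichlet_process: "prob_space D"
proof -
  have "D \<in> space (prob_algebra (prob_algebra A))"
    using DP unfolding is_dirichlet_process_def by (rule conjunct1)
  then show "sets D = sets (prob_algebra A)" and "prob_space D"
    unfolding space_prob_algebra[of "prob_algebra A"] by auto
qed

lemma space_dirichlet_process: "space D = space (prob_algebra A)"
  using sets_dirichlet_process by (rule sets_eq_imp_space_eq)

lemma measurable_measure_dirichlet_process:
  assumes "B \<in> sets A" shows "(\<lambda>G. measure G B) \<in> borel_measurable D"
  unfolding measurable_cong_sets[OF sets_dirichlet_process refl]
  using assms by (rule measurable_measure_prob_algebra)

lemma measurable_measures_dirichlet_process:
  assumes "\<And>i. i < k \<Longrightarrow> B i \<in> sets A"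
  shows "(\<lambda>G. \<lambda>i\<in>{..<k::nat}. measure G (B i)) \<in> D \<rightarrow>\<^sub>M PiM {..<k} (\<lambda>_. borel)"
  using assms by (intro measurable_restrict measurable_measure_dirichlet_process) auto

lemma measurable_normalize:
  "(\<lambda>z. \<lambda>i\<in>{..<k::nat}. z i / (\<Sum>j<k. z j :: real)) \<in> PiM {..<k} (\<lambda>i. gamma_distribution (a i)) \<rightarrow>\<^sub>M PiM {..<k} (\<lambda>_. borel)"
proof (rule measurable_restrict)
  have [measurable]: "(\<lambda>z. z i) \<in> borel_measurable (PiM {..<k} (\<lambda>i. gamma_distribution (a i)))" if "i < k" for i
    using measurable_component_singleton[of i "{..<k}" "\<lambda>i. gamma_distribution (a i)"] that
    by (simp cong: measurable_cong_sets)
  show "(\<lambda>z. z i / (\<Sum>j<k. z j)) \<in> borel_measurable (PiM {..<k} (\<lambda>i. gamma_distribution (a i)))"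
    if "i \<in> {..<k}" for i
    using that by (intro borel_measurable_divide borel_measurable_sum) auto
qed

lemma dirichlet_process_partition:
  assumes B: "\<And>i. i < k \<Longrightarrow> B i \<in> sets A" "disjoint_family_on B {..<k::nat}" "(\<Union>i<k. B i) = space A"
    and f: "f \<in> borel_measurable (PiM {..<k} (\<lambda>_. borel))"
  shows "(\<integral>\<^sup>+G. f (\<lambda>i\<in>{..<k}. measure G (B i)) \<partial>D)
    = (\<integral>\<^sup>+z. f (\<lambda>i\<in>{..<k}. z i / (\<Sum>j<k. z j)) \<partial>PiM {..<k} (\<lambda>i. gamma_distribution (measure A (B i))))"
proof -
  have "distr D (PiM {..<k} (\<lambda>_. borel)) (\<lambda>G. \<lambda>i\<in>{..<k}. measure G (B i))
      = dirichlet_distribution {..<k} (\<lambda>i. measure A (B i))"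
    using DP B unfolding is_dirichlet_process_def by blast
  then have "(\<integral>\<^sup>+x. f x \<partial>distr D (PiM {..<k} (\<lambda>_. borel)) (\<lambda>G. \<lambda>i\<in>{..<k}. measure G (B i)))
      = (\<integral>\<^sup>+x. f x \<partial>dirichlet_distribution {..<k} (\<lambda>i. measure A (B i)))" by simp
  then show ?thesis
    unfolding dirichlet_distribution_def
    by (subst (asm) (1 2) nn_integral_distr)
       (use measurable_measures_dirichlet_process[OF B(1)] measurable_normalize f in auto)
qed

text \<open>With independent Gamma variables Z0 for \<open>B\<close> and Z1 for its complement, Z0 /
  (Z0 + Z1) is at most Z0 times 1 / Z1, and the expectation factorises. The inverse moment of Z1 is
  finite only for shape above 1; this is how \<open>1 < \<alpha>\<close> enters for sets
  \<open>B\<close> of small base measure.\<close>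

lemma dirichlet_process_mean_le:
  assumes B: "B \<in> sets A" and b: "1 < measure A (space A - B)"
  shows "(\<integral>\<^sup>+G. ennreal (measure G B) \<partial>D) \<le> ennreal (measure A B / (measure A (space A - B) - 1))"
proof -
  define C where "C i = (if i = 0 then B else space A - B)" for i :: nat
  let ?\<gamma> = "\<lambda>i. gamma_distribution (measure A (C i))"
  have lt2: "{..<2} = {0, 1::nat}" by auto
  have C: "\<And>i. i < 2 \<Longrightarrow> C i \<in> sets A" "disjoint_family_on C {..<2}" "(\<Union>i<2. C i) = space A"
    using B sets.sets_into_space[OF B] by (auto simp: C_def disjoint_family_on_def lt2)
  have ps: "prob_space (?\<gamma> i)" for i by (rule prob_space_gamma_distribution) simp
  interpret product_sigma_finite ?\<gamma>
    using ps by (auto simp: product_sigma_finite_def prob_space_imp_sigma_finite)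
  have m: "(\<lambda>x::nat \<Rightarrow> real. ennreal (x 0)) \<in> borel_measurable (PiM {..<2} (\<lambda>_. borel))"
    by (intro measurable_compose[OF measurable_component_singleton]) auto
  have "(\<integral>\<^sup>+G. ennreal (measure G B) \<partial>D) = (\<integral>\<^sup>+G. ennreal ((\<lambda>i\<in>{..<2::nat}. measure G (C i)) 0) \<partial>D)"
    by (simp add: C_def)
  also have "\<dots> = (\<integral>\<^sup>+z. ennreal ((\<lambda>i\<in>{..<2::nat}. z i / (\<Sum>j<2. z j)) 0) \<partial>PiM {..<2} ?\<gamma>)"
    by (rule dirichlet_process_partition[OF C m])
  also have "\<dots> \<le> (\<integral>\<^sup>+z. (\<Prod>i<2. (if i = 0 then ennreal (z i) else ennreal (1 / z i))) \<partial>PiM {..<2} ?\<gamma>)"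
  proof (rule nn_integral_mono_AE)
    have 0: "AE z in PiM {..<2} ?\<gamma>. 0 \<le> z 0"
      by (rule AE_PiM_component[OF ps]) (auto intro: AE_gamma_distribution_nonneg)
    have 1: "AE z in PiM {..<2} ?\<gamma>. 0 < z 1"
      by (rule AE_PiM_component[OF ps]) (use b in \<open>auto intro!: AE_gamma_distribution_pos simp: C_def\<close>)
    from 0 1 show "AE z in PiM {..<2} ?\<gamma>. ennreal ((\<lambda>i\<in>{..<2::nat}. z i / (\<Sum>j<2. z j)) 0)
        \<le> (\<Prod>i<2. (if i = 0 then ennreal (z i) else ennreal (1 / z i)))"
    proof eventually_elim
      case (elim z)
      then have "z 0 / (z 0 + z 1) \<le> z 0 * (1 / z 1)"
        by (simp add: frac_le)
      then show ?case
        using elim by (simp add: lt2 ennreal_mult'[symmetric] ennreal_leI)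
    qed
  qed
  also have "\<dots> = (\<Prod>i<2. \<integral>\<^sup>+x. (if i = 0 then ennreal x else ennreal (1 / x)) \<partial>?\<gamma> i)"
    by (rule product_nn_integral_prod[where f = "\<lambda>i x. if i = 0 then ennreal x else ennreal (1 / x)"]) auto
  also have "\<dots> = ennreal (measure A B) * ennreal (1 / (measure A (space A - B) - 1))"
    using b by (simp add: lt2 C_def nn_integral_gamma_distribution_id nn_integral_gamma_distribution_inverse)
  finally show ?thesis
    using b by (simp add: ennreal_mult'[symmetric])
qed

text \<open>If every Gamma variable lies between \<open>w i\<close> and
  \<open>(1 + \<tau>) * w i\<close>, their sum exceeds that of the \<open>w i\<close> by at most the
  factor \<open>1 + \<tau>\<close>, and independence gives the product. Only lower bounds on cell
  masses are recorded, since a lower bound on the mixture is all that follows from them.\<close>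

lemma dirichlet_process_small_ball:
  fixes w :: "nat \<Rightarrow> real"
  assumes B: "\<And>i. i < k \<Longrightarrow> B i \<in> sets A" "disjoint_family_on B {..<k::nat}" "(\<Union>i<k. B i) = space A"
    and w: "\<And>i. i < k \<Longrightarrow> 0 < w i" and "0 < \<tau>" "0 < k"
  shows "(\<Prod>i<k. emeasure (gamma_distribution (measure A (B i))) {w i..w i * (1 + \<tau>)})
    \<le> emeasure D {G\<in>space D. \<forall>i<k. w i / ((1 + \<tau>) * (\<Sum>j<k. w j)) \<le> measure G (B i)}"
proof -
  let ?\<gamma> = "\<lambda>i. gamma_distribution (measure A (B i))"
  let ?t = "\<lambda>i. w i / ((1 + \<tau>) * (\<Sum>j<k. w j))"
  define E where "E = {x\<in>space (PiM {..<k} (\<lambda>_. borel)). \<forall>i\<in>{..<k}. ?t i \<le> x i}"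
  have E: "E \<in> sets (PiM {..<k} (\<lambda>_. borel))"
    unfolding E_def by (intro sets.sets_Collect_finite_All) measurable
  have ps: "prob_space (?\<gamma> i)" for i by (rule prob_space_gamma_distribution) simp
  interpret product_sigma_finite ?\<gamma>
    using ps by (auto simp: product_sigma_finite_def prob_space_imp_sigma_finite)
  have "(\<Prod>i<k. emeasure (?\<gamma> i) {w i..w i * (1 + \<tau>)}) = emeasure (PiM {..<k} ?\<gamma>) (PiE {..<k} (\<lambda>i. {w i..w i * (1 + \<tau>)}))"
    by (rule emeasure_PiM[symmetric]) auto
  also have "\<dots> = (\<integral>\<^sup>+z. indicator (PiE {..<k} (\<lambda>i. {w i..w i * (1 + \<tau>)})) z \<partial>PiM {..<k} ?\<gamma>)"
    by (rule nn_integral_indicator[symmetric]) (auto intro!: sets_PiM_I_finite)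
  also have "\<dots> \<le> (\<integral>\<^sup>+z. indicator E (\<lambda>i\<in>{..<k}. z i / (\<Sum>j<k. z j)) \<partial>PiM {..<k} ?\<gamma>)"
  proof (rule nn_integral_mono)
    fix z :: "nat \<Rightarrow> real"
    show "indicator (PiE {..<k} (\<lambda>i. {w i..w i * (1 + \<tau>)})) z
        \<le> (indicator E (\<lambda>i\<in>{..<k}. z i / (\<Sum>j<k. z j)) :: ennreal)"
    proof (cases "z \<in> PiE {..<k} (\<lambda>i. {w i..w i * (1 + \<tau>)})")
      case True
      then have z: "w i \<le> z i" "z i \<le> w i * (1 + \<tau>)" if "i < k" for i
        using that by (auto simp: PiE_iff)
      have "(\<Sum>j<k. z j) \<le> (\<Sum>j<k. w j * (1 + \<tau>))"
        using z by (intro sum_mono) auto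
      then have up: "(\<Sum>j<k. z j) \<le> (1 + \<tau>) * (\<Sum>j<k. w j)"
        by (simp add: sum_distrib_left mult.commute)
      have "0 < (\<Sum>j<k. z j)"
        using z w \<open>0 < k\<close> by (intro sum_pos) (auto intro: less_le_trans)
      then have "?t i \<le> z i / (\<Sum>j<k. z j)" if "i < k" for i
        using z[OF that] w[OF that] up by (intro frac_le) auto
      then show ?thesis
        by (auto simp: E_def space_PiM split: split_indicator)
    qed simp
  qed
  also have "\<dots> = (\<integral>\<^sup>+G. indicator E (\<lambda>i\<in>{..<k}. measure G (B i)) \<partial>D)"
    by (rule dirichlet_process_partition[OF B, symmetric]) (use E in measurable)
  also have "\<dots> = (\<integral>\<^sup>+G. indicator {G\<in>space D. \<forall>i<k. ?t i \<le> measure G (B i)} G \<partial>D)"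
    by (rule nn_integral_cong) (auto simp: E_def space_PiM split: split_indicator)
  also have "\<dots> = emeasure D {G\<in>space D. \<forall>i<k. ?t i \<le> measure G (B i)}"
  proof (rule nn_integral_indicator)
    have "{G\<in>space D. \<forall>i\<in>{..<k}. ?t i \<le> measure G (B i)} \<in> sets D"
    proof (rule sets.sets_Collect_finite_All)
      fix i assume "i \<in> {..<k}"
      then have [measurable]: "(\<lambda>G. measure G (B i)) \<in> borel_measurable D"
        by (intro measurable_measure_dirichlet_process B(1)) simp
      show "{G\<in>space D. ?t i \<le> measure G (B i)} \<in> sets D" by measurable
    qed simp
    then show "{G\<in>space D. \<forall>i<k. ?t i \<le> measure G (B i)} \<in> sets D"
      unfolding Ball_def lessThan_iff .
  qed
  finally show ?thesis .
qed

end

section \<open>Lattice mixtures\<close>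

text \<open>Completing the square in \<open>z\<close>. The first factor on the right is the density
  of the convolution; the second, as a function of \<open>z\<close>, is a normal density around the
  midpoint, so that a lattice sum over \<open>z\<close> is again a lattice sum of a normal
  density.\<close>

lemma normal_density_product:
  assumes "0 < \<sigma>"
  shows "\<phi> \<sigma> (z - y) * \<phi> \<sigma> (x - z)
    = \<phi> (sqrt 2 * \<sigma>) (x - y) * \<phi> (\<sigma> / sqrt 2) (z - (x + y) / 2)"
proof -
  have "- (z - y)\<^sup>2 / (2 * \<sigma>\<^sup>2) + - (x - z)\<^sup>2 / (2 * \<sigma>\<^sup>2)
      = - (x - y)\<^sup>2 / (2 * (sqrt 2 * \<sigma>)\<^sup>2) + - (z - (x + y) / 2)\<^sup>2 / (2 * (\<sigma> / sqrt 2)\<^sup>2)"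
    using assms by (simp add: power_mult_distrib power_divide divide_simps) (simp add: power2_eq_square algebra_simps)
  then have "exp (- (z - y)\<^sup>2 / (2 * \<sigma>\<^sup>2)) * exp (- (x - z)\<^sup>2 / (2 * \<sigma>\<^sup>2))
      = exp (- (x - y)\<^sup>2 / (2 * (sqrt 2 * \<sigma>)\<^sup>2)) * exp (- (z - (x + y) / 2)\<^sup>2 / (2 * (\<sigma> / sqrt 2)\<^sup>2))"
    by (simp only: exp_add[symmetric])
  moreover have "sqrt (2 * pi * \<sigma>\<^sup>2) * sqrt (2 * pi * \<sigma>\<^sup>2) = sqrt (2 * pi * (sqrt 2 * \<sigma>)\<^sup>2) * sqrt (2 * pi * (\<sigma> / sqrt 2)\<^sup>2)"
    unfolding real_sqrt_mult[symmetric] by (simp add: power_mult_distrib power_divide)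
  ultimately show ?thesis
    unfolding normal_density_def by (simp add: times_divide_times_eq)
qed

lemma normal_density_antimono:
  assumes "\<bar>x\<bar> \<le> \<bar>y\<bar>" shows "\<phi> \<sigma> y \<le> \<phi> \<sigma> x"
proof -
  have "x\<^sup>2 \<le> y\<^sup>2" using assms by (simp add: abs_le_square_iff)
  then have "- y\<^sup>2 / (2 * \<sigma>\<^sup>2) \<le> - x\<^sup>2 / (2 * \<sigma>\<^sup>2)" by (simp add: divide_right_mono)
  then show ?thesis unfolding normal_density_def by (auto intro!: divide_right_mono)
qed

lemma sum_le_count_space_integral:
  fixes f :: "int \<Rightarrow> real"
  assumes "integrable (count_space UNIV) f" "\<And>j. 0 \<le> f j" "finite S"
  shows "(\<Sum>j\<in>S. f j) \<le> (\<integral>j. f j \<partial>count_space UNIV)"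
    and "(\<integral>j. f j \<partial>count_space UNIV) = (\<Sum>j\<in>S. f j) + (\<integral>j. f j * indicator (- S) j \<partial>count_space UNIV)"
proof -
  have i: "integrable (count_space UNIV) (\<lambda>j. f j * indicator S j)"
    using integrable_mult_indicator[of S "count_space UNIV" f] assms(1) by (simp add: mult.commute)
  have s: "(\<integral>j. f j * indicator S j \<partial>count_space UNIV) = (\<Sum>j\<in>S. f j)"
  proof -
    have "(\<integral>j. f j * indicator S j \<partial>count_space UNIV) = (\<integral>j. (\<Sum>i\<in>S. f i * indicator {i} j) \<partial>count_space UNIV)"
      using assms(3) by (intro Bochner_Integration.integral_cong)
        (auto simp: indicator_def if_distrib sum.If_cases cong: if_cong)
    also have "\<dots> = (\<Sum>i\<in>S. f i)"
      by (subst Bochner_Integration.integral_sum) auto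
    finally show ?thesis .
  qed
  have i2: "integrable (count_space UNIV) (\<lambda>j. f j * indicator (- S) j)"
    using integrable_mult_indicator[of "- S" "count_space UNIV" f] assms(1) by (simp add: mult.commute)
  have "(\<integral>j. f j \<partial>count_space UNIV) = (\<integral>j. f j * indicator S j + f j * indicator (- S) j \<partial>count_space UNIV)"
    by (intro Bochner_Integration.integral_cong) (auto split: split_indicator)
  then show eq: "(\<integral>j. f j \<partial>count_space UNIV) = (\<Sum>j\<in>S. f j) + (\<integral>j. f j * indicator (- S) j \<partial>count_space UNIV)"
    using Bochner_Integration.integral_add[OF i i2] s by simp
  have "0 \<le> (\<integral>j. f j * indicator (- S) j \<partial>count_space UNIV)"
    using assms(2) by (intro integral_nonneg_AE) (auto split: split_indicator)
  with eq show "(\<Sum>j\<in>S. f j) \<le> (\<integral>j. f j \<partial>count_space UNIV)" by simp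
qed

lemma normal_mixture_integrable:
  assumes "G \<in> space (prob_algebra borel)"
  shows "integrable G (\<lambda>z. \<phi> \<sigma> (x - z))"
proof -
  from assms interpret prob_space G by (simp add: space_prob_algebra)
  from assms have [measurable_cong]: "sets G = sets borel" by (simp add: space_prob_algebra)
  have "\<phi> \<sigma> y \<le> 1 / sqrt (2 * pi * \<sigma>\<^sup>2)" for y
    by (simp add: normal_density_def divide_right_mono)
  then show ?thesis
    by (intro integrable_const_bound[where B = "1 / sqrt (2 * pi * \<sigma>\<^sup>2)"]) simp_all
qed

lemma normal_mixture_nonneg: "0 \<le> normal_mixture \<sigma> G x"
  unfolding normal_mixture_def by (intro integral_nonneg_AE) auto

text \<open>\<open>l\<close> is the mesh, the interval of half-width \<open>a\<close> is the window
  on which mixtures are to be bounded below, and the nodes reach at least one unit beyond it. The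
  lattice sums are controlled at two scales: \<open>\<sigma> / sqrt 2\<close> for products of two
  kernels, from below, and \<open>\<sigma>\<close> for the total weight, from above.
  \<open>P\<close> is the law whose smoothing is sampled, later the true one.\<close>

locale lattice_approximation =
  fixes \<sigma> l \<delta> a :: real and J :: nat and P :: "real measure"
  assumes \<sigma>: "0 < \<sigma>" and l: "0 < l" "l \<le> \<sigma> / sqrt 2" and \<delta>: "0 \<le> \<delta>" "\<delta> \<le> 1"
    and lower: "\<And>m. 1 - \<delta> \<le> (\<integral>j. l * \<phi> (\<sigma> / sqrt 2) (l * of_int j - m) \<partial>count_space UNIV)"
    and upper: "\<And>m. (\<integral>j. l * \<phi> \<sigma> (l * of_int j - m) \<partial>count_space UNIV) \<le> 1 + \<delta>"
    and J: "a + 1 \<le> l * real J" and a: "0 \<le> a"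
    and P: "P \<in> space (prob_algebra borel)"
begin

definition nodes :: "int set" where "nodes = {- int J..int J}"

lemma finite_nodes [simp]: "finite nodes" by (simp add: nodes_def)

lemma l_le_\<sigma>: "l \<le> \<sigma>"
proof -
  have "\<sigma> / sqrt 2 \<le> \<sigma> / 1" using \<sigma> by (intro divide_left_mono) auto
  with l show ?thesis by simp
qed

text \<open>\<open>upper\<close> averaged over \<open>P\<close>. This keeps the total weight close
  to 1, so that normalising the weights costs only a factor close to 1.\<close>

lemma node_sum_le:
  "(\<Sum>j\<in>nodes. l * normal_mixture \<sigma> P (l * of_int j)) \<le> 1 + \<delta>"
proof -
  from P interpret P: prob_space P by (simp add: space_prob_algebra)
  have "(\<Sum>j\<in>nodes. l * normal_mixture \<sigma> P (l * of_int j))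
      = (\<integral>y. (\<Sum>j\<in>nodes. l * \<phi> \<sigma> (l * of_int j - y)) \<partial>P)"
    unfolding normal_mixture_def
    by (subst Bochner_Integration.integral_sum) (auto intro!: normal_mixture_integrable P)
  also have "\<dots> \<le> (\<integral>y. 1 + \<delta> \<partial>P)"
  proof (rule integral_mono)
    show "integrable P (\<lambda>y. \<Sum>j\<in>nodes. l * \<phi> \<sigma> (l * of_int j - y))"
      by (auto intro!: normal_mixture_integrable P)
    show "(\<Sum>j\<in>nodes. l * \<phi> \<sigma> (l * of_int j - y)) \<le> 1 + \<delta>" for y
      using sum_le_count_space_integral(1)[OF lattice_normal_density_integrable[OF l(1) l_le_\<sigma>, of y], of nodes]
        upper[of y] l by auto
  qed simp
  finally show ?thesis by (simp add: P.prob_space)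
qed

text \<open>Over the full lattice, \<open>normal_density_product\<close> and \<open>lower\<close>
  give the main term. An omitted node is at distance at least 1 from \<open>x\<close>, so its second
  kernel is at most \<open>\<phi> \<sigma> 1\<close>, and the first kernels sum to at most
  \<open>1 + \<delta> \<le> 2\<close>.\<close>

lemma kernel_sum_ge:
  assumes x: "\<bar>x\<bar> \<le> a"
  shows "(1 - \<delta>) * \<phi> (sqrt 2 * \<sigma>) (x - y) - 2 * \<phi> \<sigma> 1
    \<le> (\<Sum>j\<in>nodes. l * \<phi> \<sigma> (l * of_int j - y) * \<phi> \<sigma> (x - l * of_int j))"
proof -
  let ?f = "\<lambda>j. l * \<phi> \<sigma> (l * of_int j - y) * \<phi> \<sigma> (x - l * of_int j)"
  have eq: "?f j = \<phi> (sqrt 2 * \<sigma>) (x - y) * (l * \<phi> (\<sigma> / sqrt 2) (l * of_int j - (x + y) / 2))" for j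
    using normal_density_product[OF \<sigma>, of "l * of_int j" y x] by (simp add: mult.assoc mult.left_commute)
  have i: "integrable (count_space UNIV) ?f"
    unfolding eq by (intro integrable_mult_right lattice_normal_density_integrable l)
  have "(1 - \<delta>) * \<phi> (sqrt 2 * \<sigma>) (x - y) \<le> (\<integral>j. ?f j \<partial>count_space UNIV)"
    unfolding eq using mult_right_mono[OF lower[of "(x + y) / 2"], of "\<phi> (sqrt 2 * \<sigma>) (x - y)"]
    by (simp add: mult.commute mult.left_commute)
  also have "\<dots> = (\<Sum>j\<in>nodes. ?f j) + (\<integral>j. ?f j * indicator (- nodes) j \<partial>count_space UNIV)"
    by (rule sum_le_count_space_integral(2)[OF i]) (use l in auto)
  also have "(\<integral>j. ?f j * indicator (- nodes) j \<partial>count_space UNIV)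
      \<le> (\<integral>j. \<phi> \<sigma> 1 * (l * \<phi> \<sigma> (l * of_int j - y)) \<partial>count_space UNIV)"
  proof (rule integral_mono)
    show "integrable (count_space UNIV) (\<lambda>j. ?f j * indicator (- nodes) j)"
      using integrable_mult_indicator[of "- nodes" "count_space UNIV" ?f] i by (simp add: mult.commute)
    show "integrable (count_space UNIV) (\<lambda>j. \<phi> \<sigma> 1 * (l * \<phi> \<sigma> (l * of_int j - y)))"
      by (intro integrable_mult_right lattice_normal_density_integrable l l_le_\<sigma>)
    show "?f j * indicator (- nodes) j \<le> \<phi> \<sigma> 1 * (l * \<phi> \<sigma> (l * of_int j - y))" for j
    proof (cases "j \<in> nodes")
      case False
      then have "int J + 1 \<le> \<bar>j\<bar>" by (auto simp: nodes_def)
      then have "real J \<le> \<bar>of_int j\<bar>" by linarith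
      then have "l * real J \<le> l * \<bar>of_int j\<bar>" using l by (intro mult_left_mono) auto
      also have "\<dots> = \<bar>l * of_int j\<bar>" using l by (simp add: abs_mult)
      finally have "1 \<le> \<bar>x - l * of_int j\<bar>" using x J by linarith
      then have "\<phi> \<sigma> (x - l * of_int j) \<le> \<phi> \<sigma> 1"
        by (intro normal_density_antimono) auto
      then show ?thesis
        using False l mult_left_mono[of "\<phi> \<sigma> (x - l * of_int j)" "\<phi> \<sigma> 1"
          "l * \<phi> \<sigma> (l * of_int j - y)"]
        by (simp add: mult.commute)
    qed (use l in simp)
  qed
  also have "\<dots> \<le> \<phi> \<sigma> 1 * 2"
    using upper[of y] \<delta> by (auto intro!: mult_left_mono)
  finally show ?thesis by simp
qed

lemma exists_near_node:
  assumes "\<bar>x\<bar> \<le> a" shows "\<exists>j\<in>nodes. \<bar>x - l * of_int j\<bar> \<le> l"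
proof
  let ?j = "\<lfloor>x / l\<rfloor>"
  have 1: "of_int ?j \<le> x / l" "x / l < of_int ?j + 1" by linarith+
  from 1(1) have "l * of_int ?j \<le> x"
    unfolding pos_le_divide_eq[OF l(1)] by (simp add: mult.commute)
  moreover from 1(2) have "x < l * (of_int ?j + 1)"
    unfolding pos_divide_less_eq[OF l(1)] by (simp add: mult.commute)
  ultimately show near: "\<bar>x - l * of_int ?j\<bar> \<le> l" by (simp add: algebra_simps abs_le_iff)
  have "\<bar>x / l\<bar> = \<bar>x\<bar> / l" using l by (simp add: abs_divide)
  also have "\<dots> < real J"
    unfolding pos_divide_less_eq[OF l(1)] using J assms by (simp add: mult.commute)
  finally have "\<bar>x / l\<bar> < real J" .
  then have "- real J < x / l" "x / l < real J" by linarith+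
  then have "- int J \<le> ?j" "?j \<le> int J" by linarith+
  then show "?j \<in> nodes" by (simp add: nodes_def)
qed

text \<open>The floor \<open>\<theta>\<close> pays for the truncation of the lattice to \<open>nodes\<close>.\<close>

definition weight :: "real \<Rightarrow> int \<Rightarrow> real" where
  "weight \<theta> j = l * normal_mixture \<sigma> P (l * of_int j) + \<theta>"

text \<open>\<open>kernel_sum_ge\<close> is averaged over \<open>P\<close>. The loss
  \<open>2 * \<phi> \<sigma> 1\<close> is repaid by a single node within distance
  \<open>l \<le> \<sigma>\<close> of \<open>x\<close>, where the floor contributes at least
  \<open>\<theta> * \<phi> \<sigma> \<sigma>\<close>; the condition on \<open>\<theta>\<close> is
  this comparison with the common normalising constant cancelled.\<close>

lemma weighted_sum_ge:
  assumes x: "\<bar>x\<bar> \<le> a" and \<theta>: "2 * exp (- 1 / (2 * \<sigma>\<^sup>2)) \<le> \<theta> * exp (- 1 / 2)"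
  shows "(1 - \<delta>) * normal_mixture (sqrt 2 * \<sigma>) P x
    \<le> (\<Sum>j\<in>nodes. weight \<theta> j * \<phi> \<sigma> (x - l * of_int j))"
proof -
  from P interpret P: prob_space P by (simp add: space_prob_algebra)
  have \<theta>0: "0 \<le> \<theta>"
  proof -
    have "0 < \<theta> * exp (- 1 / 2)" using \<theta> by (rule less_le_trans[rotated]) simp
    then show ?thesis by (simp add: zero_less_mult_iff)
  qed
  let ?S = "\<Sum>j\<in>nodes. l * normal_mixture \<sigma> P (l * of_int j) * \<phi> \<sigma> (x - l * of_int j)"
  have "?S = (\<integral>y. (\<Sum>j\<in>nodes. l * \<phi> \<sigma> (l * of_int j - y) * \<phi> \<sigma> (x - l * of_int j)) \<partial>P)"
    unfolding normal_mixture_def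
    by (subst Bochner_Integration.integral_sum) (auto intro!: normal_mixture_integrable P)
  also have "\<dots> \<ge> (\<integral>y. (1 - \<delta>) * \<phi> (sqrt 2 * \<sigma>) (x - y) - 2 * \<phi> \<sigma> 1 \<partial>P)"
    by (rule integral_mono)
       (auto intro!: normal_mixture_integrable P kernel_sum_ge x integrable_mult_right Bochner_Integration.integrable_diff)
  also have "(\<integral>y. (1 - \<delta>) * \<phi> (sqrt 2 * \<sigma>) (x - y) - 2 * \<phi> \<sigma> 1 \<partial>P)
      = (1 - \<delta>) * normal_mixture (sqrt 2 * \<sigma>) P x - 2 * \<phi> \<sigma> 1"
    by (subst Bochner_Integration.integral_diff)
       (auto intro!: normal_mixture_integrable P simp: normal_mixture_def P.prob_space)
  finally have S: "(1 - \<delta>) * normal_mixture (sqrt 2 * \<sigma>) P x - 2 * \<phi> \<sigma> 1 \<le> ?S" .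
  from exists_near_node[OF x] obtain i where i: "i \<in> nodes" "\<bar>x - l * of_int i\<bar> \<le> l" by blast
  have "2 * \<phi> \<sigma> 1 = 2 * exp (- 1 / (2 * \<sigma>\<^sup>2)) / sqrt (2 * pi * \<sigma>\<^sup>2)"
    by (simp add: normal_density_def)
  also have "\<dots> \<le> \<theta> * exp (- 1 / 2) / sqrt (2 * pi * \<sigma>\<^sup>2)"
    using \<theta> by (intro divide_right_mono) auto
  also have "\<dots> = \<theta> * \<phi> \<sigma> \<sigma>"
    using \<sigma> by (simp add: normal_density_def)
  also have "\<dots> \<le> \<theta> * \<phi> \<sigma> (x - l * of_int i)"
    using i(2) l_le_\<sigma> \<theta>0 by (intro mult_left_mono normal_density_antimono) auto
  also have "\<dots> \<le> (\<Sum>j\<in>nodes. \<theta> * \<phi> \<sigma> (x - l * of_int j))"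
    using i(1) \<theta>0 by (intro member_le_sum) auto
  finally have T: "2 * \<phi> \<sigma> 1 \<le> (\<Sum>j\<in>nodes. \<theta> * \<phi> \<sigma> (x - l * of_int j))" .
  have "(\<Sum>j\<in>nodes. weight \<theta> j * \<phi> \<sigma> (x - l * of_int j))
      = ?S + (\<Sum>j\<in>nodes. \<theta> * \<phi> \<sigma> (x - l * of_int j))"
    by (simp add: weight_def sum.distrib[symmetric] distrib_right)
  with S T show ?thesis by linarith
qed

definition cell :: "real \<Rightarrow> int \<Rightarrow> real set" where
  "cell \<rho> j = {l * of_int j <.. l * of_int j + \<rho>}"

lemma disjoint_cells:
  assumes \<rho>: "0 < \<rho>" "\<rho> \<le> l"
  shows "disjoint_family_on (cell \<rho>) S"
  unfolding disjoint_family_on_def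
proof (intro ballI impI)
  have *: "cell \<rho> i \<inter> cell \<rho> j = {}" if "i < j" for i j
  proof -
    have "l * (of_int i + 1) \<le> l * of_int j"
      using that l by (intro mult_left_mono) auto
    then have "l * of_int i + \<rho> \<le> l * of_int j"
      using \<rho> by (simp add: algebra_simps)
    then show ?thesis by (auto simp: cell_def)
  qed
  show "cell \<rho> i \<inter> cell \<rho> j = {}" if "i \<noteq> j" for i j
    using *[of i j] *[of j i] that by (cases "i < j") auto
qed

text \<open>Moving from a node to a point of its cell changes the squared distance to
  \<open>x\<close> by at most \<open>\<rho>\<close> times a bound on the window, whence the
  exponential factor. The kernel thus dominates a step function on the disjoint cells, which is
  integrated against \<open>G\<close>.\<close>

lemma normal_mixture_ge_node_sum:
  assumes G: "G \<in> space (prob_algebra borel)" and x: "\<bar>x\<bar> \<le> a"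
    and \<rho>: "0 < \<rho>" "\<rho> \<le> 1" "\<rho> \<le> l" and \<kappa>: "\<And>j. j \<in> nodes \<Longrightarrow> \<kappa> * v j \<le> measure G (cell \<rho> j)"
  shows "exp (- \<rho> * (2 * a + 2 * l * real J + 1) / (2 * \<sigma>\<^sup>2)) * (\<kappa> * (\<Sum>j\<in>nodes. v j * \<phi> \<sigma> (x - l * of_int j)))
    \<le> normal_mixture \<sigma> G x"
proof -
  from G interpret G: prob_space G by (simp add: space_prob_algebra)
  from G have [measurable_cong, simp]: "sets G = sets borel" by (simp add: space_prob_algebra)
  let ?c = "exp (- \<rho> * (2 * a + 2 * l * real J + 1) / (2 * \<sigma>\<^sup>2))"
  note disj = disjoint_cells[OF \<rho>(1,3)]
  have ptw: "(\<Sum>j\<in>nodes. ?c * \<phi> \<sigma> (x - l * of_int j) * indicator (cell \<rho> j) z) \<le> \<phi> \<sigma> (x - z)" for z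
  proof (cases "\<exists>j\<in>nodes. z \<in> cell \<rho> j")
    case True
    then obtain j where j: "j \<in> nodes" "z \<in> cell \<rho> j" by blast
    have "z \<notin> cell \<rho> i" if "i \<in> nodes" "i \<noteq> j" for i
      using disj j that by (auto simp: disjoint_family_on_def)
    then have "(\<Sum>i\<in>nodes. ?c * \<phi> \<sigma> (x - l * of_int i) * indicator (cell \<rho> i) z)
        = (\<Sum>i\<in>nodes. if i = j then ?c * \<phi> \<sigma> (x - l * of_int j) else 0)"
      using j by (intro sum.cong) (auto split: split_indicator)
    also have "\<dots> = ?c * \<phi> \<sigma> (x - l * of_int j)" using j by simp
    also have "\<dots> \<le> \<phi> \<sigma> (x - z)"
    proof -
      let ?z = "l * of_int j"
      have zb: "\<bar>?z\<bar> \<le> l * real J"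
        using j l by (auto simp: abs_mult nodes_def intro!: mult_left_mono)
      have zz: "0 \<le> z - ?z" "z - ?z \<le> \<rho>" using j(2) by (auto simp: cell_def)
      have "(x - z)\<^sup>2 - (x - ?z)\<^sup>2 = (z - ?z) * (z + ?z - 2 * x)"
        by (simp add: power2_eq_square algebra_simps)
      also have "\<dots> \<le> (z - ?z) * (2 * a + 2 * (l * real J) + 1)"
        using zb zz x \<rho> by (intro mult_left_mono) linarith+
      also have "\<dots> \<le> \<rho> * (2 * a + 2 * (l * real J) + 1)"
        using zz a l by (intro mult_right_mono) auto
      finally have "(x - z)\<^sup>2 \<le> (x - ?z)\<^sup>2 + \<rho> * (2 * a + 2 * l * real J + 1)"
        by (simp add: algebra_simps)
      then have "- ((x - ?z)\<^sup>2 + \<rho> * (2 * a + 2 * l * real J + 1)) / (2 * \<sigma>\<^sup>2) \<le> - (x - z)\<^sup>2 / (2 * \<sigma>\<^sup>2)"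
        by (intro divide_right_mono) auto
      then have "?c * exp (- (x - ?z)\<^sup>2 / (2 * \<sigma>\<^sup>2)) \<le> exp (- (x - z)\<^sup>2 / (2 * \<sigma>\<^sup>2))"
        by (simp add: exp_add[symmetric] add_divide_distrib diff_divide_distrib)
      then show ?thesis
        unfolding normal_density_def by (simp add: divide_right_mono)
    qed
    finally show ?thesis .
  next
    case False
    then have "(\<Sum>i\<in>nodes. ?c * \<phi> \<sigma> (x - l * of_int i) * indicator (cell \<rho> i) z) = 0"
      by (intro sum.neutral) auto
    then show ?thesis by simp
  qed
  have cm: "cell \<rho> j \<in> sets borel" for j by (simp add: cell_def)
  have "?c * (\<kappa> * (\<Sum>j\<in>nodes. v j * \<phi> \<sigma> (x - l * of_int j)))
      = (\<Sum>j\<in>nodes. ?c * \<phi> \<sigma> (x - l * of_int j) * (\<kappa> * v j))"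
    unfolding sum_distrib_left by (intro sum.cong) (simp_all only: mult_ac)
  also have "\<dots> \<le> (\<Sum>j\<in>nodes. ?c * \<phi> \<sigma> (x - l * of_int j) * measure G (cell \<rho> j))"
    using \<kappa> by (intro sum_mono mult_left_mono) auto
  also have "\<dots> = (\<integral>z. (\<Sum>j\<in>nodes. ?c * \<phi> \<sigma> (x - l * of_int j) * indicator (cell \<rho> j) z) \<partial>G)"
    using cm by (subst Bochner_Integration.integral_sum) (auto intro!: integrable_mult_right simp: G.emeasure_eq_measure)
  also have "\<dots> \<le> normal_mixture \<sigma> G x"
    unfolding normal_mixture_def
  proof (rule integral_mono[OF _ normal_mixture_integrable[OF G] ptw])
    show "integrable G (\<lambda>z. \<Sum>j\<in>nodes. ?c * \<phi> \<sigma> (x - l * of_int j) * indicator (cell \<rho> j) z)"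
      by (intro Bochner_Integration.integrable_sum integrable_mult_right integrable_real_indicator)
         (simp_all add: cm G.emeasure_eq_measure)
  qed
  finally show ?thesis .
qed

end

text \<open>\<open>m\<close> bounds the total base mass and is the exponent of the Gamma bound,
  \<open>b\<close> is a lower bound for the base mass of any cell, and \<open>\<rho>\<close> is the
  length of a cell. The condition \<open>2 * \<rho> \<le> l\<close> leaves room for an interval of
  length \<open>\<rho>\<close> that misses all cells, so that their complement has base mass at
  least \<open>b\<close> too.\<close>

locale lattice_prior = lattice_approximation +
  fixes A :: "real measure" and D :: "real measure measure" and m c b \<rho> \<theta> :: real
  assumes DP: "is_dirichlet_process A D" and A: "sets A = sets borel" "finite_measure A" "measure A UNIV \<le> m"
    and gamma: "\<And>a w \<tau>. 0 < a \<Longrightarrow> a \<le> m \<Longrightarrow> 0 < w \<Longrightarrow> w \<le> 1 \<Longrightarrow> 0 < \<tau> \<Longrightarrow> \<tau> \<le> 1 \<Longrightarrow>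
        ennreal (c * \<tau> * a * w powr m) \<le> emeasure (gamma_distribution a) {w..w * (1 + \<tau>)}"
    and pos: "0 < c" "0 < b" "0 \<le> m"
    and base: "\<And>u. \<bar>u\<bar> \<le> l * real J + 1 \<Longrightarrow> b \<le> measure A {u<..u + \<rho>}"
    and \<rho>: "0 < \<rho>" "2 * \<rho> \<le> l" "\<rho> \<le> 1" and \<theta>: "0 < \<theta>" "\<theta> \<le> 1 / 2"
begin

text \<open>The partition consists of the \<open>2 * J + 1\<close> cells and their complement, which
  gets the weight \<open>\<theta>\<close>. Every weight is at least \<open>\<theta>\<close> and
  every base mass at least \<open>b\<close>, so each of the \<open>2 * J + 2\<close> Gamma factors
  has the same lower bound.\<close>

lemma dirichlet_process_lattice_ball:
  assumes \<tau>: "0 < \<tau>" "\<tau> \<le> 1"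
    and weight_le: "\<And>j. weight \<theta> j \<le> 1"
  shows "\<exists>S\<in>sets D. ennreal ((c * \<tau> * b * \<theta> powr m) ^ (2 * J + 2)) \<le> emeasure D S \<and>
    (\<forall>G\<in>S. G \<in> space (prob_algebra borel) \<and>
      (\<forall>j\<in>nodes. weight \<theta> j / ((1 + \<tau>) * ((\<Sum>i\<in>nodes. weight \<theta> i) + \<theta>)) \<le> measure G (cell \<rho> j)))"
proof -
  interpret A: finite_measure A by (rule A(2))
  let ?k = "2 * J + 2"
  let ?U = "\<Union>j\<in>nodes. cell \<rho> j"
  have Jint: "int i - int J \<in> nodes" if "i < 2 * J + 1" for i
    using that by (auto simp: nodes_def)
  define B where "B i = (if i < 2 * J + 1 then cell \<rho> (int i - int J) else UNIV - ?U)" for i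
  define w where "w i = (if i < 2 * J + 1 then weight \<theta> (int i - int J) else \<theta>)" for i
  have spA: "space A = UNIV" using sets_eq_imp_space_eq[OF A(1)] by simp
  have cm: "cell \<rho> j \<in> sets A" for j by (simp add: A cell_def)
  have Um: "UNIV - ?U \<in> sets A"
    unfolding spA[symmetric] by (intro sets.Diff sets.top sets.finite_UN cm) simp
  have Bm: "B i \<in> sets A" for i
    using cm Um by (simp add: B_def)
  have \<rho>l: "\<rho> \<le> l" using \<rho> by simp
  have disj: "disjoint_family_on B {..<?k}"
    unfolding disjoint_family_on_def
  proof (intro ballI impI)
    fix i j assume ij: "i \<in> {..<?k}" "j \<in> {..<?k}" "i \<noteq> j"
    have d: "cell \<rho> i' \<inter> cell \<rho> j' = {}" if "i' \<noteq> j'" for i' j'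
      using disjoint_cells[OF \<rho>(1) \<rho>l, of UNIV] that by (auto simp: disjoint_family_on_def)
    have "cell \<rho> (int i' - int J) \<subseteq> ?U" if "i' < 2 * J + 1" for i'
      using Jint[OF that] by blast
    note sub = this
    show "B i \<inter> B j = {}"
    proof (cases "i < 2 * J + 1")
      case i: True
      show ?thesis
      proof (cases "j < 2 * J + 1")
        case True
        then show ?thesis using i ij d[of "int i - int J" "int j - int J"] by (simp add: B_def)
      next
        case False
        then show ?thesis using i sub[OF i] by (simp add: B_def) blast
      qed
    next
      case i: False
      then have "j < 2 * J + 1" using ij by auto
      then show ?thesis using i sub[of j] by (simp add: B_def) blast
    qed
  qed
  have un: "(\<Union>i<?k. B i) = space A"
  proof -
    have "z \<in> (\<Union>i<?k. B i)" for z
    proof (cases "z \<in> ?U")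
      case True
      then obtain j where j: "j \<in> nodes" "z \<in> cell \<rho> j" by blast
      then have "nat (j + int J) < 2 * J + 1" "int (nat (j + int J)) - int J = j" by (auto simp: nodes_def)
      with j have "z \<in> B (nat (j + int J))" by (simp add: B_def)
      then show ?thesis using \<open>nat (j + int J) < 2 * J + 1\<close> by (intro UN_I[of "nat (j + int J)"]) auto
    next
      case False
      then show ?thesis by (intro UN_I[of "2 * J + 1"]) (auto simp: B_def)
    qed
    then show ?thesis unfolding spA by blast
  qed
  have weight_ge: "\<theta> \<le> weight \<theta> j" for j
    using l normal_mixture_nonneg[of \<sigma> P "l * of_int j"] by (simp add: weight_def)
  have w: "\<theta> \<le> w i" "w i \<le> 1" "0 < w i" for i
    using weight_ge weight_le \<theta> by (auto simp: w_def intro: less_le_trans)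
  have Bb: "b \<le> measure A (B i)" if "i < ?k" for i
  proof (cases "i < 2 * J + 1")
    case True
    have "\<bar>l * of_int (int i - int J)\<bar> \<le> l * real J"
      using True l by (auto simp: abs_mult intro!: mult_left_mono)
    then show ?thesis
      using True base[of "l * of_int (int i - int J)"] by (simp add: B_def cell_def)
  next
    case False
    \<comment> \<open>The cell of node 0 ends at \<open>\<rho>\<close>, and the next one starts at
      \<open>l \<ge> 2 * \<rho>\<close>.\<close>
    have "{\<rho><..\<rho> + \<rho>} \<inter> cell \<rho> j = {}" for j
    proof (cases "j \<le> 0")
      case True
      then have "l * of_int j \<le> 0" using l by (simp add: mult_nonneg_nonpos)
      then show ?thesis by (auto simp: cell_def)
    next
      case False
      then have "l * 1 \<le> l * of_int j" using l by (intro mult_left_mono) auto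
      then obtain u where u: "u = l * of_int j" "l \<le> u" by simp
      show ?thesis using \<rho> u(2) by (auto simp: cell_def u(1)[symmetric])
    qed
    then have "{\<rho><..\<rho> + \<rho>} \<subseteq> B i" using False by (auto simp: B_def)
    then have "measure A {\<rho><..\<rho> + \<rho>} \<le> measure A (B i)"
      by (rule A.finite_measure_mono[OF _ Bm])
    moreover have "b \<le> measure A {\<rho><..\<rho> + \<rho>}"
      using \<rho> J a by (intro base) linarith
    ultimately show ?thesis by simp
  qed
  let ?S = "{G\<in>space D. \<forall>i<?k. w i / ((1 + \<tau>) * (\<Sum>j<?k. w j)) \<le> measure G (B i)}"
  define K where "K = c * \<tau> * b * \<theta> powr m"
  have "0 < K" using pos \<tau> \<theta> by (simp add: K_def)
  have "ennreal (K ^ ?k) = (\<Prod>i<?k. ennreal (K))"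
    using \<open>0 < K\<close> by (simp only: prod_constant card_lessThan ennreal_power[OF less_imp_le])
  also have "\<dots> \<le> (\<Prod>i<?k. emeasure (gamma_distribution (measure A (B i))) {w i..w i * (1 + \<tau>)})"
  proof (rule prod_mono_ennreal)
    fix i assume i: "i \<in> {..<?k}"
    have "K \<le> c * \<tau> * measure A (B i) * w i powr m"
      unfolding K_def
      using pos \<tau> Bb[of i] i w[of i] \<theta> by (intro mult_mono powr_mono2) auto
    then have "ennreal (K) \<le> ennreal (c * \<tau> * measure A (B i) * w i powr m)"
      by (rule ennreal_leI)
    also have "\<dots> \<le> emeasure (gamma_distribution (measure A (B i))) {w i..w i * (1 + \<tau>)}"
    proof (rule gamma)
      show "0 < measure A (B i)" using Bb[of i] i pos by simp
      show "measure A (B i) \<le> m"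
        using A.bounded_measure[of "B i"] A(3) unfolding spA by linarith
    qed (use w \<tau> in auto)
    finally show "ennreal K
      \<le> emeasure (gamma_distribution (measure A (B i))) {w i..w i * (1 + \<tau>)}" .
  qed
  also have "\<dots> \<le> emeasure D ?S"
  proof (rule dirichlet_process_small_ball[OF DP, where k = ?k and B = B and w = w and \<tau> = \<tau>])
    show "B i \<in> sets A" for i by (rule Bm)
    show "0 < w i" for i by (rule w(3))
    show "0 < ?k" by simp
  qed (fact disj un \<tau>(1))+
  finally have mass: "ennreal (K ^ ?k) \<le> emeasure D ?S" .
  \<comment> \<open>Measurability is read off from the mass bound: a non-measurable set would have
    \<open>emeasure\<close> 0.\<close>
  have S: "?S \<in> sets D"
  proof (rule ccontr)
    assume "?S \<notin> sets D"
    then have "emeasure D ?S = 0" by (rule emeasure_notin_sets)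
    with mass have "K ^ ?k \<le> 0"
      by (simp only: ennreal_le_iff2 ennreal_eq_0_iff le_zero_eq)
    moreover have "0 < K ^ ?k" using \<open>0 < K\<close> by (rule zero_less_power)
    ultimately show False by linarith
  qed
  have sumw: "(\<Sum>j<?k. w j) = (\<Sum>i\<in>nodes. weight \<theta> i) + \<theta>"
  proof -
    have "(\<Sum>j<?k. w j) = (\<Sum>j<2 * J + 1. weight \<theta> (int j - int J)) + \<theta>"
    proof -
      have k: "?k = Suc (2 * J + 1)" by simp
      have "(\<Sum>j<?k. w j) = (\<Sum>j<2 * J + 1. w j) + w (2 * J + 1)"
        unfolding k by (rule sum.lessThan_Suc)
      moreover have "(\<Sum>j<2 * J + 1. w j) = (\<Sum>j<2 * J + 1. weight \<theta> (int j - int J))"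
        by (rule sum.cong) (auto simp: w_def)
      moreover have "w (2 * J + 1) = \<theta>" by (simp add: w_def)
      ultimately show ?thesis by linarith
    qed
    also have "(\<Sum>j<2 * J + 1. weight \<theta> (int j - int J)) = (\<Sum>i\<in>nodes. weight \<theta> i)"
      by (rule sum.reindex_bij_witness[where i = "\<lambda>j. nat (j + int J)" and j = "\<lambda>i. int i - int J"])
         (auto simp: nodes_def)
    finally show ?thesis .
  qed
  have "G \<in> space (prob_algebra borel) \<and>
      (\<forall>j\<in>nodes. weight \<theta> j / ((1 + \<tau>) * ((\<Sum>i\<in>nodes. weight \<theta> i) + \<theta>)) \<le> measure G (cell \<rho> j))"
    if "G \<in> ?S" for G
  proof
    have "G \<in> space (prob_algebra A)"
      using that space_dirichlet_process[OF DP] by simp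
    then show "G \<in> space (prob_algebra borel)"
      using A(1) by (simp add: space_prob_algebra)
    show "\<forall>j\<in>nodes. weight \<theta> j / ((1 + \<tau>) * ((\<Sum>i\<in>nodes. weight \<theta> i) + \<theta>)) \<le> measure G (cell \<rho> j)"
    proof
      fix j assume "j \<in> nodes"
      then have j: "nat (j + int J) < 2 * J + 1" "int (nat (j + int J)) - int J = j" by (auto simp: nodes_def)
      have "w (nat (j + int J)) / ((1 + \<tau>) * (\<Sum>j<?k. w j)) \<le> measure G (B (nat (j + int J)))"
        using that j(1) by auto
      then show "weight \<theta> j / ((1 + \<tau>) * ((\<Sum>i\<in>nodes. weight \<theta> i) + \<theta>)) \<le> measure G (cell \<rho> j)"
        unfolding sumw using j by (simp add: w_def B_def)
    qed
  qed
  with mass S show ?thesis unfolding K_def by blast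
qed

text \<open>The six units of \<open>\<eta>\<close> are 2 for the factor \<open>1 - \<delta>\<close>
  of the lattice approximation, 3 for the normalisation (\<open>1 + \<eta>\<close> from the Gamma
  intervals and a total weight of at most \<open>1 + 2 * \<eta>\<close>) and 1 for replacing cells
  by nodes.\<close>

lemma mixture_ball:
  assumes \<eta>: "0 < \<eta>" "\<eta> \<le> 1 / 2"
    and \<theta>_exp: "2 * exp (- 1 / (2 * \<sigma>\<^sup>2)) \<le> \<theta> * exp (- 1 / 2)"
    and \<delta>\<eta>: "\<delta> \<le> \<eta>" and \<theta>\<eta>: "real (2 * J + 2) * \<theta> \<le> \<eta>"
    and \<rho>\<eta>: "\<rho> * (2 * a + 2 * l * real J + 1) / (2 * \<sigma>\<^sup>2) \<le> \<eta>"
  shows "\<exists>S\<in>sets D. ennreal ((c * \<eta> * b * \<theta> powr m) ^ (2 * J + 2)) \<le> emeasure D S \<and>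
    (\<forall>G\<in>S. \<forall>x. \<bar>x\<bar> \<le> a \<longrightarrow> exp (- 6 * \<eta>) * normal_mixture (sqrt 2 * \<sigma>) P x \<le> normal_mixture \<sigma> G x)"
proof -
  from P interpret P: prob_space P by (simp add: space_prob_algebra)
  \<comment> \<open>The Gamma bound is available for weights up to 1 only. The sampled density
    contributes at most 1/2 because \<open>l \<le> \<sigma> / sqrt 2\<close>, the floor at most
    another 1/2.\<close>
  have weight_le: "weight \<theta> j \<le> 1" for j
  proof -
    have "\<phi> \<sigma> y \<le> 1 / (sqrt (2 * pi) * \<sigma>)" for y
      using \<sigma> by (simp add: normal_density_def real_sqrt_mult divide_right_mono)
    then have "normal_mixture \<sigma> P (l * of_int j) \<le> (\<integral>z. 1 / (sqrt (2 * pi) * \<sigma>) \<partial>P)"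
      unfolding normal_mixture_def by (intro integral_mono normal_mixture_integrable P) auto
    then have "l * normal_mixture \<sigma> P (l * of_int j) \<le> l * (1 / (sqrt (2 * pi) * \<sigma>))"
      using l by (intro mult_left_mono) (auto simp: P.prob_space)
    also have "\<dots> \<le> \<sigma> / sqrt 2 * (1 / (sqrt (2 * pi) * \<sigma>))"
      using l \<sigma> by (intro mult_right_mono) auto
    also have "\<dots> = 1 / (sqrt 2 * sqrt (2 * pi))" using \<sigma> by simp
    also have "\<dots> \<le> 1 / 2"
    proof -
      have "2 \<le> sqrt (2 * (2 * pi))" using pi_ge_two by (intro real_le_rsqrt) (simp add: power2_eq_square)
      then show ?thesis unfolding real_sqrt_mult[symmetric] by (intro divide_left_mono) auto
    qed
    finally show ?thesis using \<theta> by (simp add: weight_def)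
  qed
  from \<eta> have \<eta>1: "\<eta> \<le> 1" by simp
  from dirichlet_process_lattice_ball[OF \<eta>(1) \<eta>1 weight_le]
  obtain S where S: "S \<in> sets D" "ennreal ((c * \<eta> * b * \<theta> powr m) ^ (2 * J + 2)) \<le> emeasure D S"
    and G: "\<And>G. G \<in> S \<Longrightarrow> G \<in> space (prob_algebra borel)"
    and cells: "\<And>G j. G \<in> S \<Longrightarrow> j \<in> nodes \<Longrightarrow>
      weight \<theta> j / ((1 + \<eta>) * ((\<Sum>i\<in>nodes. weight \<theta> i) + \<theta>)) \<le> measure G (cell \<rho> j)"
    by blast
  let ?W = "(\<Sum>i\<in>nodes. weight \<theta> i) + \<theta>"
  define \<kappa> where "\<kappa> = 1 / ((1 + \<eta>) * ?W)"
  have "?W = (\<Sum>j\<in>nodes. l * normal_mixture \<sigma> P (l * of_int j)) + real (2 * J + 2) * \<theta>"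
    by (simp add: weight_def sum.distrib nodes_def algebra_simps)
  then have W: "?W \<le> 1 + 2 * \<eta>"
    using node_sum_le \<delta>\<eta> \<theta>\<eta> by linarith
  have "0 < ?W"
    using l \<theta> by (intro add_nonneg_pos sum_nonneg) (auto simp: weight_def intro!: add_nonneg_nonneg mult_nonneg_nonneg normal_mixture_nonneg)
  have exp_neg: "exp (- 2 * \<eta>) = 1 / exp (2 * \<eta>)" "exp (- 3 * \<eta>) = 1 / exp (3 * \<eta>)"
    by (simp_all add: exp_minus divide_inverse)
  have "?W \<le> exp (2 * \<eta>)"
    using W exp_ge_add_one_self[of "2 * \<eta>"] by linarith
  then have "(1 + \<eta>) * ?W \<le> exp \<eta> * exp (2 * \<eta>)"
    using \<open>0 < ?W\<close> exp_ge_add_one_self[of \<eta>] by (intro mult_mono) auto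
  also have "\<dots> = exp (3 * \<eta>)" by (simp add: exp_add[symmetric])
  finally have "(1 + \<eta>) * ?W \<le> exp (3 * \<eta>)" .
  then have "exp (- 3 * \<eta>) \<le> \<kappa>"
    unfolding \<kappa>_def exp_neg by (rule divide_left_mono) (use \<open>0 < ?W\<close> \<eta> in \<open>auto intro!: mult_pos_pos\<close>)
  have "exp (- 2 * \<eta>) \<le> 1 - \<delta>"
  proof -
    have "1 / (1 + 2 * \<eta>) \<le> 1 - \<eta>"
      using \<eta> mult_nonneg_nonneg[of \<eta> "1 - 2 * \<eta>"] by (simp add: divide_simps) (simp add: algebra_simps)
    moreover have "exp (- 2 * \<eta>) \<le> 1 / (1 + 2 * \<eta>)"
      unfolding exp_neg by (rule divide_left_mono) (use exp_ge_add_one_self[of "2 * \<eta>"] \<eta> in auto)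
    ultimately show ?thesis using \<delta>\<eta> by linarith
  qed
  have "exp (- 6 * \<eta>) * normal_mixture (sqrt 2 * \<sigma>) P x \<le> normal_mixture \<sigma> G x"
    if "G \<in> S" "\<bar>x\<bar> \<le> a" for G x
  proof -
    let ?Q = "normal_mixture (sqrt 2 * \<sigma>) P x"
    let ?V = "\<Sum>j\<in>nodes. weight \<theta> j * \<phi> \<sigma> (x - l * of_int j)"
    let ?c = "exp (- \<rho> * (2 * a + 2 * l * real J + 1) / (2 * \<sigma>\<^sup>2))"
    have Q: "0 \<le> ?Q" by (rule normal_mixture_nonneg)
    have 1: "exp (- 2 * \<eta>) * ?Q \<le> ?V"
      by (rule order_trans[OF mult_right_mono[OF \<open>exp (- 2 * \<eta>) \<le> 1 - \<delta>\<close> Q]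
            weighted_sum_ge[OF that(2) \<theta>_exp]])
    have "exp (- \<eta>) * (exp (- 3 * \<eta>) * (exp (- 2 * \<eta>) * ?Q)) \<le> ?c * (\<kappa> * ?V)"
    proof (intro mult_mono 1)
      show "exp (- \<eta>) \<le> ?c" using \<rho>\<eta> by simp
      show "exp (- 3 * \<eta>) \<le> \<kappa>" by fact
      show "0 \<le> \<kappa>" using \<open>exp (- 3 * \<eta>) \<le> \<kappa>\<close> exp_gt_zero[of "- 3 * \<eta>"] by linarith
    qed (use Q in auto)
    also have "\<dots> \<le> normal_mixture \<sigma> G x"
    proof (rule normal_mixture_ge_node_sum[OF G[OF that(1)] that(2) \<rho>(1,3)])
      show "\<rho> \<le> l" using \<rho> by simp
      show "\<kappa> * weight \<theta> j \<le> measure G (cell \<rho> j)" if "j \<in> nodes" for j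
        using cells[OF \<open>G \<in> S\<close> that] by (simp add: \<kappa>_def)
    qed
    also have "exp (- \<eta>) * (exp (- 3 * \<eta>) * (exp (- 2 * \<eta>) * ?Q)) = exp (- 6 * \<eta>) * ?Q"
      by (simp add: exp_add[symmetric] mult.assoc[symmetric])
    finally show ?thesis .
  qed
  with S show ?thesis by blast
qed

end

text \<open>The numerical hypotheses of \<open>lattice_prior\<close> and \<open>mixture_ball\<close>
  for mesh x^{-21/100}, bandwidth x^{-1/5}, window x^{1/100}, precision x^{-3/4}, and cell length
  and floor both x^{-3}. They are stated for a real variable and specialised to sample sizes
  afterwards.\<close>

lemma asymp_conditions:
  fixes B1 B2 :: real
  shows "\<forall>\<^sub>F x in at_top. x powr (-21/100) \<le> x powr (-1/5) / sqrt 2"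
    and "\<forall>\<^sub>F x in at_top. x powr (-3/4) \<le> (1/2::real)"
    and "\<forall>\<^sub>F x in at_top. B1 * (x powr (-21/100) / (x powr (-1/5) / sqrt 2)) ^ 80 \<le> x powr (-3/4)"
    and "\<forall>\<^sub>F x in at_top. B2 * (x powr (-21/100) / x powr (-1/5)) ^ 80 \<le> x powr (-3/4)"
    and "\<forall>\<^sub>F x in at_top. 2 * x powr (-3) \<le> (x::real) powr (-21/100)"
    and "\<forall>\<^sub>F x in at_top. x powr (-3) \<le> (1/2::real)"
    and "\<forall>\<^sub>F x in at_top. 2 * exp (- 1 / (2 * (x powr (-1/5))\<^sup>2)) \<le> x powr (-3) * exp (- 1 / 2 :: real)"
    and "\<forall>\<^sub>F x in at_top. (2 * ((x powr (1/100) + 1) / x powr (-21/100) + 1) + 2) * x powr (-3) \<le> (x::real) powr (-3/4)"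
    and "\<forall>\<^sub>F x in at_top. x powr (-3) * (2 * x powr (1/100) + 2 * (x powr (1/100) + 2) + 1) / (2 * (x powr (-1/5))\<^sup>2) \<le> (x::real) powr (-3/4)"
    and "\<forall>\<^sub>F x in at_top. x powr (-21/100) \<le> (1::real)"
  by real_asymp+

text \<open>The number of partition sets, of order x^{22/100}, times the negative logarithm of the
  mass per set, of order x^{2/100}.\<close>

lemma asymp_mass:
  fixes C1 C2 C3 C4 :: real
  assumes "0 < C3"
  shows "\<forall>\<^sub>F x in at_top. (2 * ((x powr (1/100) + 1) / x powr (-21/100) + 1) + 2) *
      (C1 + C2 * ln x + C3 * (x powr (1/100) + C4)\<^sup>2) \<le> (x::real) powr (1/4)"
    and "\<forall>\<^sub>F x in at_top. 0 \<le> C1 + C2 * ln x + C3 * (x powr (1/100) + C4)\<^sup>2"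
  using assms by real_asymp+

section \<open>Prior mass of mixtures close to the smoothed true density\<close>

context
  fixes base :: "real measure" and \<alpha> \<mu> s :: real
  assumes A: "base = scale_measure (ennreal \<alpha>) (density lborel (normal_density \<mu> s))"
    and s: "0 < s" and \<alpha>: "0 < \<alpha>"
begin

lemma sets_base: "sets base = sets borel"
  by (simp add: A)

lemma emeasure_base: "B \<in> sets borel \<Longrightarrow> emeasure base B = ennreal \<alpha> * emeasure (density lborel (normal_density \<mu> s)) B"
  by (simp add: A)

lemma finite_measure_base: "finite_measure base"
proof
  interpret H: prob_space "density lborel (normal_density \<mu> s)" by (rule prob_space_normal_density[OF s])
  have "space base = UNIV" using sets_eq_imp_space_eq[OF sets_base] by simp
  then show "emeasure base (space base) \<noteq> \<infinity>"
    using emeasure_base[of UNIV] H.emeasure_space_1 by simp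
qed

lemma measure_base: 
  assumes "B \<in> sets borel"
  shows "measure base B = \<alpha> * measure (density lborel (normal_density \<mu> s)) B"
  using emeasure_base[OF assms] \<alpha> by (simp add: measure_def enn2real_mult)

lemma measure_base_UNIV: "measure base UNIV = \<alpha>"
  using measure_base[of UNIV] prob_space.prob_space[OF prob_space_normal_density[OF s, of \<mu>]] by simp

lemma measure_base_interval:
  assumes "\<bar>u\<bar> \<le> R" "0 < \<rho>" "\<rho> \<le> 1"
  shows "\<alpha> * (exp (- (R + 1 + \<bar>\<mu>\<bar>)\<^sup>2 / (2 * s\<^sup>2)) / (sqrt (2 * pi) * s) * \<rho>) \<le> measure base {u<..u + \<rho>}"
proof -
  interpret H: prob_space "density lborel (normal_density \<mu> s)" by (rule prob_space_normal_density[OF s])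
  let ?m = "exp (- (R + 1 + \<bar>\<mu>\<bar>)\<^sup>2 / (2 * s\<^sup>2)) / (sqrt (2 * pi) * s)"
  have dens: "?m \<le> normal_density \<mu> s x" if "u < x" "x \<le> u + \<rho>" for x
  proof -
    have "\<bar>x - \<mu>\<bar> \<le> \<bar>R + 1 + \<bar>\<mu>\<bar>\<bar>" using that assms by linarith
    then have "(x - \<mu>)\<^sup>2 \<le> (R + 1 + \<bar>\<mu>\<bar>)\<^sup>2" by (simp only: abs_le_square_iff)
    then have "- (R + 1 + \<bar>\<mu>\<bar>)\<^sup>2 / (2 * s\<^sup>2) \<le> - (x - \<mu>)\<^sup>2 / (2 * s\<^sup>2)"
      by (intro divide_right_mono) auto
    then have "?m \<le> exp (- (x - \<mu>)\<^sup>2 / (2 * s\<^sup>2)) / (sqrt (2 * pi) * s)"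
      using s by (intro divide_right_mono) auto
    also have "\<dots> = normal_density \<mu> s x"
      using s by (simp add: normal_density_def real_sqrt_mult)
    finally show ?thesis .
  qed
  have "ennreal (?m * \<rho>) = (\<integral>\<^sup>+x. ennreal ?m * indicator {u<..u + \<rho>} x \<partial>lborel)"
    using assms s by (subst nn_integral_cmult_indicator) (auto simp: ennreal_mult'[symmetric])
  also have "\<dots> \<le> (\<integral>\<^sup>+x. ennreal (normal_density \<mu> s x) * indicator {u<..u + \<rho>} x \<partial>lborel)"
    using dens by (intro nn_integral_mono) (auto split: split_indicator intro!: ennreal_leI)
  also have "\<dots> = ennreal (measure (density lborel (normal_density \<mu> s)) {u<..u + \<rho>})"
    by (simp add: H.emeasure_eq_measure[symmetric] emeasure_density)
  finally have "?m * \<rho> \<le> measure (density lborel (normal_density \<mu> s)) {u<..u + \<rho>}"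
    by (simp add: ennreal_le_iff)
  then have "\<alpha> * (?m * \<rho>) \<le> \<alpha> * measure (density lborel (normal_density \<mu> s)) {u<..u + \<rho>}"
    using \<alpha> by (intro mult_left_mono) auto
  then show ?thesis
    unfolding measure_base[OF greaterThanAtMost_borel] .
qed

text \<open>The mass from \<open>mixture_ball\<close> is a power of a common factor, rewritten as
  \<open>exp (- E)\<close>; the number of factors times \<open>E\<close> is then below n^{1/4} by
  \<open>asymp_mass\<close>.\<close>

lemma mixture_ball_mass:
  assumes DP: "is_dirichlet_process base D" and P: "P \<in> space (prob_algebra borel)"
  shows "\<forall>\<^sub>F n in sequentially. \<exists>S\<in>sets D. ennreal (exp (- (real n powr (1/4)))) \<le> emeasure D S \<and>
    (\<forall>G\<in>S. \<forall>x. \<bar>x\<bar> \<le> real n powr (1/100) \<longrightarrow>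
      exp (- 6 * real n powr (-3/4)) * normal_mixture (sqrt 2 * real n powr (-1/5)) P x
        \<le> normal_mixture (real n powr (-1/5)) G x)"
proof -
  obtain B where B: "\<And>h s m. 0 < h \<Longrightarrow> h \<le> s \<Longrightarrow>
     \<bar>(\<integral>j. h * \<phi> s (h * of_int j - m) \<partial>count_space UNIV) - 1\<bar> \<le> B * (h / s) ^ 80"
    using lattice_normal_density[of 80] by blast
  obtain c where c: "0 < c" and gamma: "\<And>a w \<tau>. 0 < a \<Longrightarrow> a \<le> \<alpha> \<Longrightarrow> 0 < w \<Longrightarrow> w \<le> 1 \<Longrightarrow> 0 < \<tau> \<Longrightarrow> \<tau> \<le> 1 \<Longrightarrow>
        ennreal (c * \<tau> * a * w powr \<alpha>) \<le> emeasure (gamma_distribution a) {w..w * (1 + \<tau>)}"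
    using gamma_distribution_interval_bound[OF \<alpha>] by blast
  \<comment> \<open>The coefficients of the negative logarithm of the mass per set.
    \<open>C2\<close> collects the powers of \<open>x\<close>: 3/4 from the precision, 3 from the
    cell length inside \<open>b\<close>, and \<open>3 * \<alpha>\<close> from the floor to the power
    \<open>\<alpha>\<close>. \<open>C3\<close> and \<open>C4\<close> come from the normal base
    density at the edge of the window.\<close>
  define C1 where "C1 = - ln (c * \<alpha> / (sqrt (2 * pi) * s))"
  define C2 where "C2 = 15/4 + 3 * \<alpha>"
  define C3 where "C3 = 1 / (2 * s\<^sup>2)"
  define C4 where "C4 = 4 + \<bar>\<mu>\<bar>"
  have C3: "0 < C3" using s by (simp add: C3_def)
  note conds = asymp_conditions(1,2) asymp_conditions(3)[of B] asymp_conditions(4)[of B] asymp_conditions(5-10) asymp_mass[OF C3, of C1 C2 C4] eventually_ge_at_top[of 1]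
  have "\<forall>\<^sub>F x in at_top. \<exists>S\<in>sets D. ennreal (exp (- (x powr (1/4)))) \<le> emeasure D S \<and>
    (\<forall>G\<in>S. \<forall>y. \<bar>y\<bar> \<le> x powr (1/100) \<longrightarrow>
      exp (- 6 * x powr (-3/4)) * normal_mixture (sqrt 2 * x powr (-1/5)) P y
        \<le> normal_mixture (x powr (-1/5)) G y)"
    using conds
  proof eventually_elim
    case (elim x)
    have x: "1 \<le> x" by fact
    define l \<sigma> a \<rho> \<eta> where "l = x powr (-21/100)" "\<sigma> = x powr (-1/5)" "a = x powr (1/100)" "\<rho> = x powr (-3)" "\<eta> = x powr (-3/4)"
    note defs = this
    note e = elim[folded defs]
    have pos: "0 < l" "0 < \<sigma>" "0 < a" "0 < \<rho>" "0 < \<eta>" using x by (auto simp: defs)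
    define J where "J = nat \<lceil>(a + 1) / l\<rceil>"
    have "0 \<le> (a + 1) / l" using pos by simp
    then have J: "(a + 1) / l \<le> real J" "real J \<le> (a + 1) / l + 1" unfolding J_def by linarith+
    have "real (2 * J + 2) = 2 * real J + 2" by simp
    also have "\<dots> \<le> 2 * ((a + 1) / l + 1) + 2" using J(2) by (intro add_right_mono mult_left_mono) auto
    finally have Jk: "real (2 * J + 2) \<le> 2 * ((a + 1) / l + 1) + 2" .
    have Jl: "a + 1 \<le> l * real J" using J(1) pos by (simp add: pos_divide_le_eq mult.commute)
    have "l * real J \<le> l * ((a + 1) / l + 1)" using J(2) pos by (intro mult_left_mono) auto
    also have "\<dots> = a + 1 + l" using pos by (simp add: field_simps)
    finally have Ju: "l * real J \<le> a + 2" using e(10) by linarith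
    have l\<sigma>: "l \<le> \<sigma>"
    proof -
      have "\<sigma> / sqrt 2 \<le> \<sigma> / 1" using pos by (intro divide_left_mono) auto
      with e(1) show ?thesis by simp
    qed
    \<comment> \<open>Base masses are required up to \<open>l * J + 1 \<le> a + 3\<close>; one more
      unit in the exponent covers the extent of a cell.\<close>
    define b where "b = \<alpha> * (exp (- (a + 3 + 1 + \<bar>\<mu>\<bar>)\<^sup>2 / (2 * s\<^sup>2)) / (sqrt (2 * pi) * s) * \<rho>)"
    have b: "0 < b" using \<alpha> s pos by (simp add: b_def)
    interpret base: finite_measure base by (rule finite_measure_base)
    \<comment> \<open>The last two arguments coincide: cell length and weight floor are the same
      power of \<open>x\<close>. The precision also serves as the lattice error.\<close>
    interpret L: lattice_prior \<sigma> l \<eta> a J P base D \<alpha> c b \<rho> \<rho>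
    proof
      show "1 - \<eta> \<le> (\<integral>j. l * \<phi> (\<sigma> / sqrt 2) (l * of_int j - m) \<partial>count_space UNIV)" for m
        using B[OF pos(1) e(1), of m] e(3) by linarith
      show "(\<integral>j. l * \<phi> \<sigma> (l * of_int j - m) \<partial>count_space UNIV) \<le> 1 + \<eta>" for m
        using B[OF pos(1) l\<sigma>, of m] e(4) by linarith
      show "b \<le> measure base {u<..u + \<rho>}" if "\<bar>u\<bar> \<le> l * real J + 1" for u
        unfolding b_def by (rule measure_base_interval) (use that Ju pos e(6) in auto)
      show "ennreal (c * \<tau> * a * w powr \<alpha>) \<le> emeasure (gamma_distribution a) {w..w * (1 + \<tau>)}"
        if "0 < a" "a \<le> \<alpha>" "0 < w" "w \<le> 1" "0 < \<tau>" "\<tau> \<le> 1" for a w \<tau>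
        using that by (rule gamma)
      show "measure base UNIV \<le> \<alpha>" using measure_base_UNIV by simp
      show "0 < \<sigma>" "0 < l" "0 < \<rho>" by (rule pos)+
      show "0 \<le> a" using pos(3) by simp
      show "0 \<le> \<eta>" "\<eta> \<le> 1" "0 \<le> \<alpha>" using pos(5) e(2) \<alpha> by simp_all
      show "\<rho> \<le> 1" using e(6) by simp
    qed (rule e(1,5,6) Jl P DP sets_base c b pos(4))+
    have "\<exists>S\<in>sets D. ennreal ((c * \<eta> * b * \<rho> powr \<alpha>) ^ (2 * J + 2)) \<le> emeasure D S \<and>
      (\<forall>G\<in>S. \<forall>y. \<bar>y\<bar> \<le> a \<longrightarrow> exp (- 6 * \<eta>) * normal_mixture (sqrt 2 * \<sigma>) P y \<le> normal_mixture \<sigma> G y)"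
    proof (rule L.mixture_ball)
      have "real (2 * J + 2) * \<rho> \<le> (2 * ((a + 1) / l + 1) + 2) * \<rho>"
        using pos by (intro mult_right_mono Jk) auto
      then show "real (2 * J + 2) * \<rho> \<le> \<eta>" using e(8) by linarith
      have "\<rho> * (2 * a + 2 * l * real J + 1) / (2 * \<sigma>\<^sup>2) \<le> \<rho> * (2 * a + 2 * (a + 2) + 1) / (2 * \<sigma>\<^sup>2)"
        using Ju pos by (intro divide_right_mono mult_left_mono) auto
      then show "\<rho> * (2 * a + 2 * l * real J + 1) / (2 * \<sigma>\<^sup>2) \<le> \<eta>" using e(9) by linarith
    qed (use pos e in auto)
    then obtain S where S: "S \<in> sets D" "ennreal ((c * \<eta> * b * \<rho> powr \<alpha>) ^ (2 * J + 2)) \<le> emeasure D S"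
      and SG: "\<forall>G\<in>S. \<forall>y. \<bar>y\<bar> \<le> a \<longrightarrow> exp (- 6 * \<eta>) * normal_mixture (sqrt 2 * \<sigma>) P y \<le> normal_mixture \<sigma> G y"
      by blast
    define E where "E = C1 + C2 * ln x + C3 * (a + C4)\<^sup>2"
    have E: "c * \<eta> * b * \<rho> powr \<alpha> = exp (- E)"
    proof -
      have "exp (- E) = exp (ln (c * \<alpha> / (sqrt (2 * pi) * s))) * exp (- (3/4) * ln x) * exp (- 3 * ln x) * exp (- 3 * \<alpha> * ln x) * exp (- (a + 4 + \<bar>\<mu>\<bar>)\<^sup>2 / (2 * s\<^sup>2))"
        unfolding E_def C1_def C2_def C3_def C4_def exp_add[symmetric]
        by (simp add: algebra_simps)
      also have "exp (ln (c * \<alpha> / (sqrt (2 * pi) * s))) = c * \<alpha> / (sqrt (2 * pi) * s)"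
        using c \<alpha> s by simp
      also have "exp (- (3/4) * ln x) = \<eta>" using x by (simp add: defs powr_def)
      also have "exp (- 3 * ln x) = \<rho>" using x by (simp add: defs powr_def)
      also have "exp (- 3 * \<alpha> * ln x) = \<rho> powr \<alpha>" using x by (simp add: defs powr_def mult.commute mult.left_commute)
      finally show ?thesis by (simp add: b_def algebra_simps)
    qed
    have "(2 * ((a + 1) / l + 1) + 2) * E \<le> x powr (1/4)" and "0 \<le> E"
      using e(11,12) by (simp_all add: E_def)
    moreover have "real (2 * J + 2) * E \<le> (2 * ((a + 1) / l + 1) + 2) * E"
      using \<open>0 \<le> E\<close> by (intro mult_right_mono Jk)
    ultimately have "- (x powr (1/4)) \<le> real (2 * J + 2) * (- E)" by linarith
    then have "exp (- (x powr (1/4))) \<le> exp (real (2 * J + 2) * (- E))" by (simp only: exp_le_cancel_iff)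
    also have "\<dots> = (c * \<eta> * b * \<rho> powr \<alpha>) ^ (2 * J + 2)"
      unfolding E by (rule exp_of_nat_mult)
    finally have "ennreal (exp (- (x powr (1/4)))) \<le> emeasure D S"
      using S(2) by (meson ennreal_leI order_trans)
    with S(1) SG show ?case unfolding defs by blast
  qed
  then show ?thesis
    by (rule eventually_compose_filterlim[OF _ filterlim_real_sequentially])
qed

end

section \<open>Evidence\<close>

locale dpm_posterior = prob_space M for M :: "'a measure" +
  fixes X :: "nat \<Rightarrow> 'a \<Rightarrow> real" and p0 p0' p0'' :: "real \<Rightarrow> real"
    and D :: "real measure measure" and \<mu> s \<alpha> :: real
  assumes indep: "indep_vars (\<lambda>_. borel) X {1..}"
    and dist: "\<And>i. i \<ge> 1 \<Longrightarrow> distributed M lborel (X i) (\<lambda>x. ennreal (p0 x))"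
    and p0: "p0 \<in> densities"
    and p0': "\<And>x. (p0 has_real_derivative p0' x) (at x)"
    and p0'': "\<And>x. (p0' has_real_derivative p0'' x) (at x)"
    and cont: "continuous_on UNIV p0''"
    and tail: "sub_gaussian_tail (prob_of p0)"
    and W: "(\<integral>\<^sup>+x. ennreal ((p0'' x / p0 x)\<^sup>2) \<partial>prob_of p0) < \<infinity>"
    and s: "0 < s" and \<alpha>: "1 < \<alpha>"
    and DP: "is_dirichlet_process (scale_measure (ennreal \<alpha>) (density lborel (normal_density \<mu> s))) D"
begin

abbreviation base :: "real measure" where
  "base \<equiv> scale_measure (ennreal \<alpha>) (density lborel (normal_density \<mu> s))"

abbreviation bandwidth :: "nat \<Rightarrow> real" where "bandwidth n \<equiv> real n powr (-1/5)"
abbreviation precision :: "nat \<Rightarrow> real" where "precision n \<equiv> real n powr (-3/4)"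
abbreviation radius :: "nat \<Rightarrow> real" where "radius n \<equiv> real n powr (1/100)"
abbreviation rate :: "nat \<Rightarrow> real" where "rate n \<equiv> real n powr (1/4)"

abbreviation mixture :: "nat \<Rightarrow> real measure \<Rightarrow> real \<Rightarrow> real" where
  "mixture n \<equiv> normal_mixture (bandwidth n)"

lemma \<alpha>0: "0 < \<alpha>" using \<alpha> by simp

lemma bandwidth_pos: "n \<ge> 1 \<Longrightarrow> 0 < bandwidth n" by simp

lemma sets_D: "sets D = sets (prob_algebra borel)"
proof -
  have "prob_algebra base = (prob_algebra borel :: real measure measure)"
    unfolding prob_algebra_def by (simp add: subprob_algebra_cong[of base borel])
  then show ?thesis using sets_dirichlet_process[OF DP] by simp
qed

lemma space_D: "space D = space (prob_algebra borel)"
  using sets_D by (rule sets_eq_imp_space_eq)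

sublocale D: prob_space D by (rule prob_space_dirichlet_process[OF DP])

sublocale MD: pair_sigma_finite M D ..

lemma p0_borel [measurable]: "p0 \<in> borel_measurable borel" and p0_nonneg: "0 \<le> p0 x"
  using p0 by (auto simp: densities_def)

lemma X_borel: "i \<ge> 1 \<Longrightarrow> X i \<in> borel_measurable M"
  using dist[of i] by (auto simp: distributed_def)

lemma borel_measurable_prod_X:
  fixes f :: "real \<Rightarrow> ennreal"
  assumes [measurable]: "f \<in> borel_measurable borel"
  shows "(\<lambda>\<omega>. \<Prod>i=1..n. f (X i \<omega>)) \<in> borel_measurable M"
  by (rule borel_measurable_prod_ennreal) (auto intro!: measurable_compose[OF X_borel])

lemma nn_integral_X:
  assumes "i \<ge> 1" and [measurable]: "f \<in> borel_measurable borel"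
  shows "(\<integral>\<^sup>+\<omega>. f (X i \<omega>) \<partial>M) = (\<integral>\<^sup>+x. ennreal (p0 x) * f x \<partial>lborel)"
  by (rule distributed_nn_integral[OF dist[OF assms(1)], symmetric]) simp

lemma nn_integral_prod_X:
  fixes f :: "real \<Rightarrow> ennreal"
  assumes [measurable]: "f \<in> borel_measurable borel"
  shows "(\<integral>\<^sup>+\<omega>. (\<Prod>i=1..n. f (X i \<omega>)) \<partial>M) = (\<integral>\<^sup>+x. ennreal (p0 x) * f x \<partial>lborel) ^ n"
proof -
  have "indep_vars (\<lambda>_. borel) X {1..n}"
    by (rule indep_vars_subset[OF indep]) auto
  then have "indep_vars (\<lambda>_. borel) (\<lambda>i \<omega>. f (X i \<omega>)) {1..n}"
    by (rule indep_vars_compose2) simp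
  then have "(\<integral>\<^sup>+\<omega>. (\<Prod>i=1..n. f (X i \<omega>)) \<partial>M) = (\<Prod>i=1..n. \<integral>\<^sup>+\<omega>. f (X i \<omega>) \<partial>M)"
    by (intro indep_vars_nn_integral) auto
  also have "\<dots> = (\<Prod>i=1..n. \<integral>\<^sup>+x. ennreal (p0 x) * f x \<partial>lborel)"
    by (intro prod.cong refl nn_integral_X) auto
  finally show ?thesis by simp
qed

lemma mixture_borel: "G \<in> space D \<Longrightarrow> mixture n G \<in> borel_measurable borel"
  using measurable_compose[OF measurable_Pair1' normal_mixture_joint, of G] by (simp add: space_D)

lemma mixture_joint: "(\<lambda>(G, x). mixture n G x) \<in> borel_measurable (D \<Otimes>\<^sub>M borel)"
  unfolding measurable_cong_sets[OF sets_pair_measure_cong[OF sets_D refl] refl]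
  by (rule normal_mixture_joint)

definition ratio :: "nat \<Rightarrow> 'a \<Rightarrow> real measure \<Rightarrow> ennreal" where
  "ratio n \<omega> G = (\<Prod>i=1..n. ennreal (mixture n G (X i \<omega>) / p0 (X i \<omega>)))"

text \<open>The share of the denominator of the posterior that comes from mixing measures in
  \<open>U\<close>. Working with mixing measures rather than densities keeps the Dirichlet process
  itself as the prior.\<close>

definition evidence :: "nat \<Rightarrow> real measure set \<Rightarrow> 'a \<Rightarrow> ennreal" where
  "evidence n U \<omega> = (\<integral>\<^sup>+G. ratio n \<omega> G * indicator U G \<partial>D)"

lemma ratio_eq_likelihood_ratio:
  "ratio n \<omega> G = ennreal (likelihood_ratio p0 n (\<lambda>i. X i \<omega>) (mixture n G))"
  unfolding ratio_def likelihood_ratio_def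
  by (rule prod_ennreal) (auto intro!: divide_nonneg_nonneg normal_mixture_nonneg p0_nonneg)

lemma ratio_joint [measurable]: "(\<lambda>(\<omega>, G). ratio n \<omega> G) \<in> borel_measurable (M \<Otimes>\<^sub>M D)"
  unfolding ratio_def split_beta'
proof (rule borel_measurable_prod_ennreal)
  fix i assume "i \<in> {1..n}"
  then have [measurable]: "X i \<in> borel_measurable M" by (intro X_borel) simp
  have "(\<lambda>z. (\<lambda>(G, x). mixture n G x) (snd z, X i (fst z))) \<in> borel_measurable (M \<Otimes>\<^sub>M D)"
    by (rule measurable_compose[OF _ mixture_joint]) measurable
  then have [measurable]: "(\<lambda>z. mixture n (snd z) (X i (fst z))) \<in> borel_measurable (M \<Otimes>\<^sub>M D)" by simp
  show "(\<lambda>z. ennreal (mixture n (snd z) (X i (fst z)) / p0 (X i (fst z)))) \<in> borel_measurable (M \<Otimes>\<^sub>M D)"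
    by measurable
qed

lemma ratio_borel: "\<omega> \<in> space M \<Longrightarrow> ratio n \<omega> \<in> borel_measurable D"
  using measurable_compose[OF measurable_Pair1' ratio_joint, of \<omega>] by simp

lemma evidence_borel [measurable]:
  assumes [measurable]: "U \<in> sets D" shows "evidence n U \<in> borel_measurable M"
  unfolding evidence_def[abs_def] by (rule D.borel_measurable_nn_integral) measurable

text \<open>Fubini's theorem and independence: for fixed \<open>G\<close> the factor
  \<open>p0\<close> of the data law cancels the denominators. With \<open>h = 1\<close> the mean
  evidence is bounded by the prior mass; with \<open>h\<close> the exponential of minus an indicator
  the lemma yields the tail tests.\<close>

lemma nn_integral_evidence:
  fixes h :: "real \<Rightarrow> real"
  assumes U: "U \<in> sets D" and [measurable]: "h \<in> borel_measurable borel" and h: "\<And>x. 0 \<le> h x"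
  shows "(\<integral>\<^sup>+\<omega>. evidence n U \<omega> * (\<Prod>i=1..n. ennreal (h (X i \<omega>))) \<partial>M)
    \<le> (\<integral>\<^sup>+G. (\<integral>\<^sup>+x. ennreal (mixture n G x * h x) \<partial>lborel) ^ n * indicator U G \<partial>D)"
proof -
  note [measurable] = U
  have [measurable]: "(\<lambda>\<omega>. \<Prod>i=1..n. ennreal (h (X i \<omega>))) \<in> borel_measurable M"
    by (rule borel_measurable_prod_X) measurable
  have "(\<integral>\<^sup>+\<omega>. evidence n U \<omega> * (\<Prod>i=1..n. ennreal (h (X i \<omega>))) \<partial>M)
     = (\<integral>\<^sup>+\<omega>. \<integral>\<^sup>+G. ratio n \<omega> G * indicator U G * (\<Prod>i=1..n. ennreal (h (X i \<omega>))) \<partial>D \<partial>M)"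
    unfolding evidence_def using ratio_borel
    by (intro nn_integral_cong nn_integral_multc[symmetric]) auto
  also have "\<dots> = (\<integral>\<^sup>+G. \<integral>\<^sup>+\<omega>. ratio n \<omega> G * indicator U G * (\<Prod>i=1..n. ennreal (h (X i \<omega>))) \<partial>M \<partial>D)"
    by (rule MD.Fubini'[symmetric]) measurable
  also have "\<dots> \<le> (\<integral>\<^sup>+G. (\<integral>\<^sup>+x. ennreal (mixture n G x * h x) \<partial>lborel) ^ n * indicator U G \<partial>D)"
  proof (rule nn_integral_mono)
    fix G assume G: "G \<in> space D"
    note [measurable] = mixture_borel[OF G]
    have fm: "(\<lambda>x. ennreal (mixture n G x / p0 x * h x)) \<in> borel_measurable borel"
      by measurable
    have "(\<integral>\<^sup>+\<omega>. ratio n \<omega> G * indicator U G * (\<Prod>i=1..n. ennreal (h (X i \<omega>))) \<partial>M)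
      = (\<integral>\<^sup>+\<omega>. (\<Prod>i=1..n. ennreal (mixture n G (X i \<omega>) / p0 (X i \<omega>) * h (X i \<omega>))) * indicator U G \<partial>M)"
    proof (rule nn_integral_cong)
      fix \<omega>
      have "ennreal (mixture n G (X i \<omega>) / p0 (X i \<omega>) * h (X i \<omega>))
          = ennreal (mixture n G (X i \<omega>) / p0 (X i \<omega>)) * ennreal (h (X i \<omega>))" for i
        by (rule ennreal_mult''[OF h])
      then show "ratio n \<omega> G * indicator U G * (\<Prod>i=1..n. ennreal (h (X i \<omega>)))
          = (\<Prod>i=1..n. ennreal (mixture n G (X i \<omega>) / p0 (X i \<omega>) * h (X i \<omega>))) * indicator U G"
        by (simp only: ratio_def prod.distrib mult.assoc mult.commute[of "indicator U G"])
    qed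
    also have "\<dots> = (\<integral>\<^sup>+\<omega>. (\<Prod>i=1..n. (\<lambda>x. ennreal (mixture n G x / p0 x * h x)) (X i \<omega>)) \<partial>M) * indicator U G"
      by (rule nn_integral_multc[OF borel_measurable_prod_X[OF fm]])
    also have "\<dots> = (\<integral>\<^sup>+x. ennreal (p0 x) * ennreal (mixture n G x / p0 x * h x) \<partial>lborel) ^ n * indicator U G"
      by (simp only: nn_integral_prod_X[OF fm])
    also have "\<dots> \<le> (\<integral>\<^sup>+x. ennreal (mixture n G x * h x) \<partial>lborel) ^ n * indicator U G"
    \<comment> \<open>Only an inequality: where \<open>p0\<close> vanishes, the left side is 0 while
      the mixture may have mass.\<close>
    proof (intro mult_right_mono power_mono nn_integral_mono)
      fix x
      have "p0 x * (mixture n G x / p0 x * h x) \<le> mixture n G x * h x"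
        using h[of x] normal_mixture_nonneg[of _ G x] by (cases "p0 x = 0") auto
      then show "ennreal (p0 x) * ennreal (mixture n G x / p0 x * h x) \<le> ennreal (mixture n G x * h x)"
        using p0_nonneg[of x] by (simp add: ennreal_mult'[symmetric] ennreal_leI)
    qed auto
    finally show "(\<integral>\<^sup>+\<omega>. ratio n \<omega> G * indicator U G * (\<Prod>i=1..n. ennreal (h (X i \<omega>))) \<partial>M)
      \<le> (\<integral>\<^sup>+x. ennreal (mixture n G x * h x) \<partial>lborel) ^ n * indicator U G" .
  qed
  finally show ?thesis .
qed

lemma nn_integral_mixture:
  assumes "n \<ge> 1" "G \<in> space D" shows "(\<integral>\<^sup>+x. ennreal (mixture n G x) \<partial>lborel) = 1"
proof -
  have "mixture n G \<in> densities"
    by (rule normal_mixture_density[OF _ bandwidth_pos[OF assms(1)]]) (use assms(2) space_D in simp)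
  then show ?thesis unfolding densities_def by blast
qed

lemma nn_integral_evidence_le_emeasure:
  assumes "U \<in> sets D" "n \<ge> 1"
  shows "(\<integral>\<^sup>+\<omega>. evidence n U \<omega> \<partial>M) \<le> emeasure D U"
proof -
  have "(\<integral>\<^sup>+\<omega>. evidence n U \<omega> \<partial>M) = (\<integral>\<^sup>+\<omega>. evidence n U \<omega> * (\<Prod>i=1..n. ennreal ((\<lambda>_. 1) (X i \<omega>))) \<partial>M)"
    by simp
  also have "\<dots> \<le> (\<integral>\<^sup>+G. (\<integral>\<^sup>+x. ennreal (mixture n G x * (\<lambda>_. 1) x) \<partial>lborel) ^ n * indicator U G \<partial>D)"
    by (rule nn_integral_evidence) (use assms in auto)
  also have "\<dots> = (\<integral>\<^sup>+G. indicator U G \<partial>D)"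
    using nn_integral_mixture[OF assms(2)] by (intro nn_integral_cong) simp
  finally show ?thesis using assms(1) by simp
qed

text \<open>Guards the quotient that defines the posterior: with an infinite denominator it would
  not be a probability.\<close>

lemma AE_evidence_finite:
  assumes "n \<ge> 1" shows "AE \<omega> in M. evidence n (space D) \<omega> < \<infinity>"
proof -
  have "(\<integral>\<^sup>+\<omega>. evidence n (space D) \<omega> \<partial>M) \<le> 1"
    using nn_integral_evidence_le_emeasure[of "space D" n] assms by (simp add: D.emeasure_space_1)
  then have "(\<integral>\<^sup>+\<omega>. evidence n (space D) \<omega> \<partial>M) \<noteq> \<infinity>" by (auto simp: top_unique)
  from nn_integral_PInf_AE[OF evidence_borel[OF sets.top] this] show ?thesis
    by eventually_elim (simp add: less_top)
qed

lemma AE_p0_pos: "AE \<omega> in M. \<forall>i\<in>{1..n}. 0 < p0 (X i \<omega>)"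
proof (rule AE_finite_allI)
  fix i assume i: "i \<in> {1..n}"
  then have [measurable]: "X i \<in> borel_measurable M" by (intro X_borel) simp
  have "(\<integral>\<^sup>+\<omega>. indicator {x. p0 x = 0} (X i \<omega>) \<partial>M) = (\<integral>\<^sup>+x. ennreal (p0 x) * indicator {x. p0 x = 0} x \<partial>lborel)"
    by (rule nn_integral_X) (use i in auto)
  also have "\<dots> = (\<integral>\<^sup>+x. 0 \<partial>(lborel::real measure))" by (rule nn_integral_cong) (auto split: split_indicator)
  finally have "(\<integral>\<^sup>+\<omega>. indicator {x. p0 x = 0} (X i \<omega>) \<partial>M) = (0::ennreal)" by simp
  then have "AE \<omega> in M. indicator {x. p0 x = 0} (X i \<omega>) = (0::ennreal)"
    by (subst (asm) nn_integral_0_iff_AE) auto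
  then show "AE \<omega> in M. 0 < p0 (X i \<omega>)"
    by eventually_elim (use p0_nonneg in \<open>auto simp: less_le split: split_indicator_asm\<close>)
qed simp

lemma posterior_eq:
  assumes "n \<ge> 1" "B \<in> sets density_space" "\<omega> \<in> space M"
  shows "posterior (normal_mixture_prior D (bandwidth n)) p0 n (\<lambda>i. X i \<omega>) B
    = enn2real (evidence n {G\<in>space D. mixture n G \<in> B} \<omega> / evidence n (space D) \<omega>)"
proof -
  have m: "mixture n \<in> D \<rightarrow>\<^sub>M density_space"
    unfolding measurable_cong_sets[OF sets_D refl] by (rule measurable_normal_mixture[OF bandwidth_pos[OF assms(1)]])
  have L: "(\<lambda>q. ennreal (likelihood_ratio p0 n (\<lambda>i. X i \<omega>) q)) \<in> borel_measurable density_space"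
    unfolding likelihood_ratio_def
    by (intro measurable_compose[OF _ measurable_ennreal] borel_measurable_prod borel_measurable_divide measurable_density_eval) simp
  have "(\<integral>\<^sup>+q\<in>B. ennreal (likelihood_ratio p0 n (\<lambda>i. X i \<omega>) q) \<partial>normal_mixture_prior D (bandwidth n))
     = (\<integral>\<^sup>+G. ennreal (likelihood_ratio p0 n (\<lambda>i. X i \<omega>) (mixture n G)) * indicator B (mixture n G) \<partial>D)"
    unfolding normal_mixture_prior_def using L assms(2) by (intro nn_integral_distr m) auto
  also have "\<dots> = evidence n {G\<in>space D. mixture n G \<in> B} \<omega>"
    unfolding evidence_def ratio_eq_likelihood_ratio by (intro nn_integral_cong) (auto split: split_indicator)
  finally have 1: "(\<integral>\<^sup>+q\<in>B. ennreal (likelihood_ratio p0 n (\<lambda>i. X i \<omega>) q) \<partial>normal_mixture_prior D (bandwidth n))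
     = evidence n {G\<in>space D. mixture n G \<in> B} \<omega>" .
  have "(\<integral>\<^sup>+q. ennreal (likelihood_ratio p0 n (\<lambda>i. X i \<omega>) q) \<partial>normal_mixture_prior D (bandwidth n))
     = (\<integral>\<^sup>+G. ennreal (likelihood_ratio p0 n (\<lambda>i. X i \<omega>) (mixture n G)) \<partial>D)"
    unfolding normal_mixture_prior_def using L by (intro nn_integral_distr m) auto
  also have "\<dots> = evidence n (space D) \<omega>"
    unfolding evidence_def ratio_eq_likelihood_ratio by (intro nn_integral_cong) (auto split: split_indicator)
  finally show ?thesis
    unfolding posterior_def 1 by simp
qed

lemma borel_measurable_posterior:
  assumes "B \<in> sets density_space"
  shows "(\<lambda>\<omega>. posterior (normal_mixture_prior D (bandwidth n)) p0 n (\<lambda>i. X i \<omega>) B) \<in> borel_measurable M"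
\<comment> \<open>Measurability is required at n = 0 as well, where the bandwidth is 0 and the
  mixtures need not be densities; but without observations the posterior does not depend on
  \<open>\<omega>\<close>.\<close>
proof (cases "n = 0")
  case True
  then show ?thesis by (simp add: posterior_def likelihood_ratio_def)
next
  case False
  then have n: "n \<ge> 1" by simp
  have m: "mixture n \<in> D \<rightarrow>\<^sub>M density_space"
    unfolding measurable_cong_sets[OF sets_D refl] by (rule measurable_normal_mixture[OF bandwidth_pos[OF n]])
  have [measurable]: "{G\<in>space D. mixture n G \<in> B} \<in> sets D"
    using measurable_sets[OF m assms] by (simp add: vimage_def Collect_conj_eq Int_commute)
  show ?thesis
    by (subst measurable_cong[OF posterior_eq[OF n assms]]) measurable
qed

end

lemma (in prob_space) markov_nn_integral:
  assumes [measurable]: "f \<in> borel_measurable M" and "(\<integral>\<^sup>+\<omega>. f \<omega> \<partial>M) \<le> ennreal b" "0 < c" "0 \<le> b"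
  shows "prob {\<omega>\<in>space M. ennreal c \<le> f \<omega>} \<le> b / c"
proof -
  have "emeasure M {\<omega>\<in>space M. 1 \<le> ennreal (1 / c) * f \<omega>} \<le> ennreal (1 / c) * (\<integral>\<^sup>+\<omega>. f \<omega> * indicator (space M) \<omega> \<partial>M)"
    by (rule nn_integral_Markov_inequality) auto
  also have "\<dots> \<le> ennreal (1 / c) * ennreal b"
    using assms(2) by (intro mult_left_mono) (auto cong: nn_integral_cong)
  also have "\<dots> = ennreal (b / c)" using assms by (simp add: ennreal_mult'[symmetric])
  also have "{\<omega>\<in>space M. 1 \<le> ennreal (1 / c) * f \<omega>} = {\<omega>\<in>space M. ennreal c \<le> f \<omega>}"
  proof -
    have 1: "ennreal (1 / c) * ennreal c = 1" using assms by (simp add: ennreal_mult'[symmetric])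
    have "1 \<le> ennreal (1 / c) * t \<longleftrightarrow> ennreal c \<le> t" for t
    proof
      assume "1 \<le> ennreal (1 / c) * t"
      then have "ennreal c * 1 \<le> ennreal c * (ennreal (1 / c) * t)" by (rule mult_left_mono) simp
      also have "ennreal c * (ennreal (1 / c) * t) = (ennreal (1 / c) * ennreal c) * t" by (simp only: ac_simps)
      also have "\<dots> = t" unfolding 1 by simp
      finally show "ennreal c \<le> t" by (simp only: mult_1_right)
    next
      assume "ennreal c \<le> t"
      then have "ennreal (1 / c) * ennreal c \<le> ennreal (1 / c) * t" by (rule mult_left_mono) simp
      then show "1 \<le> ennreal (1 / c) * t" unfolding 1 .
    qed
    then show ?thesis by simp
  qed
  finally show ?thesis using assms by (simp add: emeasure_eq_measure ennreal_le_iff)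
qed

lemma (in prob_space) prob_tendsto_zeroI:
  assumes "\<forall>\<^sub>F n in sequentially. prob (B n) \<le> g n" "g \<longlonglongrightarrow> 0"
  shows "(\<lambda>n. prob (B n)) \<longlonglongrightarrow> 0"
  by (rule tendsto_sandwich[OF _ assms(1) tendsto_const assms(2)]) simp

section \<open>Lower bound for the evidence\<close>

context dpm_posterior
begin

abbreviation target :: "nat \<Rightarrow> real \<Rightarrow> real" where
  "target n \<equiv> normal_mixture (sqrt 2 * bandwidth n) (prob_of p0)"

lemma prob_of_p0: "prob_of p0 \<in> space (prob_algebra borel)"
  by (rule prob_of_in_prob_algebra[OF p0])

lemma target_pos: "n \<ge> 1 \<Longrightarrow> 0 < target n x"
  by (rule normal_mixture_prob_of_pos[OF p0]) simp

lemma target_borel [measurable]: "target n \<in> borel_measurable borel"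
  using measurable_compose[OF measurable_Pair1'[OF prob_of_p0] normal_mixture_joint] by simp

text \<open>\<open>normal_mixture_chi_square\<close> at the scale
  \<open>sqrt 2 * bandwidth n\<close>, whose fourth power is four times n^{-4/5}; hence 48. The 1
  added to the constant only makes it positive.\<close>

lemma target_chi_square:
  obtains C where "0 < C" "\<And>n. n \<ge> 1 \<Longrightarrow>
    (\<integral>\<^sup>+x. ennreal ((p0 x)\<^sup>2 / target n x) \<partial>lborel) \<le> ennreal (1 + C * real n powr (-4/5))"
proof
  let ?W = "\<integral>\<^sup>+x. ennreal ((p0'' x / p0 x)\<^sup>2) \<partial>prob_of p0"
  show "0 < 48 * enn2real ?W + 1" by (intro add_nonneg_pos) auto
  fix n :: nat assume n: "n \<ge> 1"
  have "(sqrt 2 * bandwidth n) ^ 4 = 4 * real n powr (-4/5)"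
  proof -
    have "(bandwidth n) ^ 4 = real n powr (-4/5)"
      using n by (simp add: powr_power)
    moreover have "(sqrt 2) ^ 4 = (4::real)" by (simp add: power4_eq_xxxx)
    ultimately show ?thesis by (simp only: power_mult_distrib)
  qed
  moreover have "?W = ennreal (enn2real ?W)" using W by simp
  ultimately have "(\<integral>\<^sup>+x. ennreal ((p0 x)\<^sup>2 / target n x) \<partial>lborel)
      \<le> 1 + ennreal (12 * (4 * real n powr (-4/5))) * ennreal (enn2real ?W)"
    using normal_mixture_chi_square[OF p0 _ p0' p0'' cont, of "sqrt 2 * bandwidth n"] n by simp
  also have "\<dots> = ennreal (1 + 48 * enn2real ?W * real n powr (-4/5))"
    by (simp add: ennreal_mult'[symmetric] ennreal_plus[symmetric] mult.commute del: ennreal_plus flip: ennreal_1)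
  also have "\<dots> \<le> ennreal (1 + (48 * enn2real ?W + 1) * real n powr (-4/5))"
    by (intro ennreal_leI add_left_mono mult_right_mono) auto
  finally show "(\<integral>\<^sup>+x. ennreal ((p0 x)\<^sup>2 / target n x) \<partial>lborel)
      \<le> ennreal (1 + (48 * enn2real ?W + 1) * real n powr (-4/5))" .
qed

lemma prob_tail: "i \<ge> 1 \<Longrightarrow> prob {\<omega>\<in>space M. t < \<bar>X i \<omega>\<bar>} = measure (prob_of p0) {x. t < \<bar>x\<bar>}"
proof -
  assume i: "i \<ge> 1"
  have "emeasure M {\<omega>\<in>space M. t < \<bar>X i \<omega>\<bar>} = emeasure (prob_of p0) {x. t < \<bar>x\<bar>}"
    using distributed_emeasure[OF dist[OF i], of "{x. t < \<bar>x\<bar>}"]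
    by (simp add: prob_of_def emeasure_density vimage_def Int_def conj_commute)
  then show ?thesis by (simp add: measure_def)
qed

text \<open>Union bound over n observations; the sub-Gaussian tail at the radius is exp (- c
  n^{1/50}), which beats the factor n. All data may thus be assumed to lie in the window where
  mixtures are bounded below.\<close>

lemma truncation_tendsto:
  "(\<lambda>n. prob {\<omega>\<in>space M. \<exists>i\<in>{1..n}. radius n < \<bar>X i \<omega>\<bar>}) \<longlonglongrightarrow> 0"
proof -
  obtain C c where C: "0 < C" "0 < c" "\<And>t. 0 < t \<Longrightarrow> measure (prob_of p0) {x. t < \<bar>x\<bar>} \<le> C * exp (- c * t\<^sup>2)"
    using tail by (auto simp: sub_gaussian_tail_def)
  have [measurable]: "X i \<in> borel_measurable M" if "i \<in> {1..n}" for i n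
    using that by (intro X_borel) simp
  have "prob {\<omega>\<in>space M. \<exists>i\<in>{1..n}. radius n < \<bar>X i \<omega>\<bar>}
      \<le> real n * (C * exp (- c * (radius n)\<^sup>2))" if "n \<ge> 1" for n
  proof -
    have "{\<omega>\<in>space M. \<exists>i\<in>{1..n}. radius n < \<bar>X i \<omega>\<bar>}
        = (\<Union>i\<in>{1..n}. {\<omega>\<in>space M. radius n < \<bar>X i \<omega>\<bar>})" by auto
    also have "prob \<dots> \<le> (\<Sum>i\<in>{1..n}. prob {\<omega>\<in>space M. radius n < \<bar>X i \<omega>\<bar>})"
      by (rule finite_measure_subadditive_finite) (auto intro!: borel_measurable_less borel_measurable_abs X_borel)
    also have "\<dots> \<le> (\<Sum>i\<in>{1..n}. C * exp (- c * (radius n)\<^sup>2))"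
      using C(3)[of "radius n"] that by (intro sum_mono) (simp add: prob_tail)
    finally show ?thesis by simp
  qed
  then have "\<forall>\<^sub>F n in sequentially. prob {\<omega>\<in>space M. \<exists>i\<in>{1..n}. radius n < \<bar>X i \<omega>\<bar>}
      \<le> real n * (C * exp (- c * (radius n)\<^sup>2))"
    by (intro eventually_sequentiallyI[of 1])
  moreover have "(\<lambda>n. real n * (C * exp (- c * (radius n)\<^sup>2))) \<longlonglongrightarrow> 0"
    using \<open>0 < c\<close> by real_asymp
  ultimately show ?thesis by (rule prob_tendsto_zeroI)
qed

text \<open>Restricted to data in the window at which \<open>p0\<close> is positive, where
  \<open>evidence_lower_bound\<close> applies pathwise; the remaining data are handled by
  \<open>truncation_tendsto\<close> and \<open>AE_p0_pos\<close>.\<close>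

definition bad_evidence :: "nat \<Rightarrow> 'a set" where
  "bad_evidence n = {\<omega>\<in>space M. (\<forall>i\<in>{1..n}. \<bar>X i \<omega>\<bar> \<le> radius n \<and> 0 < p0 (X i \<omega>)) \<and>
     evidence n (space D) \<omega> < ennreal (exp (- 8 * rate n))}"

lemma bad_evidence_sets: "bad_evidence n \<in> sets M"
proof -
  have "{\<omega>\<in>space M. \<bar>X i \<omega>\<bar> \<le> radius n \<and> 0 < p0 (X i \<omega>)} \<in> sets M" if "i \<in> {1..n}" for i
  proof -
    have [measurable]: "X i \<in> borel_measurable M" using that by (intro X_borel) simp
    show ?thesis by measurable
  qed
  then have 1: "{\<omega>\<in>space M. \<forall>i\<in>{1..n}. \<bar>X i \<omega>\<bar> \<le> radius n \<and> 0 < p0 (X i \<omega>)} \<in> sets M"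
    by (rule sets.sets_Collect_finite_All) simp_all
  have 2: "{\<omega>\<in>space M. evidence n (space D) \<omega> < ennreal (exp (- 8 * rate n))} \<in> sets M"
    by measurable
  show ?thesis
    unfolding bad_evidence_def by (rule sets.sets_Collect_conj[OF 2 1])
qed

text \<open>The integral is restricted to the prior ball \<open>S\<close>. There each observation
  costs a factor \<open>exp (- 6 * precision n)\<close>, together \<open>exp (- 6 * rate n)\<close>
  because n times n^{-3/4} is n^{1/4}; the mass of \<open>S\<close> costs one more
  \<open>rate n\<close>.\<close>

lemma evidence_lower_bound:
  assumes n: "n \<ge> 1" and S: "S \<in> sets D" "ennreal (exp (- (rate n))) \<le> emeasure D S"
    and low: "\<And>G x. G \<in> S \<Longrightarrow> \<bar>x\<bar> \<le> radius n \<Longrightarrow>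
        exp (- 6 * precision n) * target n x \<le> mixture n G x"
    and \<omega>: "\<forall>i\<in>{1..n}. \<bar>X i \<omega>\<bar> \<le> radius n \<and> 0 < p0 (X i \<omega>)"
  shows "ennreal (exp (- 7 * rate n) / (\<Prod>i=1..n. p0 (X i \<omega>) / target n (X i \<omega>)))
    \<le> evidence n (space D) \<omega>"
proof -
  let ?r = "\<Prod>i=1..n. exp (- 6 * precision n) * target n (X i \<omega>) / p0 (X i \<omega>)"
  have 1: "real n * precision n = rate n"
    using n by (simp add: powr_mult_base)
  have "?r = (\<Prod>i=1..n. exp (- 6 * precision n)) * (\<Prod>i=1..n. target n (X i \<omega>) / p0 (X i \<omega>))"
    by (simp only: prod.distrib[symmetric] times_divide_eq_right)
  also have "(\<Prod>i=1..n. exp (- 6 * precision n)) = exp (- 6 * rate n)"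
    unfolding 1[symmetric] by (simp add: exp_of_nat_mult[symmetric])
  also have "(\<Prod>i=1..n. target n (X i \<omega>) / p0 (X i \<omega>)) = 1 / (\<Prod>i=1..n. p0 (X i \<omega>) / target n (X i \<omega>))"
    unfolding prod_dividef by simp
  finally have r: "?r = exp (- 6 * rate n) / (\<Prod>i=1..n. p0 (X i \<omega>) / target n (X i \<omega>))"
    by (simp only: times_divide_eq_right mult_1_right)
  have "0 \<le> ?r" 
    by (intro prod_nonneg mult_nonneg_nonneg divide_nonneg_nonneg p0_nonneg less_imp_le[OF target_pos[OF n]] exp_ge_zero)
  have "ennreal (exp (- 7 * rate n) / (\<Prod>i=1..n. p0 (X i \<omega>) / target n (X i \<omega>)))
      = ennreal (?r * exp (- (rate n)))"
  proof -
    have "exp (- 7 * rate n) = exp (- 6 * rate n) * exp (- (rate n))"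
      by (simp add: exp_add[symmetric])
    then show ?thesis unfolding r by (simp only: times_divide_eq_left)
  qed
  also have "\<dots> \<le> ennreal ?r * emeasure D S"
    using S(2) \<open>0 \<le> ?r\<close> by (simp only: ennreal_mult') (intro mult_left_mono; simp)
  also have "\<dots> = (\<integral>\<^sup>+G. ennreal ?r * indicator S G \<partial>D)"
    using S(1) by (simp add: nn_integral_cmult_indicator)
  also have "\<dots> \<le> evidence n (space D) \<omega>"
    unfolding evidence_def
  proof (rule nn_integral_mono)
    fix G assume G: "G \<in> space D"
    show "ennreal ?r * indicator S G \<le> ratio n \<omega> G * indicator (space D) G"
    proof (cases "G \<in> S")
      case True
      have "ennreal ?r = (\<Prod>i=1..n. ennreal (exp (- 6 * precision n) * target n (X i \<omega>) / p0 (X i \<omega>)))"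
        by (intro prod_ennreal[symmetric] mult_nonneg_nonneg divide_nonneg_nonneg p0_nonneg
            less_imp_le[OF target_pos[OF n]] exp_ge_zero)
      also have "\<dots> \<le> ratio n \<omega> G"
        unfolding ratio_def using low[OF True] \<omega>
        by (intro prod_mono_ennreal ennreal_leI divide_right_mono) (auto intro: less_imp_le)
      finally show ?thesis using G True by simp
    qed simp
  qed
  finally show ?thesis .
qed

text \<open>On the bad event the product of \<open>p0 / target\<close> over the data is at least
  \<open>exp (rate n)\<close>. Its mean is the n-th power of the chi-square integral, at most exp (C
  n^{1/5}), and 1/5 < 1/4.\<close>

lemma bad_evidence_tendsto: "(\<lambda>n. prob (bad_evidence n)) \<longlonglongrightarrow> 0"
proof -
  obtain C where C: "0 < C" "\<And>n. n \<ge> 1 \<Longrightarrow>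
    (\<integral>\<^sup>+x. ennreal ((p0 x)\<^sup>2 / target n x) \<partial>lborel) \<le> ennreal (1 + C * real n powr (-4/5))"
    by (rule target_chi_square) (rule that)
  have "\<forall>\<^sub>F n in sequentially. prob (bad_evidence n) \<le> exp (C * real n powr (1/5)) / exp (rate n)"
    using mixture_ball_mass[OF refl s \<alpha>0 DP prob_of_p0] eventually_ge_at_top[of 1]
  proof eventually_elim
    case (elim n)
    then obtain S where S: "S \<in> sets D" "ennreal (exp (- (rate n))) \<le> emeasure D S"
      and low: "\<And>G x. G \<in> S \<Longrightarrow> \<bar>x\<bar> \<le> radius n \<Longrightarrow>
        exp (- 6 * precision n) * target n x \<le> mixture n G x" by blast
    note n = elim(2)
    define Z where "Z \<omega> = (\<Prod>i=1..n. ennreal (p0 (X i \<omega>) / target n (X i \<omega>)))" for \<omega>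
    have [measurable]: "Z \<in> borel_measurable M"
      unfolding Z_def by (rule borel_measurable_prod_X) measurable
    have fm: "(\<lambda>x. ennreal (p0 x / target n x)) \<in> borel_measurable borel" by measurable
    have "(\<integral>\<^sup>+\<omega>. Z \<omega> \<partial>M) = (\<integral>\<^sup>+x. ennreal (p0 x) * ennreal (p0 x / target n x) \<partial>lborel) ^ n"
      unfolding Z_def by (rule nn_integral_prod_X[OF fm])
    also have "(\<integral>\<^sup>+x. ennreal (p0 x) * ennreal (p0 x / target n x) \<partial>lborel) = (\<integral>\<^sup>+x. ennreal ((p0 x)\<^sup>2 / target n x) \<partial>lborel)"
      using p0_nonneg target_pos[OF n]
      by (intro nn_integral_cong) (simp add: ennreal_mult'[symmetric] power2_eq_square)
    also have "\<dots> ^ n \<le> ennreal (1 + C * real n powr (-4/5)) ^ n"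
      by (intro power_mono C(2)[OF n]) simp
    also have "\<dots> = ennreal ((1 + C * real n powr (-4/5)) ^ n)"
      using C(1) by (intro ennreal_power) simp
    also have "\<dots> \<le> ennreal (exp (C * real n powr (-4/5)) ^ n)"
      using C(1) by (intro ennreal_leI power_mono exp_ge_add_one_self) simp
    also have "exp (C * real n powr (-4/5)) ^ n = exp (C * real n powr (1/5))"
    proof -
      have "real n * real n powr (-4/5) = real n powr (1/5)" using n by (simp add: powr_mult_base)
      then have "real n * (C * real n powr (-4/5)) = C * real n powr (1/5)" by (simp only: mult.left_commute)
      then show ?thesis by (simp only: exp_of_nat_mult[symmetric])
    qed
    finally have Z: "(\<integral>\<^sup>+\<omega>. Z \<omega> \<partial>M) \<le> ennreal (exp (C * real n powr (1/5)))" .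
    have "bad_evidence n \<subseteq> {\<omega>\<in>space M. ennreal (exp (rate n)) \<le> Z \<omega>}"
    proof
      fix \<omega> assume "\<omega> \<in> bad_evidence n"
      then have \<omega>: "\<omega> \<in> space M" "\<forall>i\<in>{1..n}. \<bar>X i \<omega>\<bar> \<le> radius n \<and> 0 < p0 (X i \<omega>)"
        and ev: "evidence n (space D) \<omega> < ennreal (exp (- 8 * rate n))"
        by (auto simp: bad_evidence_def)
      let ?z = "\<Prod>i=1..n. p0 (X i \<omega>) / target n (X i \<omega>)"
      have z: "0 < ?z" using \<omega>(2) target_pos[OF n] by (intro prod_pos) auto
      have "exp (- 7 * rate n) / ?z < exp (- 8 * rate n)"
        using le_less_trans[OF evidence_lower_bound[OF n S low \<omega>(2)] ev] by (simp only: ennreal_less_iff[OF divide_nonneg_pos[OF exp_ge_zero z]])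
      then have "exp (- 7 * rate n) < exp (- 8 * rate n) * ?z"
        using z by (simp only: pos_divide_less_eq)
      then have "exp (8 * rate n) * exp (- 7 * rate n) < exp (8 * rate n) * (exp (- 8 * rate n) * ?z)"
        by (intro mult_strict_left_mono) auto
      then have "exp (rate n) \<le> ?z"
        by (simp only: mult.assoc[symmetric] exp_add[symmetric]) simp
      moreover have "Z \<omega> = ennreal ?z"
        unfolding Z_def using p0_nonneg target_pos[OF n] by (intro prod_ennreal divide_nonneg_nonneg p0_nonneg less_imp_le[OF target_pos[OF n]])
      ultimately show "\<omega> \<in> {\<omega>\<in>space M. ennreal (exp (rate n)) \<le> Z \<omega>}"
        using \<omega>(1) by (simp add: ennreal_leI)
    qed
    then have "prob (bad_evidence n) \<le> prob {\<omega>\<in>space M. ennreal (exp (rate n)) \<le> Z \<omega>}"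
      by (rule finite_measure_mono) measurable
    also have "\<dots> \<le> exp (C * real n powr (1/5)) / exp (rate n)"
      by (rule markov_nn_integral[OF _ Z]) auto
    finally show ?case .
  qed
  moreover have "(\<lambda>n. exp (C * real n powr (1/5)) / exp (rate n)) \<longlonglongrightarrow> 0"
    using C(1) by real_asymp
  ultimately show ?thesis by (rule prob_tendsto_zeroI)
qed

end

section \<open>Tails of normal mixtures\<close>

lemma nn_integral_mixture_swap:
  assumes G: "G \<in> space (prob_algebra borel)" and [measurable]: "f \<in> borel_measurable borel"
  shows "(\<integral>\<^sup>+x. f x * ennreal (normal_mixture \<sigma> G x) \<partial>lborel)
    = (\<integral>\<^sup>+z. \<integral>\<^sup>+x. f x * ennreal (\<phi> \<sigma> (x - z)) \<partial>lborel \<partial>G)"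
proof -
  from G interpret G: prob_space G by (simp add: space_prob_algebra)
  from G have [measurable_cong]: "sets G = sets borel" by (simp add: space_prob_algebra)
  interpret pair_sigma_finite lborel G ..
  have "(\<integral>\<^sup>+x. f x * ennreal (normal_mixture \<sigma> G x) \<partial>lborel)
      = (\<integral>\<^sup>+x. \<integral>\<^sup>+z. f x * ennreal (\<phi> \<sigma> (x - z)) \<partial>G \<partial>lborel)"
    unfolding normal_mixture_def
    by (simp add: nn_integral_eq_integral[OF normal_mixture_integrable[OF G], symmetric] nn_integral_cmult)
  also have "\<dots> = (\<integral>\<^sup>+z. \<integral>\<^sup>+x. f x * ennreal (\<phi> \<sigma> (x - z)) \<partial>lborel \<partial>G)"
    by (rule Fubini'[symmetric]) measurable
  finally show ?thesis .
qed

lemma emeasure_prob_of: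
  assumes "q \<in> densities" "B \<in> sets borel"
  shows "emeasure (prob_of q) B = (\<integral>\<^sup>+x. indicator B x * ennreal (q x) \<partial>lborel)"
  using assms unfolding prob_of_def densities_def by (subst emeasure_density) (auto simp: mult.commute)

lemma nn_integral_normal_density_half:
  assumes "0 < \<sigma>" shows "ennreal (1/2) \<le> (\<integral>\<^sup>+y. ennreal (\<phi> \<sigma> y) * indicator {0..} y \<partial>lborel)"
    (is "_ \<le> ?I")
proof -
  have "?I = (\<integral>\<^sup>+y. ennreal (\<phi> \<sigma> (- y)) * indicator {0..} (- y) \<partial>lborel)"
    by (subst nn_integral_real_affine[where c = "-1" and t = 0]) auto
  also have "\<dots> = (\<integral>\<^sup>+y. ennreal (\<phi> \<sigma> y) * indicator {..0} y \<partial>lborel)"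
    by (intro nn_integral_cong) (auto simp: normal_density_def split: split_indicator)
  finally have 1: "?I = (\<integral>\<^sup>+y. ennreal (\<phi> \<sigma> y) * indicator {..0} y \<partial>lborel)" .
  have "1 = (\<integral>\<^sup>+y. ennreal (\<phi> \<sigma> y) \<partial>lborel)"
    using prob_space.emeasure_space_1[OF prob_space_normal_density[OF assms, of 0]]
    by (simp add: emeasure_density)
  also have "\<dots> \<le> (\<integral>\<^sup>+y. ennreal (\<phi> \<sigma> y) * indicator {0..} y
      + ennreal (\<phi> \<sigma> y) * indicator {..0} y \<partial>lborel)"
    by (intro nn_integral_mono) (auto split: split_indicator)
  also have "\<dots> = ?I + ?I" unfolding 1 by (subst nn_integral_add) (auto simp: 1)
  finally have "1 \<le> 2 * ?I" by (simp add: mult_2)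
  then have "ennreal (1/2) * 1 \<le> ennreal (1/2) * (2 * ?I)" by (rule mult_left_mono) simp
  also have "\<dots> = (ennreal (1/2) * ennreal 2) * ?I" by (simp add: mult.assoc)
  also have "ennreal (1/2) * ennreal 2 = 1" by (subst ennreal_mult'[symmetric]) auto
  finally show ?thesis by simp
qed

text \<open>At least half of the normal kernel centred at \<open>z\<close> lies on the side of
  \<open>z\<close> that points away from 0, hence stays in the tail.\<close>

lemma mixture_tail_ge:
  assumes G: "G \<in> space (prob_algebra borel)" and \<sigma>: "0 < \<sigma>" and k: "0 \<le> k"
  shows "measure G {z. k < \<bar>z\<bar>} / 2 \<le> measure (prob_of (normal_mixture \<sigma> G)) {x. k < \<bar>x\<bar>}"
proof -
  from G interpret G: prob_space G by (simp add: space_prob_algebra)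
  from G have [measurable_cong, simp]: "sets G = sets borel" by (simp add: space_prob_algebra)
  have d: "normal_mixture \<sigma> G \<in> densities" by (rule normal_mixture_density[OF G \<sigma>])
  interpret Q: prob_space "prob_of (normal_mixture \<sigma> G)"
    using prob_of_in_prob_algebra[OF d] by (simp add: space_prob_algebra)
  have half: "ennreal (1/2) * indicator {z. k < \<bar>z\<bar>} z
      \<le> (\<integral>\<^sup>+x. indicator {x. k < \<bar>x\<bar>} x * ennreal (\<phi> \<sigma> (x - z)) \<partial>lborel)" for z
  proof (cases "k < \<bar>z\<bar>")
    case True
    define c :: real where "c = (if 0 \<le> z then 1 else - 1)"
    have c: "c \<noteq> 0" "\<bar>c\<bar> = 1" by (auto simp: c_def)
    have "ennreal (1/2) \<le> (\<integral>\<^sup>+y. ennreal (\<phi> \<sigma> y) * indicator {0..} y \<partial>lborel)"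
      by (rule nn_integral_normal_density_half[OF \<sigma>])
    also have "\<dots> \<le> (\<integral>\<^sup>+y. indicator {x. k < \<bar>x\<bar>} (z + c * y) * ennreal (\<phi> \<sigma> ((z + c * y) - z)) \<partial>lborel)"
      using True k by (intro nn_integral_mono)
        (auto simp: c_def normal_density_def split: split_indicator)
    also have "\<dots> = (\<integral>\<^sup>+x. indicator {x. k < \<bar>x\<bar>} x * ennreal (\<phi> \<sigma> (x - z)) \<partial>lborel)"
      by (subst (2) nn_integral_real_affine[OF _ c(1), where t = z]) (auto simp: c(2))
    finally show ?thesis using True by simp
  qed simp
  have "ennreal (measure G {z. k < \<bar>z\<bar>} / 2) = ennreal (1/2) * emeasure G {z. k < \<bar>z\<bar>}"
    unfolding G.emeasure_eq_measure by (subst ennreal_mult[symmetric]) auto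
  also have "\<dots> = (\<integral>\<^sup>+z. ennreal (1/2) * indicator {z. k < \<bar>z\<bar>} z \<partial>G)"
    by (subst nn_integral_cmult_indicator) auto
  also have "\<dots> \<le> (\<integral>\<^sup>+z. \<integral>\<^sup>+x. indicator {x. k < \<bar>x\<bar>} x * ennreal (\<phi> \<sigma> (x - z)) \<partial>lborel \<partial>G)"
    by (intro nn_integral_mono half)
  also have "\<dots> = (\<integral>\<^sup>+x. indicator {x. k < \<bar>x\<bar>} x * ennreal (normal_mixture \<sigma> G x) \<partial>lborel)"
    by (rule nn_integral_mixture_swap[OF G, symmetric]) measurable
  also have "\<dots> = ennreal (measure (prob_of (normal_mixture \<sigma> G)) {x. k < \<bar>x\<bar>})"
    using emeasure_prob_of[OF d, of "{x. k < \<bar>x\<bar>}"] by (simp add: Q.emeasure_eq_measure)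
  finally show ?thesis by (simp add: ennreal_le_iff)
qed

text \<open>\<open>\<bar>x\<bar>\<close> is at most twice the larger of \<open>\<bar>z\<bar>\<close>
  and \<open>\<bar>x - z\<bar>\<close>. The fourth power is used because the fourth moment of the
  kernel is already available.\<close>

lemma powr_le_shifted:
  fixes x z p :: real
  assumes "1 \<le> p" "p < 4"
  shows "\<bar>x\<bar> powr p \<le> 2 powr p * (\<bar>z\<bar> powr p + (1 + (x - z) ^ 4))"
proof -
  define m where "m = max \<bar>z\<bar> \<bar>x - z\<bar>"
  have "\<bar>z\<bar> \<le> m" "\<bar>x - z\<bar> \<le> m" by (simp_all add: m_def)
  then have "\<bar>x\<bar> \<le> 2 * m" by linarith
  then have "\<bar>x\<bar> powr p \<le> (2 * m) powr p" using assms by (intro powr_mono2) auto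
  also have "\<dots> = 2 powr p * m powr p" by (rule powr_mult)
  also have "m powr p \<le> \<bar>z\<bar> powr p + (1 + (x - z) ^ 4)"
  proof (cases "\<bar>x - z\<bar> \<le> \<bar>z\<bar>")
    case True
    then show ?thesis by (simp add: m_def add_nonneg_nonneg)
  next
    case False
    have "\<bar>x - z\<bar> powr p \<le> 1 + (x - z) ^ 4"
    proof (cases "\<bar>x - z\<bar> \<le> 1")
      case True
      then have "\<bar>x - z\<bar> powr p \<le> 1" using assms by (intro powr_le1) auto
      then show ?thesis by (simp add: add_increasing2)
    next
      case False
      then have "\<bar>x - z\<bar> powr p \<le> \<bar>x - z\<bar> powr 4" using assms by (intro powr_mono) auto
      also have "\<dots> = (x - z) ^ 4" using False by (simp add: powr_numeral)
      finally show ?thesis by simp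
    qed
    then show ?thesis using False by (simp add: m_def max_def add_increasing)
  qed
  finally show ?thesis by simp
qed

text \<open>\<open>powr_le_shifted\<close> averaged over the kernel; the 4 is its constant 1 plus
  the fourth moment \<open>3 * \<sigma> ^ 4 \<le> 3\<close>.\<close>

lemma abs_moment_mixture_le:
  assumes G: "G \<in> space (prob_algebra borel)" and \<sigma>: "0 < \<sigma>" "\<sigma> \<le> 1" and p: "1 \<le> p" "p < 4"
  shows "abs_moment p (prob_of (normal_mixture \<sigma> G)) \<le> ennreal (2 powr p) * (abs_moment p G + 4)"
proof -
  from G interpret G: prob_space G by (simp add: space_prob_algebra)
  from G have [measurable_cong, simp]: "sets G = sets borel" by (simp add: space_prob_algebra)
  have d: "normal_mixture \<sigma> G \<in> densities" by (rule normal_mixture_density[OF G \<sigma>(1)])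
  then have [measurable]: "normal_mixture \<sigma> G \<in> borel_measurable borel" by (simp add: densities_def)
  have dens: "(\<integral>\<^sup>+x. ennreal (\<phi> \<sigma> x) \<partial>lborel) = 1"
    using prob_space.emeasure_space_1[OF prob_space_normal_density[OF \<sigma>(1), of 0]]
    by (simp add: emeasure_density)
  have inner: "(\<integral>\<^sup>+x. ennreal (\<bar>x\<bar> powr p) * ennreal (\<phi> \<sigma> (x - z)) \<partial>lborel)
      \<le> ennreal (2 powr p) * (ennreal (\<bar>z\<bar> powr p) + 4)" for z
  proof -
    have "(\<integral>\<^sup>+x. ennreal (\<bar>x\<bar> powr p) * ennreal (\<phi> \<sigma> (x - z)) \<partial>lborel)
       = (\<integral>\<^sup>+y. ennreal (\<bar>z + 1 * y\<bar> powr p) * ennreal (\<phi> \<sigma> ((z + 1 * y) - z)) \<partial>lborel)"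
      by (subst nn_integral_real_affine[where c = 1 and t = z]) auto
    also have "\<dots> \<le> (\<integral>\<^sup>+y. ennreal (2 powr p) * (ennreal (\<bar>z\<bar> powr p + 1) * ennreal (\<phi> \<sigma> y)
        + ennreal (\<phi> \<sigma> y * y ^ 4)) \<partial>lborel)"
    proof (rule nn_integral_mono)
      fix y
      have "\<bar>z + y\<bar> powr p * \<phi> \<sigma> y \<le> 2 powr p * (\<bar>z\<bar> powr p + (1 + y ^ 4)) * \<phi> \<sigma> y"
        using powr_le_shifted[OF p, of "z + y" z] by (intro mult_right_mono) auto
      then have "ennreal (\<bar>z + y\<bar> powr p * \<phi> \<sigma> y)
          \<le> ennreal (2 powr p * ((\<bar>z\<bar> powr p + 1) * \<phi> \<sigma> y + \<phi> \<sigma> y * y ^ 4))"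
        by (intro ennreal_leI) (simp add: algebra_simps)
      then show "ennreal (\<bar>z + 1 * y\<bar> powr p) * ennreal (\<phi> \<sigma> ((z + 1 * y) - z))
        \<le> ennreal (2 powr p) * (ennreal (\<bar>z\<bar> powr p + 1) * ennreal (\<phi> \<sigma> y)
        + ennreal (\<phi> \<sigma> y * y ^ 4))"
        by (simp add: ennreal_mult ennreal_plus)
    qed
    also have "\<dots> = ennreal (2 powr p) * (ennreal (\<bar>z\<bar> powr p + 1) + ennreal (3 * \<sigma> ^ 4))"
      by (simp add: nn_integral_cmult nn_integral_add dens nn_integral_normal_pow4[OF \<sigma>(1)])
    also have "\<dots> \<le> ennreal (2 powr p) * (ennreal (\<bar>z\<bar> powr p + 1) + ennreal 3)"
      using \<sigma> by (intro mult_left_mono add_left_mono ennreal_leI) (auto simp: power_le_one)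
    also have "ennreal (\<bar>z\<bar> powr p + 1) + ennreal 3 = ennreal (\<bar>z\<bar> powr p) + ennreal 4"
      by (subst (1 2) ennreal_plus[symmetric]) (simp_all del: ennreal_plus)
    finally show ?thesis by simp
  qed
  have "abs_moment p (prob_of (normal_mixture \<sigma> G)) = (\<integral>\<^sup>+x. ennreal (\<bar>x\<bar> powr p) * ennreal (normal_mixture \<sigma> G x) \<partial>lborel)"
    unfolding abs_moment_def prob_of_def by (subst nn_integral_density) (auto simp: mult.commute)
  also have "\<dots> = (\<integral>\<^sup>+z. \<integral>\<^sup>+x. ennreal (\<bar>x\<bar> powr p) * ennreal (\<phi> \<sigma> (x - z)) \<partial>lborel \<partial>G)"
    by (rule nn_integral_mixture_swap[OF G]) measurable
  also have "\<dots> \<le> (\<integral>\<^sup>+z. ennreal (2 powr p) * (ennreal (\<bar>z\<bar> powr p) + 4) \<partial>G)"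
    by (intro nn_integral_mono inner)
  also have "\<dots> = ennreal (2 powr p) * (abs_moment p G + 4)"
    unfolding abs_moment_def by (simp add: nn_integral_cmult nn_integral_add G.emeasure_space_1)
  finally show ?thesis .
qed

text \<open>For \<open>\<bar>z\<bar> > 1\<close> a single term of the series already dominates the
  power; the leading 1 covers the rest. The crude sum is good enough because only boundedness of the
  moment is at stake.\<close>

lemma abs_moment_le_tail_sum:
  assumes G: "G \<in> space (prob_algebra borel)" and p: "1 \<le> p"
  shows "abs_moment p G \<le> 1 + (\<Sum>k. ennreal (real (k + 2) powr p * measure G {z. real (Suc k) < \<bar>z\<bar>}))"
proof -
  from G interpret G: prob_space G by (simp add: space_prob_algebra)
  from G have [measurable_cong, simp]: "sets G = sets borel" by (simp add: space_prob_algebra)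
  have ptw: "ennreal (\<bar>z\<bar> powr p) \<le> 1 + (\<Sum>k. ennreal (real (k + 2) powr p) * indicator {z. real (Suc k) < \<bar>z\<bar>} z)" for z
  proof (cases "\<bar>z\<bar> \<le> 1")
    case True
    then have "\<bar>z\<bar> powr p \<le> 1" using p by (intro powr_le1) auto
    then have "ennreal (\<bar>z\<bar> powr p) \<le> ennreal 1" by (rule ennreal_leI)
    then show ?thesis by (simp add: add_increasing2)
  next
    case False
    \<comment> \<open>This is the integer with k + 1 < \<open>\<bar>z\<bar>\<close> <= k +
      2.\<close>
    define k where "k = nat (\<lceil>\<bar>z\<bar>\<rceil> - 2)"
    have k: "real (Suc k) < \<bar>z\<bar>" "\<bar>z\<bar> \<le> real (k + 2)"
      using False unfolding k_def by linarith+
    then have "ennreal (\<bar>z\<bar> powr p) \<le> ennreal (real (k + 2) powr p) * indicator {z. real (Suc k) < \<bar>z\<bar>} z"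
      using p by (auto intro!: ennreal_leI powr_mono2)
    also have "\<dots> = (\<Sum>i\<in>{k}. ennreal (real (i + 2) powr p) * indicator {z. real (Suc i) < \<bar>z\<bar>} z)"
      by (subst sum.insert) (simp_all only: finite.emptyI empty_iff sum.empty add_0_right simp_thms)
    also have "\<dots> \<le> (\<Sum>i. ennreal (real (i + 2) powr p) * indicator {z. real (Suc i) < \<bar>z\<bar>} z)"
      by (rule sum_le_suminf) auto
    finally show ?thesis by (simp add: add_increasing)
  qed
  have "abs_moment p G \<le> (\<integral>\<^sup>+z. 1 + (\<Sum>k. ennreal (real (k + 2) powr p) * indicator {z. real (Suc k) < \<bar>z\<bar>} z) \<partial>G)"
    unfolding abs_moment_def by (intro nn_integral_mono ptw)
  also have "\<dots> = 1 + (\<Sum>k. \<integral>\<^sup>+z. ennreal (real (k + 2) powr p) * indicator {z. real (Suc k) < \<bar>z\<bar>} z \<partial>G)"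
    by (subst nn_integral_add) (auto simp: G.emeasure_space_1 nn_integral_suminf)
  also have "(\<Sum>k. \<integral>\<^sup>+z. ennreal (real (k + 2) powr p) * indicator {z. real (Suc k) < \<bar>z\<bar>} z \<partial>G)
      = (\<Sum>k. ennreal (real (k + 2) powr p * measure G {z. real (Suc k) < \<bar>z\<bar>}))"
    by (intro suminf_cong) (simp add: nn_integral_cmult_indicator G.emeasure_eq_measure ennreal_mult)
  finally show ?thesis .
qed

text \<open>Comparison with a centred normal density of scale \<open>2 * s\<close>: half of the
  Gaussian exponent forms that density, the other half gives the decay in \<open>k\<close>. The
  factor 2 is the ratio of the normalising constants, and the remaining factor pays for the mean
  \<open>\<mu>\<close>.\<close>

lemma normal_tail_bound:
  assumes s: "0 < s" and k: "0 \<le> k"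
  shows "measure (density lborel (normal_density \<mu> s)) {z. k < \<bar>z\<bar>}
    \<le> 2 * exp (\<mu>\<^sup>2 / (2 * s\<^sup>2)) * exp (- (1 / (8 * s\<^sup>2)) * k\<^sup>2)"
proof -
  interpret H: prob_space "density lborel (normal_density \<mu> s)" by (rule prob_space_normal_density[OF s])
  let ?C = "2 * exp (\<mu>\<^sup>2 / (2 * s\<^sup>2)) * exp (- (1 / (8 * s\<^sup>2)) * k\<^sup>2)"
  have dens: "normal_density \<mu> s z \<le> ?C * \<phi> (2 * s) z" if "k < \<bar>z\<bar>" for z
  proof -
    have "z\<^sup>2 \<le> 2 * (z - \<mu>)\<^sup>2 + 2 * \<mu>\<^sup>2"
      using zero_le_power2[of "z - 2 * \<mu>"] by (simp add: power2_eq_square algebra_simps)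
    moreover have "k\<^sup>2 \<le> z\<^sup>2" using that k by (simp add: abs_le_square_iff[symmetric])
    ultimately have "(k\<^sup>2 + z\<^sup>2) / (8 * s\<^sup>2) \<le> (4 * (z - \<mu>)\<^sup>2 + 4 * \<mu>\<^sup>2) / (8 * s\<^sup>2)"
      by (intro divide_right_mono) auto
    then have "- (z - \<mu>)\<^sup>2 / (2 * s\<^sup>2) \<le> \<mu>\<^sup>2 / (2 * s\<^sup>2) + - (1 / (8 * s\<^sup>2)) * k\<^sup>2 + - z\<^sup>2 / (2 * (2 * s)\<^sup>2)"
      by (simp add: add_divide_distrib power_mult_distrib)
    then have "exp (- (z - \<mu>)\<^sup>2 / (2 * s\<^sup>2)) \<le> exp (\<mu>\<^sup>2 / (2 * s\<^sup>2)) * exp (- (1 / (8 * s\<^sup>2)) * k\<^sup>2) * exp (- z\<^sup>2 / (2 * (2 * s)\<^sup>2))"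
      by (simp only: exp_add[symmetric] exp_le_cancel_iff)
    then have "exp (- (z - \<mu>)\<^sup>2 / (2 * s\<^sup>2)) / (sqrt (2 * pi) * s) \<le> exp (\<mu>\<^sup>2 / (2 * s\<^sup>2)) * exp (- (1 / (8 * s\<^sup>2)) * k\<^sup>2) * exp (- z\<^sup>2 / (2 * (2 * s)\<^sup>2)) / (sqrt (2 * pi) * s)"
      using s by (intro divide_right_mono) auto
    moreover have "normal_density \<mu> s z = exp (- (z - \<mu>)\<^sup>2 / (2 * s\<^sup>2)) / (sqrt (2 * pi) * s)"
      using s by (simp add: normal_density_def real_sqrt_mult)
    moreover have "sqrt (2 * pi * (2 * s)\<^sup>2) = sqrt (2 * pi) * (2 * s)"
      using s by (subst real_sqrt_mult, subst real_sqrt_abs) simp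
    then have "\<phi> (2 * s) z = exp (- z\<^sup>2 / (2 * (2 * s)\<^sup>2)) / (sqrt (2 * pi) * (2 * s))"
      by (simp only: normal_density_def diff_0_right) simp
    ultimately show ?thesis by simp
  qed
  have "ennreal (measure (density lborel (normal_density \<mu> s)) {z. k < \<bar>z\<bar>})
      = (\<integral>\<^sup>+z. ennreal (normal_density \<mu> s z) * indicator {z. k < \<bar>z\<bar>} z \<partial>lborel)"
    by (simp add: H.emeasure_eq_measure[symmetric] emeasure_density)
  also have "\<dots> \<le> (\<integral>\<^sup>+z. ennreal ?C * ennreal (\<phi> (2 * s) z) \<partial>lborel)"
    using dens by (intro nn_integral_mono) (auto split: split_indicator simp: ennreal_mult'[symmetric] intro!: ennreal_leI)
  also have "\<dots> = ennreal ?C"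
    using prob_space.emeasure_space_1[OF prob_space_normal_density[of "2 * s" 0]] s
    by (simp add: emeasure_density nn_integral_cmult)
  finally show ?thesis by (subst (asm) ennreal_le_iff) auto
qed

section \<open>Tests for heavy tails\<close>

context dpm_posterior
begin

definition tail_prob :: "nat \<Rightarrow> real" where
  "tail_prob k = measure (prob_of p0) {x. real k < \<bar>x\<bar>}"

abbreviation outer :: "nat \<Rightarrow> real set" where
  "outer k \<equiv> {x. real k < \<bar>x\<bar>}"

lemma prob_space_prob_of_p0: "prob_space (prob_of p0)"
  using prob_of_p0 by (simp add: space_prob_algebra)

text \<open>The exponential of the number of observations beyond \<open>k\<close>, kept as a product
  over the observations so that independence applies.\<close>

definition exceedance :: "nat \<Rightarrow> nat \<Rightarrow> 'a \<Rightarrow> ennreal" where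
  "exceedance n k \<omega> = (\<Prod>i=1..n. ennreal (exp (indicator (outer k) (X i \<omega>))))"

lemma exceedance_borel [measurable]: "exceedance n k \<in> borel_measurable M"
  unfolding exceedance_def by (rule borel_measurable_prod_X) measurable

text \<open>The reciprocal of \<open>exceedance\<close>; as a weight on the evidence it penalises
  data with many observations beyond \<open>k\<close>.\<close>

definition discount :: "nat \<Rightarrow> nat \<Rightarrow> 'a \<Rightarrow> ennreal" where
  "discount n k \<omega> = (\<Prod>i=1..n. ennreal (exp (- indicator (outer k) (X i \<omega>))))"

lemma discount_borel [measurable]: "discount n k \<in> borel_measurable M"
  unfolding discount_def by (rule borel_measurable_prod_X) measurable

text \<open>A Chernoff bound: a single factor has mean 1 + (e - 1) \<open>tail_prob k\<close>, at
  most \<open>exp (2 * tail_prob k)\<close> because e <= 3.\<close>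

lemma exceedance_bound:
  "prob {\<omega>\<in>space M. ennreal (exp (2 * real n * tail_prob k + rate n)) \<le> exceedance n k \<omega>}
    \<le> exp (- (rate n))"
proof -
  interpret P: prob_space "prob_of p0" by (rule prob_space_prob_of_p0)
  have t0: "0 \<le> tail_prob k" by (simp add: tail_prob_def)
  have fm: "(\<lambda>x. ennreal (exp (indicator (outer k) x))) \<in> borel_measurable borel" by measurable
  have "(\<integral>\<^sup>+x. ennreal (p0 x) * ennreal (exp (indicator (outer k) x)) \<partial>lborel)
      \<le> (\<integral>\<^sup>+x. ennreal (p0 x) + ennreal 2 * (indicator (outer k) x * ennreal (p0 x)) \<partial>lborel)"
  proof (rule nn_integral_mono)
    fix x
    show "ennreal (p0 x) * ennreal (exp (indicator (outer k) x))
        \<le> ennreal (p0 x) + ennreal 2 * (indicator (outer k) x * ennreal (p0 x))"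
    proof (cases "x \<in> outer k")
      case True
      have "ennreal 3 = 1 + ennreal 2" using ennreal_plus[of 1 2] by simp
      then have "ennreal (p0 x) + ennreal 2 * ennreal (p0 x) = ennreal (p0 x) * ennreal 3"
        by (simp only: distrib_left mult_1_right mult_1_left mult.commute)
      moreover have "ennreal (p0 x) * ennreal (exp 1) \<le> ennreal (p0 x) * ennreal 3"
        by (intro mult_left_mono ennreal_leI exp_le) simp
      ultimately show ?thesis using True by simp
    qed simp
  qed
  also have "\<dots> = emeasure (prob_of p0) UNIV + ennreal 2 * emeasure (prob_of p0) (outer k)"
    by (simp add: emeasure_prob_of[OF p0] nn_integral_add nn_integral_cmult)
  also have "\<dots> = ennreal (1 + 2 * tail_prob k)"
  proof -
    have "emeasure (prob_of p0) UNIV = 1"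
      using P.emeasure_space_1 by (simp add: prob_of_def)
    moreover have "ennreal (1 + 2 * tail_prob k) = 1 + ennreal 2 * ennreal (tail_prob k)"
      using t0 by (simp add: ennreal_mult' del: ennreal_numeral)
    ultimately show ?thesis by (simp only: P.emeasure_eq_measure tail_prob_def)
  qed
  finally have 1: "(\<integral>\<^sup>+x. ennreal (p0 x) * ennreal (exp (indicator (outer k) x)) \<partial>lborel) \<le> ennreal (1 + 2 * tail_prob k)" .
  have "(\<integral>\<^sup>+\<omega>. exceedance n k \<omega> \<partial>M) = (\<integral>\<^sup>+x. ennreal (p0 x) * ennreal (exp (indicator (outer k) x)) \<partial>lborel) ^ n"
    unfolding exceedance_def by (rule nn_integral_prod_X[OF fm])
  also have "\<dots> \<le> ennreal (1 + 2 * tail_prob k) ^ n" by (intro power_mono 1) simp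
  also have "\<dots> = ennreal ((1 + 2 * tail_prob k) ^ n)" using t0 by (intro ennreal_power) simp
  also have "\<dots> \<le> ennreal (exp (2 * tail_prob k) ^ n)"
    using t0 by (intro ennreal_leI power_mono exp_ge_add_one_self) simp
  also have "exp (2 * tail_prob k) ^ n = exp (2 * real n * tail_prob k)"
    by (simp add: exp_of_nat_mult[symmetric] mult.left_commute)
  finally have "prob {\<omega>\<in>space M. ennreal (exp (2 * real n * tail_prob k + rate n)) \<le> exceedance n k \<omega>}
      \<le> exp (2 * real n * tail_prob k) / exp (2 * real n * tail_prob k + rate n)"
    by (intro markov_nn_integral) auto
  then show ?thesis by (simp add: exp_diff[symmetric])
qed

text \<open>For one observation from a mixture with outer mass at least \<open>r / 2\<close>, the
  discount has mean at most 1 - (3/5)(r/2), since 1 - exp (-1) is at least 3/5. This is at most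
  \<open>exp (- (3/10) * r)\<close>, and independence supplies the power n.\<close>

lemma nn_integral_test:
  assumes U: "U \<in> sets D" and n: "n \<ge> 1"
    and r: "\<And>G. G \<in> U \<Longrightarrow> r / 2 \<le> measure (prob_of (mixture n G)) (outer k)"
  shows "(\<integral>\<^sup>+\<omega>. evidence n U \<omega> * discount n k \<omega> \<partial>M)
    \<le> ennreal (exp (- (3/10) * real n * r))"
proof -
  have "(\<integral>\<^sup>+\<omega>. evidence n U \<omega> * discount n k \<omega> \<partial>M)
    \<le> (\<integral>\<^sup>+G. (\<integral>\<^sup>+x. ennreal (mixture n G x * exp (- indicator (outer k) x)) \<partial>lborel) ^ n * indicator U G \<partial>D)"
    unfolding discount_def by (rule nn_integral_evidence[OF U]) auto
  also have "\<dots> \<le> (\<integral>\<^sup>+G. ennreal (exp (- (3/10) * real n * r)) \<partial>D)"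
  proof (rule nn_integral_mono)
    fix G assume G: "G \<in> space D"
    show "(\<integral>\<^sup>+x. ennreal (mixture n G x * exp (- indicator (outer k) x)) \<partial>lborel) ^ n * indicator U G
        \<le> ennreal (exp (- (3/10) * real n * r))"
    proof (cases "G \<in> U")
      case True
      define q where "q = mixture n G"
      have d: "q \<in> densities"
        unfolding q_def by (rule normal_mixture_density[OF _ bandwidth_pos[OF n]]) (use G space_D in simp)
      then have [measurable]: "q \<in> borel_measurable borel" by (simp add: densities_def)
      interpret Q: prob_space "prob_of (q)"
        using prob_of_in_prob_algebra[OF d] by (simp add: space_prob_algebra)
      let ?Q = "measure (prob_of (q)) (outer k)"
      let ?I = "\<integral>\<^sup>+x. ennreal (q x * exp (- indicator (outer k) x)) \<partial>lborel"
      have "exp (- 1) \<le> (2/5 :: real)"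
      proof -
        have "5/2 \<le> exp (1::real)" using exp_lower_Taylor_quadratic[of 1] by simp
        then have "inverse (exp 1) \<le> inverse (5/2 :: real)" by (intro le_imp_inverse_le) auto
        then show ?thesis by (simp add: exp_minus)
      qed
      have "?I + ennreal (3/5) * emeasure (prob_of (q)) (outer k)
          = (\<integral>\<^sup>+x. ennreal (q x * exp (- indicator (outer k) x)) + ennreal (3/5) * (indicator (outer k) x * ennreal (q x)) \<partial>lborel)"
        by (simp add: emeasure_prob_of[OF d] nn_integral_add nn_integral_cmult)
      also have "\<dots> \<le> (\<integral>\<^sup>+x. ennreal (q x) \<partial>lborel)"
      proof (rule nn_integral_mono)
        fix x
        have q: "0 \<le> q x" unfolding q_def by (rule normal_mixture_nonneg)
        have "q x * exp (- 1) + 3/5 * q x \<le> q x"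
          using mult_left_mono[OF \<open>exp (- 1) \<le> 2/5\<close> q] by simp
        then have "ennreal (q x * exp (- 1)) + ennreal (3/5) * ennreal (q x) \<le> ennreal (q x)"
          using q by (simp add: ennreal_mult'[symmetric] ennreal_plus[symmetric] ennreal_leI del: ennreal_plus)
        then show "ennreal (q x * exp (- indicator (outer k) x)) + ennreal (3/5) * (indicator (outer k) x * ennreal (q x)) \<le> ennreal (q x)"
          by (auto split: split_indicator)
      qed
      also have "\<dots> = 1" unfolding q_def by (rule nn_integral_mixture[OF n G])
      finally have "?I + ennreal (3/5) * ennreal ?Q \<le> 1"
        by (simp only: Q.emeasure_eq_measure)
      then have le: "?I + ennreal (3/5 * ?Q) \<le> 1"
        by (subst ennreal_mult) auto
      have "?I \<le> ?I + ennreal (3/5 * ?Q)" by simp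
      also note le
      finally have I: "?I = ennreal (enn2real ?I)"
        by (simp add: le_less_trans[OF _ ennreal_one_less_top])
      have "ennreal (enn2real ?I + 3/5 * ?Q) = ?I + ennreal (3/5 * ?Q)"
        by (subst I) (simp add: ennreal_plus)
      with le have "ennreal (enn2real ?I + 3/5 * ?Q) \<le> ennreal 1" by simp
      then have "enn2real ?I + 3/5 * ?Q \<le> 1" by (subst (asm) ennreal_le_iff) simp_all
      then have "enn2real ?I \<le> 1 + (- (3/5) * ?Q)" by simp
      also have "\<dots> \<le> exp (- (3/5) * ?Q)" by (rule exp_ge_add_one_self)
      also have "\<dots> \<le> exp (- (3/10) * r)" using r[OF True] by (simp add: q_def)
      finally have "?I \<le> ennreal (exp (- (3/10) * r))"
        by (subst I) (rule ennreal_leI)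
      then have "?I ^ n \<le> ennreal (exp (- (3/10) * r)) ^ n" by (rule power_mono) simp
      also have "\<dots> = ennreal (exp (- (3/10) * real n * r))"
        by (simp add: ennreal_power exp_of_nat_mult[symmetric] mult.left_commute mult.commute)
      finally show ?thesis using True by (simp add: q_def)
    qed simp
  qed
  also have "\<dots> = ennreal (exp (- (3/10) * real n * r))" by (simp add: D.emeasure_space_1)
  finally show ?thesis .
qed

definition decay :: real where "decay = 1 / (8 * s\<^sup>2)"

lemma decay_pos: "0 < decay" using s by (simp add: decay_def)

text \<open>Chosen so that the prior level \<open>exp (- decay / 2 * k\<^sup>2)\<close> at the
  cutoff is already at most \<open>exp (- 10 * rate n)\<close>; see
  \<open>cutoff_square\<close>.\<close>

definition cutoff :: "nat \<Rightarrow> nat" where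
  "cutoff n = nat \<lceil>sqrt (20 / decay) * real n powr (1/8)\<rceil>"

lemma cutoff_bounds:
  "sqrt (20 / decay) * real n powr (1/8) \<le> real (cutoff n)"
  "real (cutoff n) \<le> sqrt (20 / decay) * real n powr (1/8) + 1"
proof -
  have "0 \<le> sqrt (20 / decay) * real n powr (1/8)" using decay_pos by simp
  then show "sqrt (20 / decay) * real n powr (1/8) \<le> real (cutoff n)"
    "real (cutoff n) \<le> sqrt (20 / decay) * real n powr (1/8) + 1"
    unfolding cutoff_def by linarith+
qed

lemma cutoff_square: "10 * rate n \<le> decay / 2 * (real (cutoff n))\<^sup>2"
proof -
  have "(sqrt (20 / decay) * real n powr (1/8))\<^sup>2 \<le> (real (cutoff n))\<^sup>2"
    using cutoff_bounds(1) decay_pos by (intro power_mono) auto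
  moreover have "(sqrt (20 / decay) * real n powr (1/8))\<^sup>2 = 20 / decay * rate n"
  proof -
    have "(real n powr (1/8))\<^sup>2 = rate n"
      by (simp add: power2_eq_square powr_add[symmetric])
    then show ?thesis using decay_pos by (simp only: power_mult_distrib) simp
  qed
  ultimately have "decay / 2 * (20 / decay * rate n) \<le> decay / 2 * (real (cutoff n))\<^sup>2"
    using decay_pos by (intro mult_left_mono) auto
  then show ?thesis using decay_pos by simp
qed

text \<open>The constants 7 and 40 make \<open>3/10 * n * level n k\<close> exceed the exponent
  \<open>2 * n * tail_prob k + rate n\<close> of \<open>exceedance_bound\<close> by at least \<open>10 * rate n\<close>.\<close>

definition level :: "nat \<Rightarrow> nat \<Rightarrow> real" where
  "level n k = (if k \<le> cutoff n then 7 * tail_prob k + 40 * precision n else exp (- decay / 2 * (real k)\<^sup>2))"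

definition heavy :: "nat \<Rightarrow> nat \<Rightarrow> real measure set" where
  "heavy n k = {G\<in>space D. level n k < measure G (outer k)}"

lemma measure_outer_borel: "(\<lambda>G. measure G (outer k)) \<in> borel_measurable D"
  by (rule measurable_measure_dirichlet_process[OF DP]) simp

lemma heavy_sets [measurable]: "heavy n k \<in> sets D"
proof -
  note [measurable] = measure_outer_borel
  show ?thesis unfolding heavy_def by measurable
qed

definition far_heavy :: "nat \<Rightarrow> real measure set" where
  "far_heavy n = (\<Union>k. heavy n (cutoff n + 1 + k))"

lemma far_heavy_sets [measurable]: "far_heavy n \<in> sets D"
  unfolding far_heavy_def by measurable

text \<open>The mean outer mass under the prior is of order \<open>exp (- decay * k\<^sup>2)\<close>
  and the level is its square root, so Markov's inequality leaves another square root. Splitting the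
  square of \<open>cutoff n + 1 + k\<close> into the squares of \<open>cutoff n\<close> and
  \<open>k\<close>, the first part gives the rate and the second a convergent series.\<close>

lemma emeasure_far_heavy:
  "\<exists>C\<ge>0. \<forall>\<^sub>F n in sequentially. emeasure D (far_heavy n) \<le> ennreal (C * exp (- 10 * rate n))"
proof -
  let ?C1 = "2 * exp (\<mu>\<^sup>2 / (2 * s\<^sup>2))"
  define C2 where "C2 = 2 * (\<alpha> * ?C1) / (\<alpha> - 1)"
  have "0 \<le> C2" using \<alpha> by (simp add: C2_def)
  note bs = sets_base[OF refl s \<alpha>0] and mb = measure_base[OF refl s \<alpha>0] and mU = measure_base_UNIV[OF refl s \<alpha>0]
  have base_tail: "measure base (outer k) \<le> \<alpha> * ?C1 * exp (- decay * (real k)\<^sup>2)" for k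
    using normal_tail_bound[OF s, of "real k" \<mu>] \<alpha> mb[of "outer k"]
    by (simp add: decay_def mult.assoc)
  \<comment> \<open>The second condition on \<open>k\<close> leaves the complement a base mass of at
    least 1 + (\<alpha> - 1)/2, bounding the denominator in \<open>dirichlet_process_mean_le\<close>
    away from 0.\<close>
  have one: "emeasure D (heavy n k) \<le> ennreal (C2 * exp (- decay / 2 * (real k)\<^sup>2))"
    if k: "cutoff n < k" "\<alpha> * ?C1 * exp (- decay * (real k)\<^sup>2) \<le> (\<alpha> - 1) / 2" for n k
  proof -
    have small: "measure base (outer k) \<le> (\<alpha> - 1) / 2" using base_tail[of k] k(2) by linarith
    interpret A: finite_measure base by (rule finite_measure_base[OF refl s \<alpha>0])
    have sp: "space base = UNIV" using sets_eq_imp_space_eq[OF bs] by simp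
    have compl: "measure base (space base - outer k) = \<alpha> - measure base (outer k)"
      using A.finite_measure_compl[of "outer k"] bs mU sp by simp
    have b: "1 < measure base (space base - outer k)" using compl small \<alpha> by simp
    have "(\<integral>\<^sup>+G. ennreal (measure G (outer k)) \<partial>D) \<le> ennreal (measure base (outer k) / (measure base (space base - outer k) - 1))"
      by (rule dirichlet_process_mean_le[OF DP _ b]) (simp add: bs)
    also have "\<dots> \<le> ennreal (\<alpha> * ?C1 * exp (- decay * (real k)\<^sup>2) / ((\<alpha> - 1) / 2))"
      using small \<alpha> base_tail[of k] unfolding compl by (intro ennreal_leI frac_le) auto
    also have "\<alpha> * ?C1 * exp (- decay * (real k)\<^sup>2) / ((\<alpha> - 1) / 2) = C2 * exp (- decay * (real k)\<^sup>2)"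
      by (simp add: C2_def)
    finally have m: "(\<integral>\<^sup>+G. ennreal (measure G (outer k)) \<partial>D) \<le> ennreal (C2 * exp (- decay * (real k)\<^sup>2))" .
    have fm: "(\<lambda>G. ennreal (measure G (outer k))) \<in> borel_measurable D"
      using measure_outer_borel by simp
    have "emeasure D (heavy n k) \<le> emeasure D {G\<in>space D. ennreal (level n k) \<le> ennreal (measure G (outer k))}"
      using fm by (intro emeasure_mono) (auto simp: heavy_def intro!: ennreal_leI)
    also have "\<dots> = ennreal (D.prob {G\<in>space D. ennreal (exp (- decay / 2 * (real k)\<^sup>2)) \<le> ennreal (measure G (outer k))})"
      using k(1) by (simp add: D.emeasure_eq_measure level_def)
    also have "\<dots> \<le> ennreal (C2 * exp (- decay * (real k)\<^sup>2) / exp (- decay / 2 * (real k)\<^sup>2))"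
      by (intro ennreal_leI D.markov_nn_integral[OF fm m]) (use \<open>0 \<le> C2\<close> in auto)
    also have "C2 * exp (- decay * (real k)\<^sup>2) / exp (- decay / 2 * (real k)\<^sup>2) = C2 * exp (- decay / 2 * (real k)\<^sup>2)"
      by (simp add: exp_diff[symmetric] times_divide_eq_right[symmetric] del: times_divide_eq_right)
    finally show ?thesis .
  qed
  have summ: "summable (\<lambda>i. exp (- decay / 2 * (real i)\<^sup>2))"
  proof (rule summable_comparison_test_bigo)
    show "summable (\<lambda>n. norm (inverse (real n ^ 2)))"
      using inverse_power_summable[of 2, where 'a = real] by simp
    show "(\<lambda>i. exp (- decay / 2 * (real i)\<^sup>2)) \<in> O(\<lambda>n. inverse (real n ^ 2))"
      using decay_pos by real_asymp
  qed
  define \<Sigma> where "\<Sigma> = (\<Sum>i. exp (- decay / 2 * (real i)\<^sup>2))"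
  have "0 \<le> \<Sigma>" unfolding \<Sigma>_def by (rule suminf_nonneg[OF summ]) simp
  have "\<forall>\<^sub>F k in sequentially. \<alpha> * ?C1 * exp (- decay * (real k)\<^sup>2) \<le> (\<alpha> - 1) / 2"
  proof -
    have "((\<lambda>k::nat. \<alpha> * ?C1 * exp (- decay * (real k)\<^sup>2)) \<longlongrightarrow> 0) sequentially"
      using decay_pos by real_asymp
    moreover have "0 < (\<alpha> - 1) / 2" using \<alpha> by simp
    ultimately show ?thesis by (rule order_tendstoD(2)[THEN eventually_mono]) simp
  qed
  then obtain k0 where k0: "\<And>k. k0 \<le> k \<Longrightarrow> \<alpha> * ?C1 * exp (- decay * (real k)\<^sup>2) \<le> (\<alpha> - 1) / 2"
    unfolding eventually_sequentially by blast
  have cut: "\<forall>\<^sub>F n in sequentially. real k0 \<le> sqrt (20 / decay) * real n powr (1/8)"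
  proof -
    have "0 < sqrt (20 / decay)" using decay_pos by simp
    then show ?thesis by real_asymp
  qed
  have "\<forall>\<^sub>F n in sequentially. emeasure D (far_heavy n) \<le> ennreal (C2 * \<Sigma> * exp (- 10 * rate n))"
    using cut
  proof eventually_elim
    case (elim n)
    then have k0n: "k0 \<le> cutoff n" using cutoff_bounds(1)[of n] by linarith
    have "emeasure D (far_heavy n) \<le> (\<Sum>k. emeasure D (heavy n (cutoff n + 1 + k)))"
      unfolding far_heavy_def by (rule emeasure_subadditive_countably) auto
    also have "\<dots> \<le> (\<Sum>k. ennreal (C2 * exp (- 10 * rate n) * exp (- decay / 2 * (real k)\<^sup>2)))"
    proof (rule suminf_le)
      fix k
      have "(real (cutoff n))\<^sup>2 + (real k)\<^sup>2 \<le> (real (cutoff n + 1 + k))\<^sup>2"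
        by (simp add: power2_eq_square algebra_simps)
      then have "decay / 2 * ((real (cutoff n))\<^sup>2 + (real k)\<^sup>2) \<le> decay / 2 * (real (cutoff n + 1 + k))\<^sup>2"
        using decay_pos by (intro mult_left_mono) auto
      then have "- decay / 2 * (real (cutoff n + 1 + k))\<^sup>2 \<le> - 10 * rate n + - decay / 2 * (real k)\<^sup>2"
        using cutoff_square[of n] by (simp add: distrib_left)
      then have e: "exp (- decay / 2 * (real (cutoff n + 1 + k))\<^sup>2) \<le> exp (- 10 * rate n) * exp (- decay / 2 * (real k)\<^sup>2)"
        by (simp only: exp_add[symmetric] exp_le_cancel_iff)
      have "emeasure D (heavy n (cutoff n + 1 + k)) \<le> ennreal (C2 * exp (- decay / 2 * (real (cutoff n + 1 + k))\<^sup>2))"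
        by (rule one) (use k0[of "cutoff n + 1 + k"] k0n in auto)
      also have "\<dots> \<le> ennreal (C2 * exp (- 10 * rate n) * exp (- decay / 2 * (real k)\<^sup>2))"
        using mult_left_mono[OF e \<open>0 \<le> C2\<close>] by (intro ennreal_leI) (simp only: mult.assoc)
      finally show "emeasure D (heavy n (cutoff n + 1 + k)) \<le> \<dots>" .
    qed auto
    also have "\<dots> = ennreal (\<Sum>k. C2 * exp (- 10 * rate n) * exp (- decay / 2 * (real k)\<^sup>2))"
      by (rule suminf_ennreal2) (use \<open>0 \<le> C2\<close> summ in \<open>auto intro!: summable_mult\<close>)
    also have "(\<Sum>k. C2 * exp (- 10 * rate n) * exp (- decay / 2 * (real k)\<^sup>2)) = C2 * exp (- 10 * rate n) * \<Sigma>"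
      unfolding \<Sigma>_def by (rule suminf_mult[OF summ])
    finally show ?case by (simp only: ac_simps)
  qed
  then show ?thesis using \<open>0 \<le> C2\<close> \<open>0 \<le> \<Sigma>\<close> by (intro exI[of _ "C2 * \<Sigma>"]) auto
qed

end

section \<open>Posterior negligibility of heavy tails, and the conclusion\<close>

context dpm_posterior
begin

definition all_heavy :: "nat \<Rightarrow> real measure set" where
  "all_heavy n = (\<Union>k\<in>{1..cutoff n}. heavy n k) \<union> far_heavy n"

lemma all_heavy_sets [measurable]: "all_heavy n \<in> sets D"
  unfolding all_heavy_def by measurable

lemma heavy_subset_all_heavy: "heavy n (Suc k) \<subseteq> all_heavy n"
proof (cases "Suc k \<le> cutoff n")
  case True
  then show ?thesis unfolding all_heavy_def by (intro le_supI1 UN_upper) simp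
next
  case False
  then have "Suc k = cutoff n + 1 + (Suc k - (cutoff n + 1))" by simp
  then show ?thesis unfolding all_heavy_def far_heavy_def by (metis UN_upper UNIV_I le_supI2)
qed

text \<open>\<open>exceedance\<close> and \<open>discount\<close> multiply to 1, so unless the data
  show many exceedances the discount can be undone at the price \<open>c\<close>.\<close>

lemma evidence_heavy_le:
  assumes "exceedance n k \<omega> < ennreal c"
  shows "evidence n U \<omega> \<le> ennreal c * (evidence n U \<omega> * discount n k \<omega>)"
proof -
  let ?t = "discount n k \<omega>"
  have "exceedance n k \<omega> * ?t = (\<Prod>i=1..n. ennreal (exp (indicator (outer k) (X i \<omega>))) * ennreal (exp (- indicator (outer k) (X i \<omega>))))"
    unfolding exceedance_def discount_def by (rule prod.distrib[symmetric])
  also have "\<dots> = (\<Prod>i=1..n. 1)"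
    by (intro prod.cong refl) (simp add: ennreal_mult'[symmetric] exp_add[symmetric])
  finally have "1 = exceedance n k \<omega> * ?t" by simp
  also have "\<dots> \<le> ennreal c * ?t" using assms by (intro mult_right_mono) auto
  finally have "evidence n U \<omega> * 1 \<le> evidence n U \<omega> * (ennreal c * ?t)" by (rule mult_left_mono) simp
  then show ?thesis by (simp only: mult_1_right mult.left_commute)
qed

lemma nn_integral_heavy_test:
  assumes n: "n \<ge> 1" and k: "k \<le> cutoff n"
  shows "(\<integral>\<^sup>+\<omega>. ennreal (exp (2 * real n * tail_prob k + rate n)) *
      (evidence n (heavy n k) \<omega> * discount n k \<omega>) \<partial>M)
    \<le> ennreal (exp (- 10 * rate n))"
proof -
  have t0: "0 \<le> tail_prob k" by (simp add: tail_prob_def)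
  have r: "level n k / 2 \<le> measure (prob_of (mixture n G)) (outer k)" if "G \<in> heavy n k" for G
    using mixture_tail_ge[of G "bandwidth n" "real k"] that n by (auto simp: heavy_def space_D)
  have "(\<integral>\<^sup>+\<omega>. ennreal (exp (2 * real n * tail_prob k + rate n)) *
      (evidence n (heavy n k) \<omega> * discount n k \<omega>) \<partial>M)
    = ennreal (exp (2 * real n * tail_prob k + rate n)) *
      (\<integral>\<^sup>+\<omega>. evidence n (heavy n k) \<omega> * discount n k \<omega> \<partial>M)"
    by (rule nn_integral_cmult) measurable
  also have "\<dots> \<le> ennreal (exp (2 * real n * tail_prob k + rate n)) * ennreal (exp (- (3/10) * real n * level n k))"
    by (intro mult_left_mono nn_integral_test heavy_sets n r) simp_all
  also have "\<dots> = ennreal (exp (2 * real n * tail_prob k + rate n + - (3/10) * real n * level n k))"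
    by (simp only: ennreal_mult[symmetric] exp_ge_zero exp_add[symmetric])
  also have "\<dots> \<le> ennreal (exp (- 10 * rate n))"
  proof -
    have 1: "real n * precision n = rate n" using n by (simp add: powr_mult_base)
    have "(3/10) * real n * level n k = (21/10) * (real n * tail_prob k) + 12 * (real n * precision n)"
      using k by (simp add: level_def algebra_simps)
    then have "(3/10) * real n * level n k = (21/10) * (real n * tail_prob k) + 12 * rate n"
      unfolding 1 .
    moreover have "0 \<le> real n * tail_prob k" using t0 by simp
    moreover have "0 \<le> rate n" by simp
    ultimately have "2 * (real n * tail_prob k) + rate n - (3/10) * real n * level n k \<le> - 10 * rate n"
      by linarith
    then show ?thesis by (intro ennreal_leI) (simp add: mult.assoc)
  qed
  finally show ?thesis .
qed

text \<open>There are only of the order of n^{1/8} tests, and each sees too many exceedances with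
  probability at most \<open>exp (- (rate n))\<close>. Otherwise the heavy evidence is dominated by
  a variable of mean of order n^{1/8} \<open>exp (- 10 * rate n)\<close>; Markov's inequality at
  level \<open>\<epsilon> * exp (- 8 * rate n)\<close> leaves a factor
  \<open>exp (- 2 * rate n)\<close>.\<close>

lemma evidence_all_heavy_tendsto:
  assumes \<epsilon>: "0 < \<epsilon>"
  shows "(\<lambda>n. prob {\<omega>\<in>space M. ennreal (\<epsilon> * exp (- 8 * rate n)) \<le> evidence n (all_heavy n) \<omega>}) \<longlonglongrightarrow> 0"
proof -
  obtain C where C: "0 \<le> C" "\<forall>\<^sub>F n in sequentially. emeasure D (far_heavy n) \<le> ennreal (C * exp (- 10 * rate n))"
    using emeasure_far_heavy by blast
  let ?v = "sqrt (20 / decay)"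
  let ?T = "\<lambda>n. ?v * real n powr (1/8) + 1"
  let ?g = "\<lambda>n. ?T n * exp (- (rate n)) + (?T n + C) * exp (- 10 * rate n) / (\<epsilon> * exp (- 8 * rate n))"
  have "\<forall>\<^sub>F n in sequentially. prob {\<omega>\<in>space M. ennreal (\<epsilon> * exp (- 8 * rate n)) \<le> evidence n (all_heavy n) \<omega>} \<le> ?g n"
    using C(2) eventually_ge_at_top[of 1]
  proof eventually_elim
    case (elim n)
    note n = elim(2)
    let ?c = "\<lambda>k. exp (2 * real n * tail_prob k + rate n)"
    define test where "test k \<omega> = ennreal (?c k) * (evidence n (heavy n k) \<omega> * discount n k \<omega>)" for k \<omega>
    \<comment> \<open>The dominating variable: below the cutoff the discounted evidence with the
      price of undoing the discount, beyond it the evidence itself.\<close>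
    define R where "R \<omega> = (\<Sum>k\<in>{1..cutoff n}. test k \<omega>) + evidence n (far_heavy n) \<omega>" for \<omega>
    let ?E = "\<lambda>k. {\<omega>\<in>space M. ennreal (?c k) \<le> exceedance n k \<omega>}"
    let ?B = "{\<omega>\<in>space M. ennreal (\<epsilon> * exp (- 8 * rate n)) \<le> R \<omega>}"
    have test[measurable]: "test k \<in> borel_measurable M" for k
      unfolding test_def by measurable
    have R[measurable]: "R \<in> borel_measurable M" unfolding R_def by measurable
    have "(\<integral>\<^sup>+\<omega>. R \<omega> \<partial>M) = (\<Sum>k\<in>{1..cutoff n}. \<integral>\<^sup>+\<omega>. test k \<omega> \<partial>M) + (\<integral>\<^sup>+\<omega>. evidence n (far_heavy n) \<omega> \<partial>M)"
      unfolding R_def by (simp add: nn_integral_add nn_integral_sum)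
    also have "\<dots> \<le> (\<Sum>k\<in>{1..cutoff n}. ennreal (exp (- 10 * rate n))) + ennreal (C * exp (- 10 * rate n))"
    proof (intro add_mono sum_mono)
      show "(\<integral>\<^sup>+\<omega>. test k \<omega> \<partial>M) \<le> ennreal (exp (- 10 * rate n))" if "k \<in> {1..cutoff n}" for k
        unfolding test_def by (rule nn_integral_heavy_test[OF n]) (use that in simp)
      show "(\<integral>\<^sup>+\<omega>. evidence n (far_heavy n) \<omega> \<partial>M) \<le> ennreal (C * exp (- 10 * rate n))"
        by (rule order_trans[OF nn_integral_evidence_le_emeasure[OF _ n] elim(1)]) measurable
    qed
    also have "\<dots> = ennreal ((real (cutoff n) + C) * exp (- 10 * rate n))"
      using C(1) by (simp add: ennreal_mult'[symmetric] ennreal_of_nat_eq_real_of_nat distrib_right)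
    also have "\<dots> \<le> ennreal ((?T n + C) * exp (- 10 * rate n))"
      using cutoff_bounds(2)[of n] by (intro ennreal_leI mult_right_mono) auto
    finally have RE: "(\<integral>\<^sup>+\<omega>. R \<omega> \<partial>M) \<le> ennreal ((?T n + C) * exp (- 10 * rate n))" .
    have "{\<omega>\<in>space M. ennreal (\<epsilon> * exp (- 8 * rate n)) \<le> evidence n (all_heavy n) \<omega>} \<subseteq> (\<Union>k\<in>{1..cutoff n}. ?E k) \<union> ?B"
    proof (rule subsetI, rule ccontr)
      fix \<omega> assume 1: "\<omega> \<in> {\<omega>\<in>space M. ennreal (\<epsilon> * exp (- 8 * rate n)) \<le> evidence n (all_heavy n) \<omega>}"
        and 2: "\<omega> \<notin> (\<Union>k\<in>{1..cutoff n}. ?E k) \<union> ?B"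
      then have \<omega>: "\<omega> \<in> space M" by simp
      have "evidence n (all_heavy n) \<omega> \<le> (\<integral>\<^sup>+G. (\<Sum>k\<in>{1..cutoff n}. ratio n \<omega> G * indicator (heavy n k) G)
          + ratio n \<omega> G * indicator (far_heavy n) G \<partial>D)"
        unfolding evidence_def
      proof (rule nn_integral_mono)
        fix G
        show "ratio n \<omega> G * indicator (all_heavy n) G \<le> (\<Sum>k\<in>{1..cutoff n}. ratio n \<omega> G * indicator (heavy n k) G)
          + ratio n \<omega> G * indicator (far_heavy n) G"
        proof (cases "\<exists>k\<in>{1..cutoff n}. G \<in> heavy n k")
          case True
          then obtain k where k: "k \<in> {1..cutoff n}" "G \<in> heavy n k" by blast
          have "ratio n \<omega> G * indicator (all_heavy n) G \<le> ratio n \<omega> G * indicator (heavy n k) G"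
            using k by (intro mult_left_mono) (auto split: split_indicator)
          also have "\<dots> \<le> (\<Sum>k\<in>{1..cutoff n}. ratio n \<omega> G * indicator (heavy n k) G)"
            using k by (intro member_le_sum) auto
          finally show ?thesis by (simp add: add_increasing2)
        next
          case False
          then have "G \<in> all_heavy n \<longleftrightarrow> G \<in> far_heavy n" by (auto simp: all_heavy_def)
          then have "indicator (all_heavy n) G = (indicator (far_heavy n) G :: ennreal)"
            by (simp only: indicator_def)
          then show ?thesis by (simp only: add_increasing order_refl zero_le)
        qed
      qed
      also have "\<dots> = (\<Sum>k\<in>{1..cutoff n}. evidence n (heavy n k) \<omega>) + evidence n (far_heavy n) \<omega>"
      proof -
        note [measurable] = ratio_borel[OF \<omega>]
        have 3: "(\<integral>\<^sup>+G. (\<Sum>k\<in>{1..cutoff n}. ratio n \<omega> G * indicator (heavy n k) G) \<partial>D)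
            = (\<Sum>k\<in>{1..cutoff n}. \<integral>\<^sup>+G. ratio n \<omega> G * indicator (heavy n k) G \<partial>D)"
          by (rule nn_integral_sum) measurable
        show ?thesis
          unfolding evidence_def 3[symmetric] by (rule nn_integral_add) measurable
      qed
      also have "\<dots> \<le> R \<omega>"
        unfolding R_def
      proof (intro add_right_mono sum_mono)
        fix k assume "k \<in> {1..cutoff n}"
        then have "exceedance n k \<omega> < ennreal (?c k)" using 2 \<omega> by (auto simp: not_le)
        then show "evidence n (heavy n k) \<omega> \<le> test k \<omega>" unfolding test_def by (rule evidence_heavy_le)
      qed
      finally show False using 1 2 \<omega> by (auto dest: order_trans)
    qed
    then have "prob {\<omega>\<in>space M. ennreal (\<epsilon> * exp (- 8 * rate n)) \<le> evidence n (all_heavy n) \<omega>}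
        \<le> prob ((\<Union>k\<in>{1..cutoff n}. ?E k) \<union> ?B)"
      by (rule finite_measure_mono) measurable
    also have "\<dots> \<le> prob (\<Union>k\<in>{1..cutoff n}. ?E k) + prob ?B"
      by (rule measure_Un_le) measurable
    also have "\<dots> \<le> (\<Sum>k\<in>{1..cutoff n}. prob (?E k)) + prob ?B"
      by (intro add_right_mono finite_measure_subadditive_finite) auto
    also have "\<dots> \<le> (\<Sum>k\<in>{1..cutoff n}. exp (- (rate n))) + (?T n + C) * exp (- 10 * rate n) / (\<epsilon> * exp (- 8 * rate n))"
      using \<epsilon> C(1) decay_pos by (intro add_mono sum_mono exceedance_bound markov_nn_integral[OF R RE]) auto
    also have "(\<Sum>k\<in>{1..cutoff n}. exp (- (rate n))) \<le> ?T n * exp (- (rate n))"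
      using cutoff_bounds(2)[of n] by (simp add: mult_right_mono)
    finally show ?case by simp
  qed
  moreover have "?g \<longlonglongrightarrow> 0"
  proof -
    have "0 < ?v" using decay_pos by simp
    then show ?thesis using \<epsilon> by real_asymp
  qed
  ultimately show ?thesis by (rule prob_tendsto_zeroI)
qed

text \<open>Outside \<open>all_heavy\<close> every outer mass is at most its level. The weighted
  levels split into \<open>b\<close>, which is summable and free of n, and \<open>d\<close>, which
  has \<open>cutoff n\<close> terms and total of order n^{1/8 + 4/8 - 3/4}, eventually at most 1.
  The 6 in the final constant is 1 from the tail sum, 1 from \<open>d\<close> and 4 from the
  smoothing.\<close>

lemma moment_bound:
  assumes p: "1 \<le> p" "p < 4"
  shows "\<exists>K. \<forall>\<^sub>F n in sequentially. \<forall>G\<in>space D - all_heavy n. abs_moment p (prob_of (mixture n G)) \<le> ennreal K"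
proof -
  obtain C c where C: "0 < C" "0 < c" "\<And>t. 0 < t \<Longrightarrow> measure (prob_of p0) {x. t < \<bar>x\<bar>} \<le> C * exp (- c * t\<^sup>2)"
    using tail by (auto simp: sub_gaussian_tail_def)
  \<comment> \<open>Adding both regimes of \<open>level\<close> avoids a case split at the cutoff,
    which depends on n.\<close>
  define b where "b k = (real k + 2) ^ 4 * (7 * C * exp (- c * (real k + 1)\<^sup>2) + exp (- decay / 2 * (real k + 1)\<^sup>2))" for k :: nat
  have b0: "0 \<le> b k" for k using C(1) by (simp add: b_def)
  have bs: "summable b"
  proof (rule summable_comparison_test_bigo)
    show "summable (\<lambda>n. norm (inverse (real n ^ 2)))"
      using inverse_power_summable[of 2, where 'a = real] by simp
    have "(\<lambda>k. (real k + 2) ^ 4 * (7 * C * exp (- c * (real k + 1)\<^sup>2))) \<in> O(\<lambda>n. inverse (real n ^ 2))"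
      using C(1,2) by real_asymp
    moreover have "(\<lambda>k. (real k + 2) ^ 4 * exp (- decay / 2 * (real k + 1)\<^sup>2)) \<in> O(\<lambda>n. inverse (real n ^ 2))"
      using decay_pos by real_asymp
    ultimately show "b \<in> O(\<lambda>n. inverse (real n ^ 2))"
      unfolding b_def distrib_left by (rule sum_in_bigo)
  qed
  let ?v = "sqrt (20 / decay)"
  have "\<forall>\<^sub>F n in sequentially. (?v * real n powr (1/8) + 1) * ((?v * real n powr (1/8) + 1 + 1) ^ 4 * (40 * precision n)) \<le> 1"
  proof -
    have "0 < ?v" using decay_pos by simp
    then show ?thesis by real_asymp
  qed
  then have "\<forall>\<^sub>F n in sequentially. \<forall>G\<in>space D - all_heavy n. abs_moment p (prob_of (mixture n G)) \<le> ennreal (2 powr p * (6 + suminf b))"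
    using eventually_ge_at_top[of 1]
  proof eventually_elim
    case (elim n)
    note n = elim(2)
    define d where "d k = (if Suc k \<le> cutoff n then (real k + 2) ^ 4 * (40 * precision n) else 0)" for k
    have d0: "0 \<le> d k" for k by (simp add: d_def)
    have dfin: "d k = 0" if "k \<notin> {..<cutoff n}" for k using that by (simp add: d_def)
    have ds: "summable d" by (rule summable_finite[of "{..<cutoff n}"]) (use dfin in auto)
    have "suminf d = (\<Sum>k<cutoff n. d k)" by (rule suminf_finite) (use dfin in auto)
    also have "\<dots> \<le> (\<Sum>k<cutoff n. (real (cutoff n) + 1) ^ 4 * (40 * precision n))"
      by (intro sum_mono) (auto simp: d_def intro!: mult_right_mono power_mono)
    also have "\<dots> = real (cutoff n) * ((real (cutoff n) + 1) ^ 4 * (40 * precision n))" by simp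
    also have "\<dots> \<le> (?v * real n powr (1/8) + 1) * ((?v * real n powr (1/8) + 1 + 1) ^ 4 * (40 * precision n))"
      using cutoff_bounds(2)[of n] by (intro mult_mono mult_right_mono power_mono) auto
    finally have dsum: "suminf d \<le> 1" using elim(1) by linarith
    have "abs_moment p (prob_of (mixture n G)) \<le> ennreal (2 powr p * (6 + suminf b))"
      if G: "G \<in> space D - all_heavy n" for G
    proof -
      have GP: "G \<in> space (prob_algebra borel)" using G space_D by simp
      have lev: "real (k + 2) powr p * measure G (outer (Suc k)) \<le> b k + d k" for k
      proof -
        have "measure G (outer (Suc k)) \<le> level n (Suc k)"
          using G heavy_subset_all_heavy[of n k] by (force simp: heavy_def)
        also have "\<dots> \<le> (7 * C * exp (- c * (real k + 1)\<^sup>2) + exp (- decay / 2 * (real k + 1)\<^sup>2)) + (if Suc k \<le> cutoff n then 40 * precision n else 0)"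
        proof -
          define A E where "A = C * exp (- c * (real k + 1)\<^sup>2)" and "E = exp (- decay / 2 * (real k + 1)\<^sup>2)"
          have "tail_prob (Suc k) \<le> A"
            using C(3)[of "real (Suc k)"] by (simp add: tail_prob_def A_def add.commute)
          moreover have "0 \<le> A" "0 \<le> E" using C(1) by (simp_all add: A_def E_def)
          moreover have "exp (- decay / 2 * (real (Suc k))\<^sup>2) = E" by (simp add: E_def add.commute)
          ultimately have "level n (Suc k) \<le> (7 * A + E) + (if Suc k \<le> cutoff n then 40 * precision n else 0)"
            unfolding level_def by (cases "Suc k \<le> cutoff n") simp_all
          then show ?thesis by (simp only: A_def E_def mult.assoc)
        qed
        finally have m: "measure G (outer (Suc k)) \<le> \<dots>" .
        have "real (k + 2) powr p \<le> real (k + 2) powr 4" using p by (intro powr_mono) auto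
        also have "\<dots> = (real k + 2) ^ 4" by (simp add: powr_numeral add.commute)
        finally have "real (k + 2) powr p * measure G (outer (Suc k)) \<le> (real k + 2) ^ 4 *
          ((7 * C * exp (- c * (real k + 1)\<^sup>2) + exp (- decay / 2 * (real k + 1)\<^sup>2)) + (if Suc k \<le> cutoff n then 40 * precision n else 0))"
          using m by (intro mult_mono) auto
        also have "\<dots> = b k + d k" by (simp add: b_def d_def distrib_left)
        finally show ?thesis .
      qed
      have "(\<Sum>k. ennreal (real (k + 2) powr p * measure G (outer (Suc k)))) \<le> (\<Sum>k. ennreal (b k + d k))"
        by (intro suminf_le ennreal_leI lev) auto
      also have "\<dots> = ennreal (\<Sum>k. b k + d k)"
        by (rule suminf_ennreal2) (use b0 d0 bs ds in \<open>auto intro: summable_add\<close>)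
      also have "(\<Sum>k. b k + d k) = suminf b + suminf d" by (rule suminf_add[OF bs ds, symmetric])
      also have "ennreal (suminf b + suminf d) \<le> ennreal (suminf b + 1)" using dsum by (intro ennreal_leI) simp
      finally have tail_sum: "(\<Sum>k. ennreal (real (k + 2) powr p * measure G (outer (Suc k)))) \<le> ennreal (suminf b + 1)" .
      have sb: "0 \<le> suminf b" by (rule suminf_nonneg[OF bs b0])
      have "abs_moment p G \<le> 1 + ennreal (suminf b + 1)"
        using abs_moment_le_tail_sum[OF GP p(1)] tail_sum by (meson add_left_mono order_trans)
      then have "abs_moment p G + 4 \<le> (1 + ennreal (suminf b + 1)) + 4" by (rule add_right_mono)
      also have "\<dots> = ennreal (6 + suminf b)"
        using sb by (simp add: add.commute add.left_commute)
      finally have "ennreal (2 powr p) * (abs_moment p G + 4) \<le> ennreal (2 powr p) * ennreal (6 + suminf b)"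
        by (rule mult_left_mono) simp
      moreover have "abs_moment p (prob_of (mixture n G)) \<le> ennreal (2 powr p) * (abs_moment p G + 4)"
      proof (rule abs_moment_mixture_le[OF GP _ _ p])
        show "0 < bandwidth n" using n by simp
        have "bandwidth n \<le> real n powr 0" using n by (intro powr_mono) auto
        then show "bandwidth n \<le> 1" using n by simp
      qed
      ultimately have "abs_moment p (prob_of (mixture n G)) \<le> ennreal (2 powr p) * ennreal (6 + suminf b)" by (rule order_trans[rotated])
      then show ?thesis using sb by (simp only: ennreal_mult[symmetric] powr_ge_zero add_nonneg_nonneg zero_le_numeral)
    qed
    then show ?case by blast
  qed
  then show ?thesis by blast
qed

text \<open>Mixtures outside \<open>B\<close> stem from heavy mixing measures, so the posterior
  misses 1 by at most the heavy share of the evidence, which is at most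
  \<open>\<epsilon> * x\<close> divided by \<open>x\<close>.\<close>

lemma posterior_deviation:
  assumes n: "n \<ge> 1" and B: "B \<in> sets density_space" and \<omega>: "\<omega> \<in> space M"
    and cover: "\<And>G. G \<in> space D - all_heavy n \<Longrightarrow> mixture n G \<in> B"
    and fin: "evidence n (space D) \<omega> < \<infinity>"
    and low: "ennreal x \<le> evidence n (space D) \<omega>" and x: "0 < x"
    and up: "evidence n (all_heavy n) \<omega> \<le> ennreal (\<epsilon> * x)" and \<epsilon>: "0 < \<epsilon>"
  shows "\<bar>posterior (normal_mixture_prior D (bandwidth n)) p0 n (\<lambda>i. X i \<omega>) B - 1\<bar> \<le> \<epsilon>"
proof -
  let ?A = "{G\<in>space D. mixture n G \<in> B}"
  have m: "mixture n \<in> D \<rightarrow>\<^sub>M density_space"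
    unfolding measurable_cong_sets[OF sets_D refl] by (rule measurable_normal_mixture[OF bandwidth_pos[OF n]])
  have A: "?A \<in> sets D"
    using measurable_sets[OF m B] by (simp add: vimage_def Collect_conj_eq Int_commute)
  note [measurable] = ratio_borel[OF \<omega>] A
  have le: "evidence n ?A \<omega> \<le> evidence n (space D) \<omega>"
    unfolding evidence_def by (intro nn_integral_mono mult_left_mono) (auto split: split_indicator)
  have "evidence n (space D) \<omega> \<le> (\<integral>\<^sup>+G. ratio n \<omega> G * indicator ?A G + ratio n \<omega> G * indicator (all_heavy n) G \<partial>D)"
    unfolding evidence_def using cover by (intro nn_integral_mono) (auto split: split_indicator)
  also have "\<dots> = evidence n ?A \<omega> + evidence n (all_heavy n) \<omega>"
    unfolding evidence_def by (rule nn_integral_add) measurable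
  finally have sum: "evidence n (space D) \<omega> \<le> evidence n ?A \<omega> + evidence n (all_heavy n) \<omega>" .
  obtain e where e: "evidence n (space D) \<omega> = ennreal e" "0 \<le> e"
    using fin by (cases "evidence n (space D) \<omega>") auto
  have "evidence n ?A \<omega> < \<infinity>" using le fin by (rule le_less_trans)
  then obtain a where a: "evidence n ?A \<omega> = ennreal a" "0 \<le> a"
    by (cases "evidence n ?A \<omega>") auto
  have "x \<le> e" using low e by (simp add: ennreal_le_iff)
  have "a \<le> e" using le e a by (simp add: ennreal_le_iff)
  have "ennreal e \<le> ennreal a + ennreal (\<epsilon> * x)"
    using sum up unfolding e(1) a(1) by (meson add_left_mono order_trans)
  also have "\<dots> = ennreal (a + \<epsilon> * x)" using a(2) x \<epsilon> by (simp add: ennreal_plus)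
  finally have "e \<le> a + \<epsilon> * x" using a(2) x \<epsilon> by (subst (asm) ennreal_le_iff) auto
  also have "\<dots> \<le> a + \<epsilon> * e" using \<open>x \<le> e\<close> \<epsilon> by simp
  finally have "1 - \<epsilon> \<le> a / e" "a / e \<le> 1"
    using \<open>x \<le> e\<close> x \<open>a \<le> e\<close> by (auto simp: field_simps)
  then have "\<bar>a / e - 1\<bar> \<le> \<epsilon>" by linarith
  then show ?thesis
    unfolding posterior_eq[OF n B \<omega>] e(1) a(1) using \<open>x \<le> e\<close> x a(2) by (simp add: divide_ennreal)
qed

text \<open>A deviation forces one of three events of vanishing probability: an observation outside
  the window, too little evidence, or too much heavy evidence.\<close>

lemma posterior_tendsto:
  assumes B: "B \<in> sets density_space"
    and cover: "\<forall>\<^sub>F n in sequentially. \<forall>G\<in>space D - all_heavy n. mixture n G \<in> B"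
  shows "converges_in_probability M
    (\<lambda>n \<omega>. posterior (normal_mixture_prior D (bandwidth n)) p0 n (\<lambda>i. X i \<omega>) B) 1"
  unfolding converges_in_probability_def
proof (intro conjI allI impI)
  show "(\<lambda>\<omega>. posterior (normal_mixture_prior D (bandwidth n)) p0 n (\<lambda>i. X i \<omega>) B) \<in> borel_measurable M" for n
    by (rule borel_measurable_posterior[OF B])
  fix \<epsilon> :: real assume \<epsilon>: "0 < \<epsilon>"
  let ?Y = "\<lambda>n \<omega>. posterior (normal_mixture_prior D (bandwidth n)) p0 n (\<lambda>i. X i \<omega>) B"
  let ?T = "\<lambda>n. {\<omega>\<in>space M. \<exists>i\<in>{1..n}. radius n < \<bar>X i \<omega>\<bar>}"
  let ?H = "\<lambda>n. {\<omega>\<in>space M. ennreal (\<epsilon> * exp (- 8 * rate n)) \<le> evidence n (all_heavy n) \<omega>}"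
  have "\<forall>\<^sub>F n in sequentially. prob {\<omega>\<in>space M. \<epsilon> < \<bar>?Y n \<omega> - 1\<bar>} \<le> prob (?T n) + prob (bad_evidence n) + prob (?H n)"
    using cover eventually_ge_at_top[of 1]
  proof eventually_elim
    case (elim n)
    note n = elim(2)
    have T: "?T n \<in> sets M"
    proof (rule sets.sets_Collect_finite_Ex)
      fix i assume "i \<in> {1..n}"
      then have [measurable]: "X i \<in> borel_measurable M" by (intro X_borel) simp
      show "{\<omega>\<in>space M. radius n < \<bar>X i \<omega>\<bar>} \<in> sets M" by measurable
    qed simp
    have H: "?H n \<in> sets M" by measurable
    \<comment> \<open>The inclusion holds only almost surely: finite evidence and positivity of
      \<open>p0\<close> at the data are almost sure facts.\<close>
    have "AE \<omega> in M. \<omega> \<in> {\<omega>\<in>space M. \<epsilon> < \<bar>?Y n \<omega> - 1\<bar>} \<longrightarrow> \<omega> \<in> (?T n \<union> bad_evidence n) \<union> ?H n"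
      using AE_evidence_finite[OF n] AE_p0_pos[of n]
    proof eventually_elim
      case (elim \<omega>)
      show ?case
      proof (rule impI, rule ccontr)
        assume 1: "\<omega> \<in> {\<omega>\<in>space M. \<epsilon> < \<bar>?Y n \<omega> - 1\<bar>}" and 2: "\<omega> \<notin> (?T n \<union> bad_evidence n) \<union> ?H n"
        then have \<omega>: "\<omega> \<in> space M" by simp
        have "\<forall>i\<in>{1..n}. \<bar>X i \<omega>\<bar> \<le> radius n" using 2 \<omega> by (auto simp: not_less)
        then have "ennreal (exp (- 8 * rate n)) \<le> evidence n (space D) \<omega>"
          using 2 \<omega> elim(2) by (auto simp: bad_evidence_def not_less)
        moreover have "evidence n (all_heavy n) \<omega> \<le> ennreal (\<epsilon> * exp (- 8 * rate n))"
          using 2 \<omega> by (auto simp: not_le)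
        ultimately have "\<bar>?Y n \<omega> - 1\<bar> \<le> \<epsilon>"
          using \<open>\<forall>G\<in>space D - all_heavy n. mixture n G \<in> B\<close> elim(1)
          by (intro posterior_deviation[OF n B \<omega> _ _ _ exp_gt_zero _ \<epsilon>]) auto
        with 1 show False by simp
      qed
    qed
    then have "prob {\<omega>\<in>space M. \<epsilon> < \<bar>?Y n \<omega> - 1\<bar>} \<le> prob ((?T n \<union> bad_evidence n) \<union> ?H n)"
      by (rule finite_measure_mono_AE) (intro sets.Un T H bad_evidence_sets)
    also have "\<dots> \<le> prob (?T n \<union> bad_evidence n) + prob (?H n)"
      by (intro measure_Un_le sets.Un T H bad_evidence_sets)
    also have "prob (?T n \<union> bad_evidence n) \<le> prob (?T n) + prob (bad_evidence n)"
      by (intro measure_Un_le T bad_evidence_sets)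
    finally show ?case by simp
  qed
  moreover have "(\<lambda>n. prob (?T n) + prob (bad_evidence n) + prob (?H n)) \<longlonglongrightarrow> 0 + 0 + 0"
    by (intro tendsto_add truncation_tendsto bad_evidence_tendsto evidence_all_heavy_tendsto \<epsilon>)
  ultimately show "(\<lambda>n. prob {\<omega>\<in>space M. \<epsilon> < \<bar>?Y n \<omega> - 1\<bar>}) \<longlonglongrightarrow> 0"
    by (intro prob_tendsto_zeroI) simp_all
qed

end

theorem theorem5p1:
  fixes M :: "'a measure" and X :: "nat \<Rightarrow> 'a \<Rightarrow> real"
    and p0 p0' p0'' :: "real \<Rightarrow> real"
    and D :: "real measure measure"
    and \<mu>\<^sub>H \<sigma>\<^sub>H \<alpha> p :: real
  assumes "prob_space M"
    and "prob_space.indep_vars M (\<lambda>_. borel) X {1..}"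
    and "\<And>i. i \<ge> 1 \<Longrightarrow> distributed M lborel (X i) (\<lambda>x. ennreal (p0 x))"
    and "p0 \<in> densities"
    and "\<And>x. (p0 has_real_derivative p0' x) (at x)"
    and "\<And>x. (p0' has_real_derivative p0'' x) (at x)"
    and "continuous_on UNIV p0''"
    and "sub_gaussian_tail (prob_of p0)"
    and "(\<integral>\<^sup>+x. ennreal ((p0'' x / p0 x)\<^sup>2 + (p0' x / p0 x) ^ 4) \<partial>prob_of p0) < \<infinity>"
    and "0 < \<sigma>\<^sub>H"
    and "1 < \<alpha>"
    and "is_dirichlet_process
           (scale_measure (ennreal \<alpha>) (density lborel (normal_density \<mu>\<^sub>H \<sigma>\<^sub>H))) D"
    and "1 \<le> p" and "p < 4"
  shows "\<exists>K::real. converges_in_probability M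
           (\<lambda>n \<omega>. posterior (normal_mixture_prior D (real n powr (- 1 / 5))) p0 n (\<lambda>i. X i \<omega>)
                    {q \<in> densities. abs_moment p (prob_of q) \<le> ennreal K}) 1"
proof -
  have "(\<integral>\<^sup>+x. ennreal ((p0'' x / p0 x)\<^sup>2) \<partial>prob_of p0)
      \<le> (\<integral>\<^sup>+x. ennreal ((p0'' x / p0 x)\<^sup>2 + (p0' x / p0 x) ^ 4) \<partial>prob_of p0)"
    by (intro nn_integral_mono ennreal_leI) simp
  then have W: "(\<integral>\<^sup>+x. ennreal ((p0'' x / p0 x)\<^sup>2) \<partial>prob_of p0) < \<infinity>"
    using assms(9) by (rule le_less_trans)
  interpret prob_space M by (rule assms(1))
  interpret dpm_posterior M X p0 p0' p0'' D \<mu>\<^sub>H \<sigma>\<^sub>H \<alpha>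
    by unfold_locales (fact assms W)+
  obtain K where K: "\<forall>\<^sub>F n in sequentially. \<forall>G\<in>space D - all_heavy n. abs_moment p (prob_of (mixture n G)) \<le> ennreal K"
    using moment_bound[OF assms(13,14)] by blast
  have "\<forall>\<^sub>F n in sequentially. \<forall>G\<in>space D - all_heavy n.
      mixture n G \<in> {q \<in> densities. abs_moment p (prob_of q) \<le> ennreal K}"
    using K eventually_ge_at_top[of 1]
  proof eventually_elim
    case (elim n)
    then show ?case
      using normal_mixture_density[OF _ bandwidth_pos[OF elim(2)]] by (auto simp: space_D)
  qed
  from posterior_tendsto[OF sets_moment_le this] show ?thesis by blast
qed

end
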